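(* Let $n\ge2$ and let $E,F\subset\mathbb{R}^n$ be compact sets with $\dim_H E=\dim_H F=0$. If $\dim_H E=\dim_{qH}E$ and $\dim_H F<\dim_{qH}F$, then no quasiconformal map of $\mathbb{R}^n$ sends $E$ to $F$; that is, there is no quasiconformal homeomorphism $f:\mathbb{R}^n\to\mathbb{R}^n$ with $f(E)=F$.
   Context: $\dim_H$ is Hausdorff dimension. For a bounded set $A\subset\mathbb{R}^n$ and $0<\theta<1$, the upper $\theta$-intermediate dimension $\overline{\dim}_\theta A$ is the infimum of those $s>0$ such that for each $\epsilon>0$ there exists $\delta_0>0$ so that for each $0<\delta\le\delta_0$ there is a countable covering $(A_i)$ of $A$ by subsets of $\mathbb{R}^n$ with $\delta^{1/\theta}\le\operatorname{diam}(A_i)\le\delta$ for all $i$ and $\sum_i(\operatorname{diam}A_i)^s<\epsilon$. The (upper) quasi-Hausdorff dimension is $\dim_{qH}A:=\lim_{\theta\searrow0}\overline{\dim}_\theta A$ (the limit exists by monotonicity in $\theta$). A homeomorphism $f:\Omega\to\Omega'$ between domains in $\mathbb{R}^n$, $n\ge2$, is $K$-quasiconformal ($K\ge1$) if $f\in W^{1,n}_{loc}(\Omega:\mathbb{R}^n)$ and $\|Df(x)\|^n\le K\det Df(x)$ for a.e. $x\in\Omega$ (operator norm); it is quasiconformal if it is $K$-quasiconformal for some $K\ge1$. *)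

theory Defs
  imports "HOL-Analysis.Analysis"
begin

section \<open>Hausdorff and intermediate dimensions\<close>

text \<open>
  A countable (finite or infinite) family is indexed by a set \<open>I\<close> of natural numbers; finite index
  sets matter because a positive lower bound \<open>a\<close> on the diameters excludes padding by empty sets.
  The library \<^const>\<open>diameter\<close> is only meaningful on bounded sets.
\<close>

definition diam_cover ::
  "real \<Rightarrow> real \<Rightarrow> 'a::euclidean_space set \<Rightarrow> nat set \<Rightarrow> (nat \<Rightarrow> 'a set) \<Rightarrow> bool" where
  "diam_cover a b A I U \<longleftrightarrow>
     A \<subseteq> (\<Union>i\<in>I. U i) \<and>
     (\<forall>i\<in>I. bounded (U i) \<and> a \<le> diameter (U i) \<and> diameter (U i) \<le> b)"

definition diam_sum :: "real \<Rightarrow> nat set \<Rightarrow> (nat \<Rightarrow> 'a::euclidean_space set) \<Rightarrow> ennreal" where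
  "diam_sum s I U = (\<Sum>\<^sub>\<infinity>i\<in>I. ennreal (diameter (U i) powr s))"

text \<open>
  Used for \<open>s > 0\<close> only (for \<open>s = 0\<close> the library convention \<open>0 powr 0 = 0\<close> would be the wrong one).
\<close>

definition hausdorff_measure :: "real \<Rightarrow> 'a::euclidean_space set \<Rightarrow> ennreal" where
  "hausdorff_measure s A =
     (SUP \<delta>\<in>{0<..}. INF (I, U)\<in>{(I, U). diam_cover 0 \<delta> A I U}. diam_sum s I U)"

text \<open>
  The infimum is over a nonempty set of reals, since \<open>s\<close>-dimensional Hausdorff measure vanishes
  on the whole space whenever \<open>s\<close> exceeds the dimension of the space.
\<close>

definition hausdorff_dim :: "'a::euclidean_space set \<Rightarrow> real" where
  "hausdorff_dim A = Inf {s. s > 0 \<and> hausdorff_measure s A = 0}"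

text \<open>Intended for \<open>0 < \<theta> < 1\<close> and bounded \<open>A\<close>; then the infimum is again over a nonempty set.\<close>

definition upper_intermediate_dim :: "real \<Rightarrow> 'a::euclidean_space set \<Rightarrow> real" where
  "upper_intermediate_dim \<theta> A =
     Inf {s. s > 0 \<and>
       (\<forall>\<epsilon>>0. \<exists>\<delta>\<^sub>0>0. \<forall>\<delta>. 0 < \<delta> \<and> \<delta> \<le> \<delta>\<^sub>0 \<longrightarrow>
         (\<exists>I U. diam_cover (\<delta> powr (1 / \<theta>)) \<delta> A I U \<and> diam_sum s I U < ennreal \<epsilon>))}"

definition quasi_hausdorff_dim :: "'a::euclidean_space set \<Rightarrow> real" where
  "quasi_hausdorff_dim A = Lim (at_right 0) (\<lambda>\<theta>. upper_intermediate_dim \<theta> A)"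


section \<open>Local Sobolev spaces\<close>

definition partial_deriv :: "'n::finite \<Rightarrow> (real ^ 'n \<Rightarrow> real) \<Rightarrow> real ^ 'n \<Rightarrow> real" where
  "partial_deriv i \<phi> x = frechet_derivative \<phi> (at x) (axis i 1)"

primrec C_k :: "nat \<Rightarrow> (real ^ 'n::finite \<Rightarrow> real) \<Rightarrow> bool" where
  "C_k 0 \<phi> \<longleftrightarrow> continuous_on UNIV \<phi>"
| "C_k (Suc k) \<phi> \<longleftrightarrow> \<phi> differentiable_on UNIV \<and> (\<forall>i. C_k k (partial_deriv i \<phi>))"

definition test_function :: "(real ^ 'n::finite) set \<Rightarrow> (real ^ 'n \<Rightarrow> real) \<Rightarrow> bool" where
  "test_function \<Omega> \<phi> \<longleftrightarrow>
     (\<forall>k. C_k k \<phi>) \<and> (\<exists>S. compact S \<and> S \<subseteq> \<Omega> \<and> (\<forall>x. x \<notin> S \<longrightarrow> \<phi> x = 0))"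

definition Lp_loc ::
  "real \<Rightarrow> (real ^ 'n::finite) set \<Rightarrow> (real ^ 'n \<Rightarrow> 'b::euclidean_space) \<Rightarrow> bool" where
  "Lp_loc p \<Omega> u \<longleftrightarrow>
     (\<forall>S. compact S \<and> S \<subseteq> \<Omega> \<longrightarrow>
       set_borel_measurable lebesgue S u \<and>
       set_integrable lebesgue S (\<lambda>x. norm (u x) powr p))"

definition weak_partial_deriv ::
  "(real ^ 'n::finite) set \<Rightarrow> 'n \<Rightarrow> (real ^ 'n \<Rightarrow> real) \<Rightarrow> (real ^ 'n \<Rightarrow> real) \<Rightarrow> bool" where
  "weak_partial_deriv \<Omega> i u v \<longleftrightarrow>
     Lp_loc 1 \<Omega> u \<and> Lp_loc 1 \<Omega> v \<and>
     (\<forall>\<phi>. test_function \<Omega> \<phi> \<longrightarrow>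
       (LINT x:\<Omega>|lebesgue. u x * partial_deriv i \<phi> x) = - (LINT x:\<Omega>|lebesgue. v x * \<phi> x))"

text \<open>
  \<open>Df\<close> is the matrix field whose row \<open>j\<close>, column \<open>i\<close> entry is the weak \<open>i\<close>-th partial derivative
  of the \<open>j\<close>-th component of \<open>f\<close>. It is unique up to a null set.
\<close>

definition weak_deriv ::
  "(real ^ 'n::finite) set \<Rightarrow> (real ^ 'n \<Rightarrow> real ^ 'm::finite) \<Rightarrow> (real ^ 'n \<Rightarrow> real ^ 'n ^ 'm) \<Rightarrow> bool"
  where
  "weak_deriv \<Omega> f Df \<longleftrightarrow>
     (\<forall>i j. weak_partial_deriv \<Omega> i (\<lambda>x. f x $ j) (\<lambda>x. Df x $ j $ i))"

definition W1p_loc ::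
  "real \<Rightarrow> (real ^ 'n::finite) set \<Rightarrow> (real ^ 'n \<Rightarrow> real ^ 'm::finite) \<Rightarrow> bool" where
  "W1p_loc p \<Omega> f \<longleftrightarrow> Lp_loc p \<Omega> f \<and> (\<exists>Df. weak_deriv \<Omega> f Df \<and> Lp_loc p \<Omega> Df)"


section \<open>Quasiconformal maps\<close>

definition is_domain :: "(real ^ 'n::finite) set \<Rightarrow> bool" where
  "is_domain \<Omega> \<longleftrightarrow> open \<Omega> \<and> connected \<Omega> \<and> \<Omega> \<noteq> {}"

text \<open>
  As the weak derivative is unique almost everywhere, it is immaterial which version \<open>Df\<close> of it
  satisfies the distortion inequality.
\<close>

definition K_quasiconformal ::
  "real \<Rightarrow> (real ^ 'n::finite) set \<Rightarrow> (real ^ 'n) set \<Rightarrow> (real ^ 'n \<Rightarrow> real ^ 'n) \<Rightarrow> bool" where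
  "K_quasiconformal K \<Omega> \<Omega>' f \<longleftrightarrow>
     K \<ge> 1 \<and> is_domain \<Omega> \<and> is_domain \<Omega>' \<and> (\<exists>g. homeomorphism \<Omega> \<Omega>' f g) \<and>
     W1p_loc (real CARD('n)) \<Omega> f \<and>
     (\<exists>Df. weak_deriv \<Omega> f Df \<and>
       (AE x in lebesgue. x \<in> \<Omega> \<longrightarrow> onorm (\<lambda>h. Df x *v h) ^ CARD('n) \<le> K * det (Df x)))"

definition quasiconformal ::
  "(real ^ 'n::finite) set \<Rightarrow> (real ^ 'n) set \<Rightarrow> (real ^ 'n \<Rightarrow> real ^ 'n) \<Rightarrow> bool" where
  "quasiconformal \<Omega> \<Omega>' f \<longleftrightarrow> (\<exists>K\<ge>1. K_quasiconformal K \<Omega> \<Omega>' f)"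

end

theory Submission
  imports Defs
begin

text \<open>
  A quasiconformal map \<open>f\<close> is locally Hoelder continuous, and a Hoelder map of exponent \<open>\<alpha>\<close> multiplies
  the intermediate dimensions of a bounded set by at most \<open>1 / \<alpha>\<close>: a cover of \<open>E\<close> with diameters in
  \<open>[\<delta> powr (1 / \<theta>), \<delta>]\<close> is turned into a cover of \<open>f ` E\<close> of the same kind by enlarging the images of
  its members to balls. So \<open>f\<close> cannot raise quasi-Hausdorff dimension \<open>0\<close> to a positive value.

  The Hoelder continuity is Widman's hole filling. Let \<open>n\<close> be the dimension, \<open>Q\<close> the cube of radius
  \<open>r\<close>, \<open>2Q\<close> the concentric cube of radius \<open>2r\<close>, and \<open>\<eta>\<close> a cutoff function between them. For smooth
  \<open>u\<close> the Jacobian of \<open>\<eta> (u - c)\<close> has integral \<open>0\<close>, equals \<open>det Du\<close> on \<open>Q\<close>, and is bounded by a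
  multiple of \<open>\<bar>Du\<bar>^n + (\<bar>u - c\<bar> / r)^n\<close> on \<open>2Q - Q\<close>; by a Poincare inequality on this annulus,
  \<open>det Du\<close> has integral over \<open>Q\<close> at most a multiple of the integral of \<open>\<bar>Du\<bar>^n\<close> over \<open>2Q - Q\<close>.
  Mollification carries this over to \<open>f\<close>, where the distortion inequality bounds the integral \<open>D r\<close> of
  \<open>\<bar>Df\<bar>^n\<close> over \<open>Q\<close> by a multiple of \<open>D (2r) - D r\<close>. Hence \<open>D\<close> decays geometrically along dyadic
  radii, and comparing the averages of \<open>f\<close> over dyadic cubes gives the Hoelder estimate.
\<close>

section \<open>Mollifiers\<close>

text \<open>Membership in W^{1,n} gives no classical derivative, so the Jacobian identity is proved
  for C1 maps and reaches \<open>f\<close> by approximation. This works because det is homogeneous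
  of degree n: convergence of the derivatives in L^n on cubes gives convergence of the Jacobians in
  L^1. The exponent n also makes |Du|^n and (|u - c| / r)^n scale alike, so the decay factor is the
  same at every scale; that is what produces a power of the distance.

  Integrating along segments to get the Poincare inequality needs convexity, and the annulus is not
  convex. The inequality is therefore stated for the double integral of |u x - u z|^n over two sets:
  it involves no mean value, increases with the sets, and can be chained through a third set. The
  constant c is then averaged over the values of u instead of being chosen.

  The Hoelder exponent \<alpha> depends on the distortion, but any positive one suffices:
  quasi-Hausdorff dimension 0 becomes at most 0 / \<alpha> = 0.\<close>

definition flat_exp :: "real poly \<Rightarrow> real \<Rightarrow> real" where
  "flat_exp p t = (if t > 0 then poly p (inverse t) * exp (- inverse t) else 0)"

lemma poly_times_exp_neg_tendsto_0: "((\<lambda>y. poly p y * exp (- y)) \<longlongrightarrow> (0::real)) at_top"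
proof -
  have "((\<lambda>y. \<Sum>i\<le>degree p. coeff p i * (y ^ i / exp y)) \<longlongrightarrow> (\<Sum>i\<le>degree p. coeff p i * 0)) at_top"
    by (intro tendsto_sum tendsto_mult tendsto_const tendsto_power_div_exp_0)
  moreover have "(\<Sum>i\<le>degree p. coeff p i * (y ^ i / exp y)) = poly p y * exp (- y)" for y
    by (simp add: poly_altdef sum_distrib_right sum_distrib_left exp_minus divide_inverse mult_ac)
  ultimately show ?thesis by simp
qed

text \<open>The parameter \<open>p\<close> is what closes the family under differentiation: for t >
  0 the derivative of p(1/t) exp(-1/t) is (1/t)^2 (p - p')(1/t) exp(-1/t), and
  \<open>[:0, 0, 1:]\<close> is the square of the variable. Only t = 0 needs an argument.\<close>

lemma has_derivative_flat_exp:
  "(flat_exp p has_field_derivative flat_exp ([:0, 0, 1:] * (p - pderiv p)) t) (at t)"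
proof -
  consider "t > 0" | "t < 0" | "t = 0" by linarith
  then show ?thesis
  proof cases
    case 1
    have ev: "eventually (\<lambda>s. s \<in> {0<..}) (nhds t)"
      using 1 by (intro eventually_nhds_in_open) auto
    have "((\<lambda>s. poly p (inverse s) * exp (- inverse s)) has_field_derivative
        flat_exp ([:0, 0, 1:] * (p - pderiv p)) t) (at t)"
      using 1 by (auto intro!: derivative_eq_intros DERIV_chain2[OF poly_DERIV]
          simp: flat_exp_def field_simps power2_eq_square)
    then show ?thesis
      by (rule DERIV_cong_ev[THEN iffD2, rotated -1])
        (use ev in \<open>auto elim!: eventually_mono simp: flat_exp_def\<close>)
  next
    case 2
    have ev: "eventually (\<lambda>s. s \<in> {..<0}) (nhds t)"
      using 2 by (intro eventually_nhds_in_open) auto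
    have "((\<lambda>s. 0) has_field_derivative flat_exp ([:0, 0, 1:] * (p - pderiv p)) t) (at t)"
      using 2 by (simp add: flat_exp_def)
    then show ?thesis
      by (rule DERIV_cong_ev[THEN iffD2, rotated -1])
        (use ev in \<open>auto elim!: eventually_mono simp: flat_exp_def\<close>)
  next
    case 3
    have "((\<lambda>h. flat_exp p h / h) \<longlongrightarrow> 0) (at_right 0)"
    proof (rule Lim_transform_eventually)
      \<comment> \<open>Dividing by h multiplies the polynomial in 1/h by its variable, hence
        \<open>pCons 0 p\<close>; the limit is that of a polynomial in y times exp(-y) as y tends to
        infinity.\<close>
      show "((\<lambda>h. poly (pCons 0 p) (inverse h) * exp (- inverse h)) \<longlongrightarrow> 0) (at_right 0)"
        by (rule filterlim_compose[OF poly_times_exp_neg_tendsto_0 filterlim_inverse_at_top_right])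
      show "\<forall>\<^sub>F h in at_right 0. poly (pCons 0 p) (inverse h) * exp (- inverse h) = flat_exp p h / h"
        unfolding eventually_at_filter
        by (rule always_eventually) (auto simp: flat_exp_def field_simps)
    qed
    moreover have "((\<lambda>h. flat_exp p h / h) \<longlongrightarrow> 0) (at_left 0)"
      by (rule Lim_transform_eventually[OF tendsto_const])
        (auto simp: eventually_at_filter flat_exp_def intro!: always_eventually)
    ultimately have "((\<lambda>h. flat_exp p h / h) \<longlongrightarrow> 0) (at 0)"
      by (simp add: filterlim_split_at)
    then show ?thesis
      using 3 by (simp add: DERIV_def flat_exp_def)
  qed
qed

lemma flat_exp_nonneg_1: "flat_exp 1 t \<ge> 0"
  by (simp add: flat_exp_def)

lemma flat_exp_1_eq_0_iff: "flat_exp 1 t = 0 \<longleftrightarrow> t \<le> 0"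
  by (simp add: flat_exp_def)

text \<open>An algebra of functions closed under partial derivatives, hence consisting of smooth functions.\<close>

inductive_set bump_algebra :: "(real ^ 'n::finite \<Rightarrow> real) set" where
  base: "(\<lambda>x. flat_exp p (a * x $ i + b)) \<in> bump_algebra"
| const: "(\<lambda>x. c) \<in> bump_algebra"
| add: "\<phi> \<in> bump_algebra \<Longrightarrow> \<psi> \<in> bump_algebra \<Longrightarrow> (\<lambda>x. \<phi> x + \<psi> x) \<in> bump_algebra"
| mult: "\<phi> \<in> bump_algebra \<Longrightarrow> \<psi> \<in> bump_algebra \<Longrightarrow> (\<lambda>x. \<phi> x * \<psi> x) \<in> bump_algebra"

lemma bump_algebra_prod:
  "finite I \<Longrightarrow> (\<And>i. i \<in> I \<Longrightarrow> \<phi> i \<in> bump_algebra) \<Longrightarrow> (\<lambda>x. \<Prod>i\<in>I. \<phi> i x) \<in> bump_algebra"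
proof (induction I rule: finite_induct)
  case empty
  then show ?case by (simp add: bump_algebra.const)
next
  case (insert j I)
  then show ?case by (auto intro: bump_algebra.mult)
qed

lemma partial_deriv_eq:
  assumes "(\<phi> has_derivative \<phi>') (at x)"
  shows "partial_deriv i \<phi> x = \<phi>' (axis i 1)"
  using frechet_derivative_at[OF assms] by (simp add: partial_deriv_def)

lemma bump_algebra_partial_deriv:
  assumes "\<phi> \<in> bump_algebra"
  shows "(\<forall>x. \<phi> differentiable (at x)) \<and> (\<forall>i. partial_deriv i \<phi> \<in> bump_algebra)"
  using assms
proof induction
  case (base p a i b)
  have d: "((\<lambda>x. flat_exp p (a * x $ i + b)) has_derivative
      (\<lambda>h. flat_exp ([:0, 0, 1:] * (p - pderiv p)) (a * x $ i + b) * (a * h $ i))) (at x)" for x :: "real ^ 'a"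
    by (rule has_derivative_compose[OF _ has_derivative_flat_exp[unfolded has_field_derivative_def],
        where f = "\<lambda>x. a * x $ i + b"])
      (auto intro!: derivative_eq_intros bounded_linear_imp_has_derivative[OF bounded_linear_vec_nth])
  have "partial_deriv j (\<lambda>x. flat_exp p (a * x $ i + b)) =
    (\<lambda>x. flat_exp ([:0, 0, 1:] * (p - pderiv p)) (a * x $ i + b) * (a * axis j 1 $ i))" for j
    using partial_deriv_eq[OF d] by blast
  then show ?case
    using d by (auto simp: differentiable_def simp del: mult_pCons_left intro!: bump_algebra.intros)
next
  case (const c)
  have d: "((\<lambda>x. c) has_derivative (\<lambda>h. 0)) (at x)" for x :: "real ^ 'a"
    by simp
  have "partial_deriv j (\<lambda>x. c) = (\<lambda>x::real ^ 'a. 0)" for j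
    using partial_deriv_eq[OF d] by blast
  then show ?case using d by (auto simp: bump_algebra.const)
next
  case (add \<phi> \<psi>)
  have d: "(\<phi> has_derivative frechet_derivative \<phi> (at x)) (at x)"
    "(\<psi> has_derivative frechet_derivative \<psi> (at x)) (at x)" for x
    using add.IH by (auto simp: frechet_derivative_works)
  have "partial_deriv j (\<lambda>x. \<phi> x + \<psi> x) = (\<lambda>x. partial_deriv j \<phi> x + partial_deriv j \<psi> x)" for j
    using partial_deriv_eq[OF has_derivative_add[OF d]] by (auto simp: partial_deriv_def)
  then show ?case using add.IH by (auto intro!: bump_algebra.add)
next
  case (mult \<phi> \<psi>)
  have d: "(\<phi> has_derivative frechet_derivative \<phi> (at x)) (at x)"
    "(\<psi> has_derivative frechet_derivative \<psi> (at x)) (at x)" for x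
    using mult.IH by (auto simp: frechet_derivative_works)
  have "partial_deriv j (\<lambda>x. \<phi> x * \<psi> x) =
    (\<lambda>x. \<phi> x * partial_deriv j \<psi> x + partial_deriv j \<phi> x * \<psi> x)" for j
    using partial_deriv_eq[OF has_derivative_mult[OF d]] by (auto simp: partial_deriv_def)
  then show ?case using mult by (auto intro!: bump_algebra.add bump_algebra.mult)
qed

lemma bump_algebra_C_k: "\<phi> \<in> bump_algebra \<Longrightarrow> C_k k \<phi>"
proof (induction k arbitrary: \<phi>)
  case 0
  then show ?case
    using bump_algebra_partial_deriv[OF 0]
    by (auto intro!: continuous_at_imp_continuous_on differentiable_imp_continuous_within)
next
  case (Suc k)
  then show ?case
    using bump_algebra_partial_deriv[OF Suc.prems]
    by (auto intro!: differentiable_at_imp_differentiable_on)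
qed

lemma C_k_1_has_derivative:
  assumes "C_k 1 \<phi>"
  shows "(\<phi> has_derivative (\<lambda>h. \<Sum>i\<in>UNIV. partial_deriv i \<phi> x * h $ i)) (at x)"
    and "continuous_on UNIV (partial_deriv i \<phi>)"
proof -
  have d: "(\<phi> has_derivative frechet_derivative \<phi> (at x)) (at x)"
    using assms by (auto simp: differentiable_on_def frechet_derivative_works)
  interpret linear "frechet_derivative \<phi> (at x)"
    using d by (rule has_derivative_linear)
  have "frechet_derivative \<phi> (at x) h = (\<Sum>i\<in>UNIV. partial_deriv i \<phi> x * h $ i)" for h
  proof -
    have "frechet_derivative \<phi> (at x) h = frechet_derivative \<phi> (at x) (\<Sum>i\<in>UNIV. h $ i *s axis i 1)"
      by (simp add: basis_expansion)
    also have "\<dots> = (\<Sum>i\<in>UNIV. partial_deriv i \<phi> x * h $ i)"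
      by (simp add: sum scale partial_deriv_def scalar_mult_eq_scaleR mult.commute)
    finally show ?thesis .
  qed
  then show "(\<phi> has_derivative (\<lambda>h. \<Sum>i\<in>UNIV. partial_deriv i \<phi> x * h $ i)) (at x)"
    using d by presburger
  show "continuous_on UNIV (partial_deriv i \<phi>)"
    using assms by simp
qed

text \<open>The support lies in a cube, in keeping with the cubes used throughout. The last clause
  concerns y \<mapsto> \<open>\<rho> (x - y)\<close> because this is the function inserted into the
  definition of the weak derivative.\<close>

definition mollifier :: "real \<Rightarrow> (real ^ 'n::finite \<Rightarrow> real) \<Rightarrow> bool" where
  "mollifier \<epsilon> \<rho> \<longleftrightarrow> (\<forall>x. \<rho> x \<ge> 0) \<and> (\<forall>x i. \<bar>x $ i\<bar> \<ge> \<epsilon> \<longrightarrow> \<rho> x = 0) \<and>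
     integrable lborel \<rho> \<and> integral\<^sup>L lborel \<rho> = 1 \<and> C_k 1 \<rho> \<and> (\<forall>x. test_function UNIV (\<lambda>y. \<rho> (x - y)))"

lemma cbox_const_vec: "cbox (\<chi> i. a) (\<chi> i. b) = {x::real^'n::finite. \<forall>i. a \<le> x $ i \<and> x $ i \<le> b}"
  by (auto simp: mem_box_cart)

lemma mollifier_exists:
  assumes "\<epsilon> > 0"
  shows "\<exists>\<rho> :: real ^ 'n::finite \<Rightarrow> real. mollifier \<epsilon> \<rho>"
proof -
  \<comment> \<open>Coordinate i contributes flat functions of 1 + x_i / \<epsilon> and 1 - x_i /
    \<epsilon>, so the product is positive exactly where every |x_i| is below \<epsilon>.\<close>
  define \<psi> :: "real ^ 'n \<Rightarrow> real" where
    "\<psi> x = (\<Prod>i\<in>UNIV. flat_exp 1 (1 / \<epsilon> * x $ i + 1) * flat_exp 1 (- 1 / \<epsilon> * x $ i + 1))" for x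
  have nonneg: "\<psi> x \<ge> 0" for x
    unfolding \<psi>_def by (intro prod_nonneg mult_nonneg_nonneg flat_exp_nonneg_1)
  have supp: "\<psi> x = 0" if "\<bar>x $ i\<bar> \<ge> \<epsilon>" for x i
  proof -
    have "1 / \<epsilon> * x $ i + 1 \<le> 0 \<or> - 1 / \<epsilon> * x $ i + 1 \<le> 0"
      using that assms by (auto simp: field_simps abs_if split: if_splits)
    then show ?thesis
      unfolding \<psi>_def by (intro prod_zero) (auto simp: flat_exp_1_eq_0_iff simp del: mult_minus_left)
  qed
  have pos: "\<psi> 0 > 0"
    unfolding \<psi>_def by (intro prod_pos mult_pos_pos) (auto simp: flat_exp_def)
  have alg: "\<psi> \<in> bump_algebra"
    unfolding \<psi>_def[abs_def] by (intro bump_algebra_prod bump_algebra.mult bump_algebra.base) auto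
  have cont: "continuous_on UNIV \<psi>"
    using bump_algebra_C_k[OF alg, of 0] by simp
  define B where "B = cbox (\<chi> i::'n. -\<epsilon>) (\<chi> i. \<epsilon>)"
  have out: "\<psi> x = 0" if "x \<notin> B" for x
  proof -
    obtain i where "\<bar>x $ i\<bar> \<ge> \<epsilon>"
      using \<open>x \<notin> B\<close> unfolding B_def cbox_const_vec by (auto simp: abs_if not_le) (smt (verit))+
    then show ?thesis by (rule supp)
  qed
  have eqB: "(\<lambda>x. indicator B x *\<^sub>R \<psi> x) = \<psi>"
    using out by (intro ext) (auto simp: indicator_def)
  have "set_integrable lborel B \<psi>"
    unfolding B_def set_integrable_def by (intro borel_integrable_compact continuous_on_subset[OF cont]) auto
  then have int: "integrable lborel \<psi>"
    unfolding set_integrable_def eqB .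
  define c where "c = integral\<^sup>L lborel \<psi>"
  have "c > 0"
  proof -
    have op: "open {x. \<psi> x > 0}"
      using cont by (intro open_Collect_less) auto
    have "c \<noteq> 0"
    proof
      assume "c = 0"
      then have "AE x in lborel. \<psi> x = 0"
        using integral_nonneg_eq_0_iff_AE[OF int] nonneg by (auto simp: c_def)
      then have "AE x in lborel. x \<notin> {x. \<psi> x > 0}"
        by eventually_elim auto
      then have "{x. \<psi> x > 0} \<in> null_sets lborel"
        using op by (subst AE_iff_null_sets) (auto intro: borel_open)
      then have "negligible {x. \<psi> x > 0}"
        by (simp add: negligible_iff_null_sets null_sets_completionI)
      then show False
        using open_not_negligible[OF op] pos by auto
    qed
    moreover have "c \<ge> 0" unfolding c_def using nonneg by simp
    ultimately show ?thesis by simp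
  qed
  define \<rho> where "\<rho> x = inverse c * \<psi> x" for x
  have test: "test_function UNIV (\<lambda>y. \<rho> (x - y))" for x
  proof -
    \<comment> \<open>Both arguments are rewritten as affine functions of a coordinate of y, the
      form that \<open>bump_algebra.base\<close> accepts.\<close>
    have e: "flat_exp 1 (1 / \<epsilon> * (x - y) $ i + 1) = flat_exp 1 ((- 1 / \<epsilon>) * y $ i + (1 / \<epsilon> * x $ i + 1))"
      "flat_exp 1 (- 1 / \<epsilon> * (x - y) $ i + 1) = flat_exp 1 ((1 / \<epsilon>) * y $ i + (- 1 / \<epsilon> * x $ i + 1))" for y i
      by (auto simp: algebra_simps diff_divide_distrib)
    have "(\<lambda>y. \<rho> (x - y)) \<in> bump_algebra"
      unfolding \<rho>_def \<psi>_def e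
      by (intro bump_algebra.mult bump_algebra.const bump_algebra_prod bump_algebra.base) auto
    moreover have "\<rho> (x - y) = 0" if "y \<notin> cbox (x - (\<chi> i. \<epsilon>)) (x + (\<chi> i. \<epsilon>))" for y
    proof -
      have "x - y \<notin> B"
        using that by (auto simp: B_def mem_box_cart algebra_simps)
      then show ?thesis by (simp add: \<rho>_def out)
    qed
    ultimately show ?thesis
      unfolding test_function_def
      by (intro conjI allI exI[of _ "cbox (x - (\<chi> i. \<epsilon>)) (x + (\<chi> i. \<epsilon>))"]) (auto intro: bump_algebra_C_k)
  qed
  have "C_k 1 \<rho>"
    unfolding \<rho>_def[abs_def] by (intro bump_algebra_C_k bump_algebra.mult bump_algebra.const alg)
  then have "mollifier \<epsilon> \<rho>"
    unfolding mollifier_def using \<open>c > 0\<close> nonneg supp int test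
    by (auto simp: \<rho>_def[abs_def] c_def less_imp_le simp del: C_k.simps)
  then show ?thesis by blast
qed

section \<open>The integral of a compactly supported Jacobian\<close>

text \<open>The factors are exchanged one at a time; each exchange costs at most \<open>d\<close>
  and leaves \<open>card I - 1\<close> factors bounded by \<open>m\<close>. For empty
  \<open>I\<close> both sides are 0.\<close>

lemma abs_prod_diff_le:
  fixes a b :: "'i \<Rightarrow> real"
  assumes "finite I" "\<And>i. i \<in> I \<Longrightarrow> \<bar>a i\<bar> \<le> m" "\<And>i. i \<in> I \<Longrightarrow> \<bar>b i\<bar> \<le> m"
    "\<And>i. i \<in> I \<Longrightarrow> \<bar>a i - b i\<bar> \<le> d" "m \<ge> 0" "d \<ge> 0"
  shows "\<bar>prod a I - prod b I\<bar> \<le> real (card I) * d * m ^ (card I - 1)"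
  using assms(1-4)
proof (induction I rule: finite_induct)
  case empty
  then show ?case by simp
next
  case (insert j I)
  let ?k = "card I"
  have IH: "\<bar>prod a I - prod b I\<bar> \<le> real ?k * d * m ^ (?k - 1)"
    using insert by auto
  have pa: "\<bar>prod a I\<bar> \<le> m ^ ?k"
    unfolding abs_prod using insert.prems prod_mono[of I "\<lambda>i. \<bar>a i\<bar>" "\<lambda>i. m"] by (auto simp: abs_ge_zero)
  have "\<bar>a j * prod a I - b j * prod b I\<bar> = \<bar>(a j - b j) * prod a I + b j * (prod a I - prod b I)\<bar>"
    by (simp add: algebra_simps)
  also have "\<dots> \<le> \<bar>a j - b j\<bar> * \<bar>prod a I\<bar> + \<bar>b j\<bar> * \<bar>prod a I - prod b I\<bar>"
    by (metis abs_mult abs_triangle_ineq)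
  also have "\<dots> \<le> d * m ^ ?k + m * (real ?k * d * m ^ (?k - 1))"
    using insert.prems pa IH assms(5,6) by (intro add_mono mult_mono) auto
  also have "m * (real ?k * d * m ^ (?k - 1)) = real ?k * d * m ^ ?k"
    using insert.hyps(1) by (cases ?k) auto
  finally show ?case
    using insert.hyps by (simp add: algebra_simps)
qed

lemma abs_matrix_nth_le: "\<bar>A $ i $ j\<bar> \<le> norm (A :: real ^ 'n ^ 'm)"
  using component_le_norm_cart[of "A $ i" j] Finite_Cartesian_Product.norm_nth_le[of A i] by simp

text \<open>The Leibniz formula has \<open>fact n\<close> terms, each a product of n entries, and
  entries are bounded by the norm. Through \<open>abs_det_diff_le_eps\<close> the factor
  \<open>norm (A - B)\<close> later turns L^n convergence of derivatives into L^1 convergence of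
  Jacobians.\<close>

lemma abs_det_diff_le:
  fixes A B :: "real ^ 'n ^ 'n"
  assumes "norm A \<le> m" "norm B \<le> m"
  shows "\<bar>det A - det B\<bar> \<le> fact (CARD('n)) * (CARD('n) * norm (A - B) * m ^ (CARD('n) - 1))"
proof -
  let ?P = "{p. p permutes (UNIV :: 'n set)}"
  have m: "m \<ge> 0" using assms norm_ge_zero order_trans by blast
  have "\<bar>det A - det B\<bar> =
    \<bar>\<Sum>p\<in>?P. of_int (sign p) * ((\<Prod>i\<in>UNIV. A $ i $ p i) - (\<Prod>i\<in>UNIV. B $ i $ p i))\<bar>"
    by (simp add: det_def sum_subtractf right_diff_distrib)
  also have "\<dots> \<le> (\<Sum>p\<in>?P. \<bar>of_int (sign p) * ((\<Prod>i\<in>UNIV. A $ i $ p i) - (\<Prod>i\<in>UNIV. B $ i $ p i))\<bar>)"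
    by (rule sum_abs)
  also have "\<dots> \<le> (\<Sum>p\<in>?P. CARD('n) * norm (A - B) * m ^ (CARD('n) - 1))"
  proof (rule sum_mono)
    fix p
    have "\<bar>of_int (sign p) * ((\<Prod>i\<in>UNIV. A $ i $ p i) - (\<Prod>i\<in>UNIV. B $ i $ p i))\<bar>
      = \<bar>(\<Prod>i\<in>UNIV. A $ i $ p i) - (\<Prod>i\<in>UNIV. B $ i $ p i)\<bar>"
      by (simp add: abs_mult flip: of_int_abs)
    also have "\<dots> \<le> CARD('n) * norm (A - B) * m ^ (CARD('n) - 1)"
    proof (rule abs_prod_diff_le)
      show "\<bar>A $ i $ p i - B $ i $ p i\<bar> \<le> norm (A - B)" for i
        using abs_matrix_nth_le[of "A - B" i "p i"] by simp
      show "\<bar>A $ i $ p i\<bar> \<le> m" "\<bar>B $ i $ p i\<bar> \<le> m" for i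
        using abs_matrix_nth_le[of A i "p i"] abs_matrix_nth_le[of B i "p i"] assms by linarith+
    qed (use m in auto)
    finally show "\<bar>of_int (sign p) * ((\<Prod>i\<in>UNIV. A $ i $ p i) - (\<Prod>i\<in>UNIV. B $ i $ p i))\<bar>
      \<le> CARD('n) * norm (A - B) * m ^ (CARD('n) - 1)" .
  qed
  also have "\<dots> = fact (CARD('n)) * (CARD('n) * norm (A - B) * m ^ (CARD('n) - 1))"
    by (simp add: card_permutations[OF refl]) 
  finally show ?thesis .
qed

lemma abs_det_le:
  fixes A :: "real ^ 'n ^ 'n"
  shows "\<bar>det A\<bar> \<le> fact (CARD('n)) * CARD('n) * norm A ^ CARD('n)"
proof -
  have "norm A * norm A ^ (CARD('n) - 1) = norm A ^ CARD('n)"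
    by (metis One_nat_def Suc_pred power_Suc zero_less_card_finite)
  moreover have "det (0 :: real ^ 'n ^ 'n) = 0"
    by (simp add: det_0[unfolded mat_0[symmetric], simplified] flip: mat_0)
  ultimately show ?thesis
    using abs_det_diff_le[of A "norm A" 0] by (simp add: mult.assoc)
qed

lemma continuous_on_det [continuous_intros]:
  fixes F :: "'a::topological_space \<Rightarrow> real ^ 'n ^ 'n"
  assumes "continuous_on S F"
  shows "continuous_on S (\<lambda>x. det (F x))"
  unfolding det_def by (intro continuous_intros assms)

text \<open>The norm of a matrix is here the Frobenius norm, so this is the Cauchy-Schwarz
  inequality applied to each row.\<close>

lemma norm_matrix_vector_mult_le: "norm (A *v x) \<le> norm A * norm (x :: real ^ 'n)"
  for A :: "real ^ 'n ^ 'm"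
proof -
  have "norm (A *v x) = L2_set (\<lambda>i. \<bar>A $ i \<bullet> x\<bar>) UNIV"
    by (simp add: norm_vec_def matrix_vector_mul_component)
  also have "\<dots> \<le> L2_set (\<lambda>i. norm (A $ i) * norm x) UNIV"
    by (intro L2_set_mono Cauchy_Schwarz_ineq2) auto
  also have "\<dots> = norm A * norm x"
    by (simp add: norm_vec_def L2_set_left_distrib)
  finally show ?thesis .
qed

text \<open>Every row contributes either t A or the identity, and \<open>T\<close> collects the rows
  of the first kind. The term of \<open>T = UNIV\<close> is t^n det A.\<close>

lemma det_mat_1_add_scaled:
  fixes A :: "real ^ 'n ^ 'n"
  shows "det (mat 1 + t *\<^sub>R A) = (\<Sum>T\<in>UNIV. t ^ card T *
    (\<Sum>p | p permutes UNIV. of_int (sign p) *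
      ((\<Prod>i\<in>T. A $ i $ p i) * (\<Prod>i\<in>-T. mat 1 $ i $ p i))))"
proof -
  have "(\<Prod>i\<in>UNIV. (mat 1 + t *\<^sub>R A) $ i $ p i) =
      (\<Sum>T\<in>UNIV. t ^ card T * ((\<Prod>i\<in>T. A $ i $ p i) * (\<Prod>i\<in>-T. mat 1 $ i $ p i)))" for p
  proof -
    have "(\<Prod>i\<in>UNIV. (mat 1 + t *\<^sub>R A) $ i $ p i) = (\<Prod>i\<in>UNIV. t * A $ i $ p i + mat 1 $ i $ p i)"
      by (simp add: add.commute)
    also have "\<dots> = (\<Sum>T\<in>Pow UNIV. (\<Prod>i\<in>T. t * A $ i $ p i) * (\<Prod>i\<in>UNIV - T. mat 1 $ i $ p i))"
      by (rule prod_add) simp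
    finally show ?thesis
      by (simp add: prod.distrib Compl_eq_Diff_UNIV mult.assoc)
  qed
  then have "det (mat 1 + t *\<^sub>R A) = (\<Sum>p | p permutes UNIV. \<Sum>T\<in>UNIV. t ^ card T *
      (of_int (sign p) * ((\<Prod>i\<in>T. A $ i $ p i) * (\<Prod>i\<in>-T. mat 1 $ i $ p i))))"
    unfolding det_def by (simp only: sum_distrib_left mult.left_commute)
  also have "\<dots> = (\<Sum>T\<in>UNIV. \<Sum>p | p permutes UNIV. t ^ card T *
      (of_int (sign p) * ((\<Prod>i\<in>T. A $ i $ p i) * (\<Prod>i\<in>-T. mat 1 $ i $ p i))))"
    by (rule sum.swap)
  finally show ?thesis by (simp only: sum_distrib_left)
qed

text \<open>
  For small \<open>t > 0\<close> the map \<open>x \<mapsto> x + t v x\<close> is a bijection of the box onto itself, so the integral of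
  \<open>det (mat 1 + t Dv)\<close> does not depend on \<open>t\<close>. It is a polynomial in \<open>t\<close> whose coefficient of
  degree \<open>CARD('n)\<close> is the integral of \<open>det Dv\<close>.
\<close>

lemma integral_det_eq_0_wellorder:
  fixes v :: "real ^ 'n::{finite,wellorder} \<Rightarrow> real ^ 'n::_"
  assumes der: "\<And>x. (v has_derivative (\<lambda>h. Dv x *v h)) (at x)"
    and cont: "continuous_on UNIV Dv"
    and v0: "\<And>x. x \<notin> cbox a b \<Longrightarrow> v x = 0"
  shows "integral (cbox a b) (\<lambda>x. det (Dv x)) = 0"
proof -
  define n where "n = CARD('n)"
  have n: "n > 0" by (simp add: n_def)
  define S where "S = cbox a b"
  have intd: "(\<lambda>x. det (mat 1 + t *\<^sub>R Dv x)) integrable_on S" for t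
    unfolding S_def by (intro integrable_continuous continuous_intros continuous_on_subset[OF cont]) auto
  have "bounded (Dv ` S)"
    unfolding S_def by (intro compact_imp_bounded compact_continuous_image continuous_on_subset[OF cont]) auto
  then obtain M where M: "M > 0" "\<And>x. x \<in> S \<Longrightarrow> norm (Dv x) \<le> M"
    unfolding bounded_pos by auto
  have Dv0: "Dv x = 0" if "x \<notin> S" for x
  proof -
    have "open (- S)" "x \<in> - S" using that by (auto simp: S_def open_Compl)
    then have "((\<lambda>x. 0) has_derivative (\<lambda>h. Dv x *v h)) (at x)"
      by (intro has_derivative_transform_within_open[OF der]) (auto simp: S_def v0)
    then have "(\<lambda>h. Dv x *v h) = (\<lambda>h. 0)"
      by (intro has_derivative_unique[OF _ has_derivative_const])
    then show ?thesis by (metis matrix_eq matrix_vector_mult_0)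
  qed
  then have M': "norm (Dv x) \<le> M" for x using M by (cases "x \<in> S") auto
  have lip: "norm (v x - v y) \<le> M * norm (x - y)" for x y
  proof (rule differentiable_bound[OF convex_UNIV])
    show "(v has_derivative (\<lambda>h. Dv x *v h)) (at x within UNIV)" for x using der by simp
    show "onorm (\<lambda>h. Dv x *v h) \<le> M" for x
    proof (rule onorm_le)
      fix h
      have "norm (Dv x *v h) \<le> norm (Dv x) * norm h" by (rule norm_matrix_vector_mult_le)
      also have "\<dots> \<le> M * norm h" using M' by (intro mult_right_mono) auto
      finally show "norm (Dv x *v h) \<le> M * norm h" .
    qed
  qed auto
  \<comment> \<open>\<open>m\<close> bounds the norms of \<open>mat 1\<close> and of mat 1 + t Dv as
    soon as t M < 1/2; then t \<open>c\<close> bounds the difference of their determinants.\<close>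
  define m where "m = norm (mat 1 :: real ^ 'n::_ ^ 'n::_) + 1"
  define c where "c = fact n * (n * M * m ^ (n - 1))"
  have "m > 0" unfolding m_def by (simp add: add_nonneg_pos)
  then have "c > 0" using n M by (simp add: c_def)
  define t0 where "t0 = min (1 / (2 * M)) (1 / (2 * c))"
  have "t0 > 0" using M \<open>c > 0\<close> by (simp add: t0_def)
  define q where "q t = integral S (\<lambda>x. det (mat 1 + t *\<^sub>R Dv x))" for t
  have q_eq: "q t = measure lebesgue S" if t: "0 < t" "t < t0" for t
  proof -
    have tM: "t * M < 1 / 2" and tc: "t * c < 1 / 2"
      using t M \<open>c > 0\<close> by (auto simp: t0_def field_simps)
    define g where "g x = x + t *\<^sub>R v x" for x
    have derg: "(g has_derivative (\<lambda>h. (mat 1 + t *\<^sub>R Dv x) *v h)) (at x)" for x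
      unfolding g_def
      by (auto intro!: derivative_eq_intros der simp: matrix_vector_mult_add_rdistrib scaleR_matrix_vector_assoc)
    have lipt: "norm (t *\<^sub>R v x - t *\<^sub>R v y) \<le> 1 / 2 * norm (x - y)" for x y
    proof -
      have "norm (t *\<^sub>R v x - t *\<^sub>R v y) = t * norm (v x - v y)"
        using t by (simp flip: scaleR_diff_right)
      also have "\<dots> \<le> t * (M * norm (x - y))" using t lip by simp
      also have "\<dots> = (t * M) * norm (x - y)" by simp
      also have "\<dots> \<le> 1 / 2 * norm (x - y)" using tM by (intro mult_right_mono) auto
      finally show ?thesis .
    qed
    have inj: "inj g"
    proof (rule injI)
      fix x y assume "g x = g y"
      then have "x - y = - (t *\<^sub>R v x - t *\<^sub>R v y)" by (simp add: g_def algebra_simps)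
      then have "norm (x - y) \<le> 1 / 2 * norm (x - y)" using lipt[of x y] by (metis norm_minus_cancel)
      then show "x = y" by simp
    qed
    \<comment> \<open>\<open>g\<close> is the identity outside \<open>S\<close>. Being injective, it
      therefore maps no point of \<open>S\<close> outside, and the solution x of g x = y given by
      the contraction principle lies in \<open>S\<close> when y does.\<close>
    have gS: "g ` S = S"
    proof (rule set_eqI iffI)+
      fix y assume "y \<in> g ` S"
      then obtain x where x: "x \<in> S" "y = g x" by auto
      show "y \<in> S"
      proof (rule ccontr)
        assume "y \<notin> S"
        then have "g y = g x" using x v0 by (simp add: g_def S_def)
        then have "y = x" using inj by (auto dest: injD)
        with x \<open>y \<notin> S\<close> show False by simp
      qed
    next
      fix y assume y: "y \<in> S"
      have "\<exists>!x. y - t *\<^sub>R v x = x"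
      proof (rule banach_fix_type[of "1/2" "\<lambda>x. y - t *\<^sub>R v x"])
        show "\<forall>x z. dist (y - t *\<^sub>R v x) (y - t *\<^sub>R v z) \<le> 1 / 2 * dist x z"
          using lipt by (auto simp: dist_norm norm_minus_commute)
      qed auto
      then obtain x where "y - t *\<^sub>R v x = x" by blast
      then have x: "g x = y" unfolding g_def by (metis diff_add_cancel)
      have "x \<in> S"
      proof (rule ccontr)
        assume "x \<notin> S"
        then have "g x = x" using v0 by (simp add: g_def S_def)
        with x y \<open>x \<notin> S\<close> show False by simp
      qed
      with x show "y \<in> g ` S" by auto
    qed
    have pos: "\<bar>det (mat 1 + t *\<^sub>R Dv x)\<bar> = det (mat 1 + t *\<^sub>R Dv x)" for x
    proof -
      have tD: "norm (t *\<^sub>R Dv x) \<le> t * M" using M'[of x] t by simp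
      have n1: "norm (mat 1 + t *\<^sub>R Dv x) \<le> m"
        using norm_triangle_ineq[of "mat 1" "t *\<^sub>R Dv x"] tD tM by (simp add: m_def)
      have "\<bar>det (mat 1 + t *\<^sub>R Dv x) - det (mat 1 :: real^'n::_^'n::_)\<bar> \<le>
          fact n * (n * norm ((mat 1 + t *\<^sub>R Dv x) - mat 1) * m ^ (n - 1))"
        unfolding n_def by (rule abs_det_diff_le[OF n1]) (simp add: m_def)
      also have "\<dots> \<le> fact n * (n * (t * M) * m ^ (n - 1))"
        using tD \<open>m > 0\<close> by (intro mult_left_mono mult_right_mono) auto
      also have "\<dots> = t * c" by (simp add: c_def)
      finally show ?thesis using tc by (simp add: det_I)
    qed
    have mat: "matrix (\<lambda>h. (mat 1 + t *\<^sub>R Dv x) *v h) = mat 1 + t *\<^sub>R Dv x" for x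
      by (rule matrix_of_matrix_vector_mul)
    have "measure lebesgue (g ` S) = integral S (\<lambda>x. \<bar>det (matrix (\<lambda>h. (mat 1 + t *\<^sub>R Dv x) *v h))\<bar>)"
    proof (rule measure_differentiable_image_eq)
      show "(g has_derivative (\<lambda>h. (mat 1 + t *\<^sub>R Dv x) *v h)) (at x within S)" for x
        by (rule has_derivative_at_withinI[OF derg])
      show "inj_on g S" using inj by (rule inj_on_subset) simp
      show "(\<lambda>x. \<bar>det (matrix (\<lambda>h. (mat 1 + t *\<^sub>R Dv x) *v h))\<bar>) integrable_on S"
        unfolding mat pos by (rule intd)
    qed (simp add: S_def)
    then show ?thesis by (simp add: gS mat pos q_def)
  qed
  define d where "d T A = (\<Sum>p | p permutes UNIV. of_int (sign p) *
      ((\<Prod>i\<in>T. A $ i $ p i) * (\<Prod>i\<in>-T. mat 1 $ i $ p i)))" for T and A :: "real ^ 'n::_ ^ 'n::_"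
  have intdT: "(\<lambda>x. d T (Dv x)) integrable_on S" for T
    unfolding S_def d_def by (intro integrable_continuous continuous_intros continuous_on_subset[OF cont]) auto
  define e where "e T = integral S (\<lambda>x. d T (Dv x))" for T
  have "q t = (\<Sum>T\<in>UNIV. t ^ card T * e T)" for t
  proof -
    have "q t = integral S (\<lambda>x. \<Sum>T\<in>UNIV. t ^ card T * d T (Dv x))"
      unfolding q_def d_def det_mat_1_add_scaled ..
    also have "\<dots> = (\<Sum>T\<in>UNIV. integral S (\<lambda>x. t ^ card T * d T (Dv x)))"
      by (intro integral_sum integrable_on_mult_right intdT) auto
    finally show ?thesis by (simp add: e_def)
  qed
  also have "(\<Sum>T\<in>UNIV. t ^ card T * e T) = (\<Sum>k\<le>n. (\<Sum>T | card T = k. e T) * t ^ k)" for t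
  proof -
    have "(\<Sum>T\<in>UNIV. t ^ card T * e T) = (\<Sum>k\<le>n. \<Sum>T | T \<in> UNIV \<and> card T = k. t ^ card T * e T)"
      by (rule sum.group[symmetric]) (auto simp: n_def card_mono)
    also have "\<dots> = (\<Sum>k\<le>n. (\<Sum>T | card T = k. e T) * t ^ k)"
      unfolding sum_distrib_right by (intro sum.cong) auto
    finally show ?thesis .
  qed
  finally have q_poly: "q t = (\<Sum>k\<le>n. (\<Sum>T | card T = k. e T) * t ^ k)" for t .
  \<comment> \<open>The polynomial q t - measure S has infinitely many zeros in (0, t0), so all its
    coefficients vanish. The correction sits in degree 0 only and n > 0, so degree n yields
    \<open>e UNIV = 0\<close>.\<close>
  define C where "C k = (\<Sum>T | card T = k. e T) - (if k = 0 then measure lebesgue S else 0)" for k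
  have C: "(\<Sum>k\<le>n. C k * t ^ k) = q t - measure lebesgue S" for t
    unfolding q_poly C_def left_diff_distrib sum_subtractf
    by (simp add: if_distrib[of "\<lambda>a. a * t ^ _"] cong: if_cong)
  have "{0<..<t0} \<subseteq> {t. (\<Sum>k\<le>n. C k * t ^ k) = 0}"
    using q_eq by (auto simp: C)
  moreover have "infinite {0<..<t0}" using \<open>t0 > 0\<close> by simp
  ultimately have "infinite {t. (\<Sum>k\<le>n. C k * t ^ k) = 0}" by (metis finite_subset)
  then have "C n = 0" using polyfun_finite_roots[of C n] by blast
  moreover have "{T. card T = n} = {UNIV :: 'n set}"
    using card_subset_eq[of "UNIV :: 'n set"] by (auto simp: n_def)
  ultimately have "e UNIV = 0" using n by (simp add: C_def)
  moreover have "d UNIV A = det A" for A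
    by (simp add: d_def det_def)
  ultimately show ?thesis by (simp add: e_def S_def)
qed


text \<open>
  The change of variables theorem of the library is restricted to well-ordered index types.
  A finite type is in bijection with the following one, which is well-ordered.
\<close>

typedef ('n::finite) enumerated = "{..<CARD('n)}"
  by (rule exI[of _ 0]) auto

instantiation enumerated :: (finite) wellorder
begin

definition "x \<le> y \<longleftrightarrow> Rep_enumerated x \<le> Rep_enumerated y"
definition "x < y \<longleftrightarrow> Rep_enumerated x < Rep_enumerated y"

instance
proof
  fix P :: "'a enumerated \<Rightarrow> bool" and a
  assume step: "\<And>x. (\<And>y. y < x \<Longrightarrow> P y) \<Longrightarrow> P x"
  show "P a"
    by (induction a rule: measure_induct_rule[of Rep_enumerated]) (auto intro: step simp: less_enumerated_def)
qed (auto simp: less_eq_enumerated_def less_enumerated_def Rep_enumerated_inject)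

end

lemma card_enumerated: "card (UNIV :: 'n::finite enumerated set) = CARD('n)"
  by (simp add: type_definition.card[OF type_definition_enumerated])

instance enumerated :: (finite) finite
proof
  show "finite (UNIV :: 'a enumerated set)"
    using card_enumerated[where 'n = 'a] by (metis card.infinite zero_less_card_finite less_irrefl)
qed

text \<open>Conjugation turns the transposition of a and b into that of f a and f b, so the claim
  follows by induction over products of transpositions. The two index types differ, hence a
  bijection in place of a permutation.\<close>

lemma sign_conjugate:
  assumes "p permutes (UNIV :: 'a::finite set)" and bij: "bij (f :: 'a \<Rightarrow> 'b::finite)"
  shows "sign (f \<circ> p \<circ> inv f) = sign p"
  using assms(1) finite
proof (induction rule: permutes_induct)
  case id
  then show ?case
    using bij by (simp add: comp_def bij_is_surj surj_f_inv_f)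
next
  case (swap a b p)
  have "f \<circ> (Transposition.transpose a b \<circ> p) \<circ> inv f = Transposition.transpose (f a) (f b) \<circ> (f \<circ> p \<circ> inv f)"
    using bij by (auto simp: fun_eq_iff Transposition.transpose_def bij_is_inj inj_eq)
  moreover have perm: "permutation (f \<circ> p \<circ> inv f)" "permutation p"
    using swap.hyps bij unfolding permutation by (auto intro!: bij_comp permutes_bij[of p] bij_imp_bij_inv simp del: o_apply)
  moreover have "f a \<noteq> f b" using swap.hyps bij by (auto simp: bij_is_inj inj_eq)
  ultimately have "sign (f \<circ> (Transposition.transpose a b \<circ> p) \<circ> inv f) = - sign p"
    using sign_compose[OF permutation_swap_id perm(1), of "f a" "f b"] swap.IH by (simp only: sign_swap_id) simp
  moreover have "sign (Transposition.transpose a b \<circ> p) = - sign p"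
    using sign_compose[OF permutation_swap_id perm(2), of a b] swap.hyps by (simp only: sign_swap_id) simp
  ultimately show ?case by metis
qed

text \<open>Rows and columns are relabelled by the same bijection, which conjugates the permutations
  in the Leibniz formula and so keeps their signs.\<close>

lemma det_reindex:
  fixes A :: "real ^ 'n ^ 'n" and f :: "'m::finite \<Rightarrow> 'n"
  assumes bij: "bij f"
  shows "det (\<chi> i j. A $ f i $ f j) = det A"
proof -
  have inv: "inv f (f x) = x" "f (inv f y) = y" for x y
    using bij by (auto simp: bij_is_inj bij_is_surj surj_f_inv_f)
  have "det A = (\<Sum>p | p permutes (UNIV::'m set). of_int (sign (f \<circ> p \<circ> inv f)) *
      (\<Prod>i\<in>UNIV. A $ i $ (f \<circ> p \<circ> inv f) i))"
    unfolding det_def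
  proof (rule sum.reindex_bij_witness[of _ "\<lambda>p. f \<circ> p \<circ> inv f" "\<lambda>p. inv f \<circ> p \<circ> f"])
    show "inv f \<circ> p \<circ> f \<in> {p. p permutes UNIV}" if "p \<in> {p. p permutes UNIV}" for p
      using that bij by (auto simp: permutes_univ inv) (metis inv)+
    show "f \<circ> p \<circ> inv f \<in> {p. p permutes UNIV}" if "p \<in> {p. p permutes UNIV}" for p
      using that bij by (auto simp: permutes_univ inv) (metis inv)+
  qed (auto simp: fun_eq_iff inv comp_def)
  also have "\<dots> = (\<Sum>p | p permutes (UNIV::'m set). of_int (sign p) * (\<Prod>i\<in>UNIV. A $ f i $ f (p i)))"
  proof (rule sum.cong[OF refl])
    fix p assume "p \<in> {p. p permutes (UNIV::'m set)}"
    moreover have "(\<Prod>i\<in>UNIV. A $ i $ (f \<circ> p \<circ> inv f) i) = (\<Prod>i\<in>UNIV. A $ f i $ f (p i))"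
      by (rule prod.reindex_bij_witness[of _ f "inv f"]) (auto simp: inv)
    ultimately show "of_int (sign (f \<circ> p \<circ> inv f)) * (\<Prod>i\<in>UNIV. A $ i $ (f \<circ> p \<circ> inv f) i) =
        of_int (sign p) * (\<Prod>i\<in>UNIV. A $ f i $ f (p i))"
      using sign_conjugate[OF _ bij] by auto
  qed
  finally show ?thesis by (simp add: det_def)
qed

theorem integral_det_eq_0:
  fixes v :: "real ^ 'n \<Rightarrow> real ^ 'n"
  assumes der: "\<And>x. (v has_derivative (\<lambda>h. Dv x *v h)) (at x)"
    and cont: "continuous_on UNIV Dv"
    and v0: "\<And>x. x \<notin> cbox a b \<Longrightarrow> v x = 0"
  shows "integral (cbox a b) (\<lambda>x. det (Dv x)) = 0"
proof -
  obtain f :: "'n enumerated \<Rightarrow> 'n" where bij: "bij f"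
    using finite_same_card_bij[of "UNIV :: 'n enumerated set" "UNIV :: 'n set"] card_enumerated by auto
  have inv: "inv f (f x) = x" "f (inv f y) = y" for x y
    using bij by (auto simp: bij_is_inj bij_is_surj surj_f_inv_f)
  \<comment> \<open>Relabelling the coordinates maps boxes to boxes of equal content, so the
    integral is carried over with factor 1.\<close>
  define \<phi> :: "real ^ 'n \<Rightarrow> real ^ 'n enumerated" where "\<phi> x = (\<chi> j. x $ f j)" for x
  define \<psi> :: "real ^ 'n enumerated \<Rightarrow> real ^ 'n" where "\<psi> y = (\<chi> i. y $ inv f i)" for y
  have \<phi>\<psi>: "\<phi> (\<psi> y) = y" and \<psi>\<phi>: "\<psi> (\<phi> x) = x" for x y
    by (auto simp: \<phi>_def \<psi>_def inv vec_eq_iff)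
  have lin\<phi>: "bounded_linear \<phi>" and lin\<psi>: "bounded_linear \<psi>"
    unfolding linear_conv_bounded_linear[symmetric]
    by (auto simp: \<phi>_def \<psi>_def vec_eq_iff intro!: linearI)
  have mem\<phi>: "\<phi> x \<in> cbox (\<phi> u) (\<phi> w) \<longleftrightarrow> x \<in> cbox u w" for x u w
    unfolding \<phi>_def mem_box_cart by (simp, metis inv(2))
  have img\<phi>: "\<phi> ` cbox u w = cbox (\<phi> u) (\<phi> w)" for u w
  proof (intro set_eqI iffI)
    fix y assume "y \<in> cbox (\<phi> u) (\<phi> w)"
    then have "\<psi> y \<in> cbox u w" using mem\<phi>[of "\<psi> y"] by (simp add: \<phi>\<psi>)
    then show "y \<in> \<phi> ` cbox u w" using \<phi>\<psi> by (metis imageI)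
  qed (auto simp: mem\<phi>)
  have img\<psi>: "\<psi> ` cbox u w = cbox (\<psi> u) (\<psi> w)" for u w
  proof -
    have "\<psi> ` (\<phi> ` cbox (\<psi> u) (\<psi> w)) = cbox (\<psi> u) (\<psi> w)"
      unfolding image_image \<psi>\<phi> by simp
    then show ?thesis by (simp add: img\<phi> \<phi>\<psi>)
  qed
  have content\<phi>: "Henstock_Kurzweil_Integration.content (\<phi> ` cbox u w) = 1 * Henstock_Kurzweil_Integration.content (cbox u w)" for u w
  proof -
    have "(cbox (\<phi> u) (\<phi> w) = {}) = (cbox u w = {})" using img\<phi>[of u w] by auto
    moreover have "(\<Prod>i\<in>UNIV. \<phi> w $ i - \<phi> u $ i) = (\<Prod>i\<in>UNIV. w $ i - u $ i)"
      by (rule prod.reindex_bij_witness[of _ "inv f" f]) (auto simp: inv \<phi>_def)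
    ultimately show ?thesis
      unfolding img\<phi> by (simp add: content_cbox_if_cart)
  qed
  define v' where "v' y = \<phi> (v (\<psi> y))" for y
  define Dv' where "Dv' y = (\<chi> i j. Dv (\<psi> y) $ f i $ f j)" for y
  have mult: "Dv' y *v h = \<phi> (Dv (\<psi> y) *v \<psi> h)" for y h
  proof -
    have "(\<Sum>j\<in>UNIV. Dv (\<psi> y) $ f i $ f j * h $ j) = (\<Sum>j\<in>UNIV. Dv (\<psi> y) $ f i $ j * h $ inv f j)" for i
      by (rule sum.reindex_bij_witness[of _ "inv f" f]) (auto simp: inv)
    then show ?thesis
      by (simp add: vec_eq_iff Dv'_def \<phi>_def \<psi>_def matrix_vector_mult_def)
  qed
  have "(v' has_derivative (\<lambda>h. Dv' y *v h)) (at y)" for y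
    unfolding mult unfolding v'_def
    by (rule bounded_linear.has_derivative[OF lin\<phi>]
        has_derivative_compose[OF bounded_linear_imp_has_derivative[OF lin\<psi>] der])+
  moreover have "continuous_on UNIV Dv'"
    unfolding Dv'_def
    by (intro continuous_intros continuous_on_compose2[OF cont]
        linear_continuous_on[OF lin\<psi>]) auto
  moreover have "v' y = 0" if "y \<notin> cbox (\<phi> a) (\<phi> b)" for y
    using that v0[of "\<psi> y"] mem\<phi>[of "\<psi> y"] by (auto simp: v'_def \<phi>\<psi>) (simp add: \<phi>_def vec_eq_iff)
  ultimately have "integral (cbox (\<phi> a) (\<phi> b)) (\<lambda>y. det (Dv' y)) = 0"
    by (rule integral_det_eq_0_wellorder)
  moreover have "(\<lambda>y. det (Dv' y)) integrable_on cbox (\<phi> a) (\<phi> b)"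
    by (intro integrable_continuous continuous_intros continuous_on_subset[OF \<open>continuous_on UNIV Dv'\<close>]) auto
  ultimately have "((\<lambda>y. det (Dv' y)) has_integral 0) (cbox (\<phi> a) (\<phi> b))"
    by (metis integrable_integral)
  then have "((\<lambda>x. det (Dv' (\<phi> x))) has_integral (1 / 1) *\<^sub>R 0) (\<psi> ` cbox (\<phi> a) (\<phi> b))"
    using content\<phi> img\<phi> img\<psi> linear_continuous_at[OF lin\<phi>]
    by (intro has_integral_twiddle) (auto simp: \<psi>\<phi> \<phi>\<psi>)
  then have "((\<lambda>x. det (Dv x)) has_integral 0) (cbox a b)"
    by (simp add: img\<psi> \<psi>\<phi> Dv'_def det_reindex[OF bij])
  then show ?thesis by (rule integral_unique)
qed

section \<open>Intermediate dimensions of Hoelder images\<close>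

definition intermediate_exponents :: "real \<Rightarrow> 'a::euclidean_space set \<Rightarrow> real set" where
  "intermediate_exponents \<theta> A = {s. s > 0 \<and>
     (\<forall>\<epsilon>>0. \<exists>\<delta>\<^sub>0>0. \<forall>\<delta>. 0 < \<delta> \<and> \<delta> \<le> \<delta>\<^sub>0 \<longrightarrow>
       (\<exists>I U. diam_cover (\<delta> powr (1 / \<theta>)) \<delta> A I U \<and> diam_sum s I U < ennreal \<epsilon>))}"

lemma upper_intermediate_dim_eq: "upper_intermediate_dim \<theta> A = Inf (intermediate_exponents \<theta> A)"
  by (simp add: upper_intermediate_dim_def intermediate_exponents_def)

lemma bdd_below_intermediate_exponents: "bdd_below (intermediate_exponents \<theta> A)"
  by (rule bdd_belowI[of _ 0]) (auto simp: intermediate_exponents_def)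

lemma intermediate_exponentsE:
  assumes "s \<in> intermediate_exponents \<theta> A" "\<epsilon> > 0"
  obtains \<delta>\<^sub>0 where "\<delta>\<^sub>0 > 0" "\<And>\<delta>. 0 < \<delta> \<Longrightarrow> \<delta> \<le> \<delta>\<^sub>0 \<Longrightarrow>
       \<exists>I U. diam_cover (\<delta> powr (1 / \<theta>)) \<delta> A I U \<and> diam_sum s I U < ennreal \<epsilon>"
proof -
  have "\<forall>\<epsilon>>0. \<exists>\<delta>\<^sub>0>0. \<forall>\<delta>. 0 < \<delta> \<and> \<delta> \<le> \<delta>\<^sub>0 \<longrightarrow>
       (\<exists>I U. diam_cover (\<delta> powr (1 / \<theta>)) \<delta> A I U \<and> diam_sum s I U < ennreal \<epsilon>)"
    using assms(1) by (simp add: intermediate_exponents_def)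
  from this[rule_format, OF assms(2)] show ?thesis
    by (elim exE conjE) (rule that, assumption, blast)
qed

lemma diam_sum_eq_SUP:
  "diam_sum s I U = (SUP F\<in>{F. finite F \<and> F \<subseteq> I}. \<Sum>i\<in>F. ennreal (diameter (U i) powr s))"
  unfolding diam_sum_def by (rule nonneg_infsum_complete) simp

lemma diam_sum_le:
  assumes le: "\<And>i. i \<in> I \<Longrightarrow> diameter (V i) powr t \<le> B * diameter (U i) powr s" and "B \<ge> 0"
  shows "diam_sum t I V \<le> ennreal B * diam_sum s I U"
proof -
  have "sum (\<lambda>i. ennreal (diameter (V i) powr t)) F \<le> ennreal B * diam_sum s I U"
    if "finite F" "F \<subseteq> I" for F
  proof -
    have "sum (\<lambda>i. ennreal (diameter (V i) powr t)) F \<le> (\<Sum>i\<in>F. ennreal B * ennreal (diameter (U i) powr s))"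
      using that le assms(2) by (intro sum_mono) (auto simp flip: ennreal_mult intro!: ennreal_leI)
    also have "\<dots> = ennreal B * (\<Sum>i\<in>F. ennreal (diameter (U i) powr s))"
      by (simp add: sum_distrib_left del: sum_ennreal)
    also have "(\<Sum>i\<in>F. ennreal (diameter (U i) powr s)) \<le> diam_sum s I U"
      unfolding diam_sum_eq_SUP using that by (intro SUP_upper) auto
    finally show ?thesis by (simp add: mult_left_mono)
  qed
  then show ?thesis
    unfolding diam_sum_eq_SUP[of t] by (intro SUP_least) (auto simp del: sum_ennreal)
qed

text \<open>With \<delta> = A \<eta>^\<alpha>, a cover with diameters between \<eta>^(1/\<theta>)
  and \<eta> yields one with diameters between \<delta>^(1/\<theta>) and \<delta>. The lower bound
  may force an image ball to be enlarged, but \<delta>^(1/\<theta>) = B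
  (\<eta>^(1/\<theta>))^\<alpha> is at most B d^\<alpha> by the lower bound on the original diameter
  d. So \<theta> is kept and the sums grow by a constant factor only.\<close>

lemma intermediate_exponents_hoelder_image:
  fixes E :: "'a::euclidean_space set" and f :: "'a \<Rightarrow> 'b::euclidean_space"
  assumes hoelder: "\<And>x y. x \<in> E \<Longrightarrow> y \<in> E \<Longrightarrow> dist (f x) (f y) \<le> C * dist x y powr \<alpha>"
    and "\<alpha> > 0" "0 < \<theta>" "\<theta> < 1" and s: "s \<in> intermediate_exponents \<theta> E"
  shows "s / \<alpha> \<in> intermediate_exponents \<theta> (f ` E)"
proof -
  \<comment> \<open>The factor 2 passes from the radius of a ball centred at an image point to its
    diameter; the maximum with 1 makes \<open>A\<close> positive whatever \<open>C\<close> is and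
    gives A \<le> A^(1/\<theta>) = B.\<close>
  define A where "A = max 1 (2 * C)"
  define B where "B = A powr (1 / \<theta>)"
  have A: "A \<ge> 1" "2 * C \<le> A" by (auto simp: A_def)
  have B: "B > 0" "A \<le> B"
    using A powr_mono[of 1 "1/\<theta>" A] assms by (auto simp: B_def field_simps)
  have "s > 0" using s by (simp add: intermediate_exponents_def)
  have "\<exists>\<delta>\<^sub>0>0. \<forall>\<delta>. 0 < \<delta> \<and> \<delta> \<le> \<delta>\<^sub>0 \<longrightarrow>
       (\<exists>I U. diam_cover (\<delta> powr (1 / \<theta>)) \<delta> (f ` E) I U \<and> diam_sum (s / \<alpha>) I U < ennreal \<epsilon>)"
    if "\<epsilon> > 0" for \<epsilon>
  proof -
    define \<epsilon>' where "\<epsilon>' = \<epsilon> / B powr (s / \<alpha>)"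
    have "\<epsilon>' > 0" using that B by (simp add: \<epsilon>'_def)
    then obtain \<delta>1 where \<delta>1: "\<delta>1 > 0" and cov: "\<And>\<delta>. 0 < \<delta> \<Longrightarrow> \<delta> \<le> \<delta>1 \<Longrightarrow>
       \<exists>I U. diam_cover (\<delta> powr (1 / \<theta>)) \<delta> E I U \<and> diam_sum s I U < ennreal \<epsilon>'"
      using intermediate_exponentsE[OF s \<open>\<epsilon>' > 0\<close>] by metis
    \<comment> \<open>The bound 1 gives \<delta>^(1/\<theta>) \<le> \<delta>; the second bound gives
      \<eta> \<le> \<open>\<delta>1\<close>.\<close>
    define \<delta>\<^sub>0 where "\<delta>\<^sub>0 = min 1 (A * \<delta>1 powr \<alpha>)"
    have "\<delta>\<^sub>0 > 0" using A \<delta>1 by (simp add: \<delta>\<^sub>0_def)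
    moreover have "\<exists>I U. diam_cover (\<delta> powr (1 / \<theta>)) \<delta> (f ` E) I U \<and> diam_sum (s / \<alpha>) I U < ennreal \<epsilon>"
      if \<delta>: "0 < \<delta>" "\<delta> \<le> \<delta>\<^sub>0" for \<delta>
    proof -
      define \<eta> where "\<eta> = (\<delta> / A) powr (1 / \<alpha>)"
      have \<eta>: "0 < \<eta>" using \<delta> A by (simp add: \<eta>_def)
      have A\<eta>: "A * \<eta> powr \<alpha> = \<delta>" using \<delta> A \<open>\<alpha> > 0\<close> by (simp add: \<eta>_def powr_powr)
      have "\<delta> / A \<le> \<delta>1 powr \<alpha>" using \<delta> A by (simp add: \<delta>\<^sub>0_def field_simps)
      then have "\<eta> \<le> (\<delta>1 powr \<alpha>) powr (1 / \<alpha>)"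
        unfolding \<eta>_def using \<delta> A \<open>\<alpha> > 0\<close> by (intro powr_mono2) auto
      then have "\<eta> \<le> \<delta>1" using \<delta>1 \<open>\<alpha> > 0\<close> by (simp add: powr_powr)
      from cov[OF \<eta> this] obtain I U where IU: "diam_cover (\<eta> powr (1 / \<theta>)) \<eta> E I U"
        and sum: "diam_sum s I U < ennreal \<epsilon>'" by blast
      define d where "d i = diameter (U i)" for i
      have d: "\<eta> powr (1 / \<theta>) \<le> d i" "d i \<le> \<eta>" "bounded (U i)" "d i > 0" if "i \<in> I" for i
      proof -
        show 1: "\<eta> powr (1 / \<theta>) \<le> d i" "d i \<le> \<eta>" "bounded (U i)"
          using IU that by (auto simp: diam_cover_def d_def)
        show "d i > 0" using 1(1) \<eta> by (smt (verit) powr_gt_zero)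
      qed
      define R where "R i = max (A * d i powr \<alpha>) (\<delta> powr (1 / \<theta>))" for i
      \<comment> \<open>If \<open>U i\<close> does not meet \<open>E\<close>, the centre is
        arbitrary; the ball still has an admissible diameter.\<close>
      define y where "y i = (SOME y. y \<in> f ` (U i \<inter> E))" for i
      define V where "V i = cball (y i) (R i / 2)" for i
      have Rpos: "R i > 0" for i
        unfolding R_def using \<delta> by (simp add: less_max_iff_disj)
      have diamV: "diameter (V i) = R i" for i
        using Rpos[of i] by (simp add: V_def)
      have subV: "f ` (U i \<inter> E) \<subseteq> V i" if "i \<in> I" for i
      proof
        fix z assume "z \<in> f ` (U i \<inter> E)"
        then obtain a where a: "a \<in> U i" "a \<in> E" "z = f a" by auto
        have "y i \<in> f ` (U i \<inter> E)"
          unfolding y_def using \<open>z \<in> _\<close> by (rule someI)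
        then obtain b where b: "b \<in> U i" "b \<in> E" "y i = f b" by auto
        have "dist a b \<le> d i"
          unfolding d_def using d(3)[OF that] a b by (intro diameter_bounded_bound)
        then have "dist a b powr \<alpha> \<le> d i powr \<alpha>"
          using \<open>\<alpha> > 0\<close> by (intro powr_mono2) auto
        moreover have "2 * dist z (y i) \<le> A * dist a b powr \<alpha>"
        proof -
          have "2 * dist z (y i) \<le> (2 * C) * dist a b powr \<alpha>" using hoelder a b by simp
          also have "\<dots> \<le> A * dist a b powr \<alpha>" using A by (intro mult_right_mono) auto
          finally show ?thesis .
        qed
        ultimately have "2 * dist z (y i) \<le> A * d i powr \<alpha>"
          using A by (smt (verit, best) mult_left_mono)
        also have "\<dots> \<le> R i" by (simp add: R_def)
        finally show "z \<in> V i" by (simp add: V_def dist_commute)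
      qed
      have cover: "diam_cover (\<delta> powr (1 / \<theta>)) \<delta> (f ` E) I V"
        unfolding diam_cover_def diamV
      proof (intro conjI ballI)
        show "f ` E \<subseteq> (\<Union>i\<in>I. V i)"
        proof
          fix z assume "z \<in> f ` E"
          then obtain x where x: "x \<in> E" "z = f x" by auto
          then obtain i where "i \<in> I" "x \<in> U i" using IU unfolding diam_cover_def by auto
          then show "z \<in> (\<Union>i\<in>I. V i)" using subV[of i] x by auto
        qed
        fix i assume i: "i \<in> I"
        show "bounded (V i)" by (simp add: V_def)
        show "\<delta> powr (1 / \<theta>) \<le> R i" by (simp add: R_def)
        have "d i powr \<alpha> \<le> \<eta> powr \<alpha>" using d[OF i] \<open>\<alpha> > 0\<close> by (intro powr_mono2) auto
        then have "A * d i powr \<alpha> \<le> \<delta>" using A by (subst A\<eta>[symmetric]) (rule mult_left_mono, auto)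
        moreover have "\<delta> powr (1 / \<theta>) \<le> \<delta> powr 1"
          using \<delta> assms by (intro powr_mono') (auto simp: \<delta>\<^sub>0_def field_simps)
        ultimately show "R i \<le> \<delta>" using \<delta> by (simp add: R_def)
      qed
      have "diam_sum (s / \<alpha>) I V \<le> ennreal (B powr (s / \<alpha>)) * diam_sum s I U"
      proof (rule diam_sum_le)
        fix i assume i: "i \<in> I"
        have "\<delta> powr (1 / \<theta>) = B * (\<eta> powr (1 / \<theta>)) powr \<alpha>"
          unfolding A\<eta>[symmetric] B_def using A \<eta> by (simp add: powr_mult powr_powr mult.commute)
        also have "\<dots> \<le> B * d i powr \<alpha>"
          using B \<open>\<alpha> > 0\<close> d[OF i] by (intro mult_left_mono powr_mono2) auto
        finally have "R i \<le> B * d i powr \<alpha>"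
          using B by (simp add: R_def mult_right_mono)
        then have "R i powr (s / \<alpha>) \<le> (B * d i powr \<alpha>) powr (s / \<alpha>)"
          using Rpos[of i] \<open>s > 0\<close> \<open>\<alpha> > 0\<close> by (intro powr_mono2) auto
        then show "diameter (V i) powr (s / \<alpha>) \<le> B powr (s / \<alpha>) * diameter (U i) powr s"
          using B \<open>\<alpha> > 0\<close> unfolding diamV by (simp add: powr_mult powr_powr d_def)
      qed simp
      also have "\<dots> < ennreal \<epsilon>"
      proof -
        obtain r where r: "r \<ge> 0" "diam_sum s I U = ennreal r" 
          using sum by (cases "diam_sum s I U") auto
        then have "r < \<epsilon>'" using sum \<open>\<epsilon>' > 0\<close> by (simp add: ennreal_less_iff)
        then have "B powr (s / \<alpha>) * r < \<epsilon>" using B by (simp add: \<epsilon>'_def field_simps)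
        then show ?thesis using r by (simp add: ennreal_less_iff flip: ennreal_mult)
      qed
      finally show ?thesis using cover by blast
    qed
    ultimately show ?thesis by blast
  qed
  then show ?thesis
    using \<open>s > 0\<close> \<open>\<alpha> > 0\<close> by (simp add: intermediate_exponents_def)
qed

section \<open>Dependence on the parameter and the quasi-Hausdorff dimension\<close>

text \<open>For \<delta> \<le> 1, lowering \<theta> lowers the least admissible diameter
  \<delta>^(1/\<theta>), so every cover remains admissible.\<close>

lemma intermediate_exponents_antimono:
  assumes "0 < \<theta>" "\<theta> \<le> \<theta>'"
  shows "intermediate_exponents \<theta>' A \<subseteq> intermediate_exponents \<theta> A"
proof
  fix s assume s: "s \<in> intermediate_exponents \<theta>' A"
  have "\<exists>\<delta>\<^sub>0>0. \<forall>\<delta>. 0 < \<delta> \<and> \<delta> \<le> \<delta>\<^sub>0 \<longrightarrow>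
       (\<exists>I U. diam_cover (\<delta> powr (1 / \<theta>)) \<delta> A I U \<and> diam_sum s I U < ennreal \<epsilon>)" if \<epsilon>: "\<epsilon> > 0" for \<epsilon>
  proof -
    obtain \<delta>\<^sub>0 where \<delta>\<^sub>0: "\<delta>\<^sub>0 > 0" and cov: "\<And>\<delta>. 0 < \<delta> \<Longrightarrow> \<delta> \<le> \<delta>\<^sub>0 \<Longrightarrow>
       \<exists>I U. diam_cover (\<delta> powr (1 / \<theta>')) \<delta> A I U \<and> diam_sum s I U < ennreal \<epsilon>"
      using intermediate_exponentsE[OF s \<epsilon>] by metis
    have "\<exists>I U. diam_cover (\<delta> powr (1 / \<theta>)) \<delta> A I U \<and> diam_sum s I U < ennreal \<epsilon>"
      if \<delta>: "0 < \<delta>" "\<delta> \<le> min 1 \<delta>\<^sub>0" for \<delta>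
    proof -
      obtain I U where *: "diam_cover (\<delta> powr (1 / \<theta>')) \<delta> A I U" "diam_sum s I U < ennreal \<epsilon>"
        using cov[of \<delta>] \<delta> by auto
      have "\<delta> powr (1 / \<theta>) \<le> \<delta> powr (1 / \<theta>')"
        using \<delta> assms by (intro powr_mono') (auto simp: field_simps)
      then have "diam_cover (\<delta> powr (1 / \<theta>)) \<delta> A I U"
        using *(1) unfolding diam_cover_def by force
      with * show ?thesis by blast
    qed
    then show ?thesis using \<delta>\<^sub>0 by (intro exI[of _ "min 1 \<delta>\<^sub>0"]) auto
  qed
  then show "s \<in> intermediate_exponents \<theta> A"
    using s by (simp add: intermediate_exponents_def)
qed

text \<open>Points are rounded down to a grid of mesh \<eta> = \<delta> / (2 n); the l1 norm bounds
  the error by n \<eta> = \<delta> / 2.\<close>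

lemma finite_grid_cover:
  fixes A :: "'a::euclidean_space set"
  assumes "bounded A"
  shows "\<exists>C>0. \<forall>\<delta>. 0 < \<delta> \<and> \<delta> \<le> 1 \<longrightarrow>
    (\<exists>G. finite G \<and> real (card G) \<le> C * (1 / \<delta>) ^ DIM('a) \<and> A \<subseteq> (\<Union>g\<in>G. cball g (\<delta> / 2)))"
proof -
  define n where "n = DIM('a)"
  have n: "real n > 0" by (simp add: n_def)
  obtain r where r: "r > 0" "\<And>x. x \<in> A \<Longrightarrow> norm x \<le> r"
    using assms unfolding bounded_pos by auto
  \<comment> \<open>The bound \<open>N\<close> on the grid indices is at most r / \<eta> + 1, hence
    at most (2 n r + 1) / \<delta> because \<delta> \<le> 1; the last 1 accounts for the index 0 in
    -N..N.\<close>
  define C where "C = (2 * (2 * n * r + 1) + 1) ^ n"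
  have "C > 0" unfolding C_def using r n by (intro zero_less_power add_pos_pos mult_pos_pos) auto
  moreover have "\<exists>G. finite G \<and> real (card G) \<le> C * (1 / \<delta>) ^ n \<and> A \<subseteq> (\<Union>g\<in>G. cball g (\<delta> / 2))"
    if \<delta>: "0 < \<delta>" "\<delta> \<le> 1" for \<delta>
  proof -
    define \<eta> where "\<eta> = \<delta> / (2 * n)"
    have \<eta>: "\<eta> > 0" using \<delta> n by (simp add: \<eta>_def)
    define N where "N = nat \<lceil>r / \<eta>\<rceil>"
    define K where "K = PiE (Basis :: 'a set) (\<lambda>_. {- int N..int N})"
    define G where "G = (\<lambda>k. \<Sum>b\<in>Basis. (\<eta> * of_int (k b)) *\<^sub>R b) ` K"
    have finK: "finite K" unfolding K_def by (intro finite_PiE) auto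
    then have "finite G" by (simp add: G_def)
    have "real (card G) \<le> real (card K)"
      unfolding G_def using card_image_le[OF finK] by simp
    also have "card K = (2 * N + 1) ^ n"
      unfolding K_def by (simp add: card_PiE n_def nat_add_distrib nat_mult_distrib)
    also have "real ((2 * N + 1) ^ n) \<le> ((2 * (2 * n * r + 1) + 1) * (1 / \<delta>)) ^ n"
    proof -
      have "real N \<le> r / \<eta> + 1" unfolding N_def using r \<eta> by (simp add: of_nat_nat)
      also have "r / \<eta> + 1 \<le> (2 * n * r + 1) * (1 / \<delta>)"
        using \<delta> n by (simp add: \<eta>_def field_simps)
      finally have "2 * real N + 1 \<le> 2 * ((2 * n * r + 1) * (1 / \<delta>)) + 1 * (1 / \<delta>)"
        using \<delta> by (intro add_mono) (auto simp: field_simps)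
      then have "real (2 * N + 1) \<le> (2 * (2 * n * r + 1) + 1) * (1 / \<delta>)"
        by (simp add: algebra_simps add_divide_distrib)
      then show ?thesis unfolding of_nat_power by (intro power_mono) auto
    qed
    also have "\<dots> = C * (1 / \<delta>) ^ n" unfolding C_def by (rule power_mult_distrib)
    finally have "real (card G) \<le> C * (1 / \<delta>) ^ n" .
    moreover have "A \<subseteq> (\<Union>g\<in>G. cball g (\<delta> / 2))"
    proof
      fix x assume x: "x \<in> A"
      define k where "k = restrict (\<lambda>b. \<lfloor>(x \<bullet> b) / \<eta>\<rfloor>) Basis"
      have "k \<in> K"
        unfolding K_def
      proof (rule PiE_I)
        fix b :: 'a assume b: "b \<in> Basis"
        have "\<bar>x \<bullet> b\<bar> \<le> r" using r(2)[OF x] Basis_le_norm[OF b, of x] by linarith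
        then have "- (r / \<eta>) \<le> (x \<bullet> b) / \<eta>" "(x \<bullet> b) / \<eta> \<le> r / \<eta>"
          using \<eta> by (auto simp: field_simps abs_le_iff)
        moreover have "r / \<eta> \<le> of_int (int N)"
          unfolding N_def using r \<eta> by (simp add: of_nat_nat)
        ultimately show "k b \<in> {- int N..int N}"
          using b by (simp add: k_def le_floor_iff floor_le_iff)
      qed (simp add: k_def)
      define g where "g = (\<Sum>b\<in>Basis. (\<eta> * of_int (k b)) *\<^sub>R b)"
      have "g \<in> G" using \<open>k \<in> K\<close> by (auto simp: G_def g_def)
      have "norm (g - x) \<le> (\<Sum>b\<in>Basis. \<bar>(g - x) \<bullet> b\<bar>)" by (rule norm_le_l1)
      also have "\<dots> \<le> (\<Sum>b\<in>(Basis :: 'a set). \<eta>)"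
      proof (rule sum_mono)
        fix b :: 'a assume b: "b \<in> Basis"
        define q where "q = (x \<bullet> b) / \<eta>"
        have "g \<bullet> b = \<eta> * of_int \<lfloor>q\<rfloor>" using b by (simp add: g_def k_def q_def)
        moreover have "x \<bullet> b = \<eta> * q" using \<eta> by (simp add: q_def)
        ultimately have "(g - x) \<bullet> b = \<eta> * (of_int \<lfloor>q\<rfloor> - q)"
          by (simp add: inner_diff_left right_diff_distrib)
        then have "\<bar>(g - x) \<bullet> b\<bar> = \<eta> * \<bar>of_int \<lfloor>q\<rfloor> - q\<bar>"
          using \<eta> by (simp add: abs_mult)
        also have "\<dots> \<le> \<eta> * 1" using \<eta> by (intro mult_left_mono) linarith+
        finally show "\<bar>(g - x) \<bullet> b\<bar> \<le> \<eta>" by simp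
      qed
      also have "\<dots> = \<delta> / 2" using n by (simp add: \<eta>_def n_def)
      finally show "x \<in> (\<Union>g\<in>G. cball g (\<delta> / 2))"
        using \<open>g \<in> G\<close> by (auto simp: dist_norm)
    qed
    ultimately show ?thesis using \<open>finite G\<close> by blast
  qed
  ultimately show ?thesis unfolding n_def by blast
qed

text \<open>With exponent one above the dimension, the O(\<delta>^(-dim)) grid balls of diameter
  \<delta> contribute O(\<delta>). Nonemptiness matters because the infimum of the empty set of
  reals is unspecified.\<close>

lemma intermediate_exponents_nonempty:
  fixes A :: "'a::euclidean_space set"
  assumes "bounded A" "0 < \<theta>" "\<theta> < 1"
  shows "intermediate_exponents \<theta> A \<noteq> {}"
proof -
  obtain C where C: "C > 0" and grid: "\<And>\<delta>. 0 < \<delta> \<Longrightarrow> \<delta> \<le> 1 \<Longrightarrow>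
    \<exists>G. finite G \<and> real (card G) \<le> C * (1 / \<delta>) ^ DIM('a) \<and> A \<subseteq> (\<Union>g\<in>G. cball g (\<delta> / 2))"
    using finite_grid_cover[OF assms(1)] by blast
  define s where "s = real (DIM('a) + 1)"
  have "\<exists>\<delta>\<^sub>0>0. \<forall>\<delta>. 0 < \<delta> \<and> \<delta> \<le> \<delta>\<^sub>0 \<longrightarrow>
       (\<exists>I U. diam_cover (\<delta> powr (1 / \<theta>)) \<delta> A I U \<and> diam_sum s I U < ennreal \<epsilon>)" if \<epsilon>: "\<epsilon> > 0" for \<epsilon>
  proof -
    have "\<exists>I U. diam_cover (\<delta> powr (1 / \<theta>)) \<delta> A I U \<and> diam_sum s I U < ennreal \<epsilon>"
      if \<delta>: "0 < \<delta>" "\<delta> \<le> min 1 (\<epsilon> / (2 * C))" for \<delta>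
    proof -
      obtain G where G: "finite G" "real (card G) \<le> C * (1 / \<delta>) ^ DIM('a)" "A \<subseteq> (\<Union>g\<in>G. cball g (\<delta> / 2))"
        using grid[of \<delta>] \<delta> by auto
      obtain g where g: "bij_betw g {..<card G} G"
        using ex_bij_betw_nat_finite[OF G(1)] by (auto simp: atLeast0LessThan)
      define U where "U i = cball (g i) (\<delta> / 2)" for i
      have diam: "diameter (U i) = \<delta>" for i using \<delta> by (simp add: U_def)
      have "\<delta> powr (1 / \<theta>) \<le> \<delta> powr 1"
        using \<delta> assms by (intro powr_mono') (auto simp: field_simps)
      moreover have "A \<subseteq> (\<Union>i<card G. U i)"
      proof -
        have "(\<Union>i<card G. U i) = (\<Union>h\<in>g ` {..<card G}. cball h (\<delta> / 2))"
          by (simp add: U_def)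
        then show ?thesis using G(3) bij_betw_imp_surj_on[OF g] by simp
      qed
      ultimately have "diam_cover (\<delta> powr (1 / \<theta>)) \<delta> A {..<card G} U"
        unfolding diam_cover_def diam using \<delta> by (auto simp: U_def)
      moreover have "diam_sum s {..<card G} U < ennreal \<epsilon>"
      proof -
        have "diam_sum s {..<card G} U = ennreal (card G * \<delta> powr s)"
          unfolding diam_sum_def diam using \<delta> by (simp add: ennreal_of_nat_eq_real_of_nat ennreal_mult)
        moreover have "card G * \<delta> powr s < \<epsilon>"
        proof -
          have "\<delta> powr s = \<delta> ^ DIM('a) * \<delta>" unfolding s_def using \<delta> by (subst powr_realpow) auto
          then have "card G * \<delta> powr s \<le> C * (1 / \<delta>) ^ DIM('a) * (\<delta> ^ DIM('a) * \<delta>)"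
            using G(2) \<delta> by (simp only:) (intro mult_right_mono, auto)
          also have "\<dots> = C * \<delta>" using \<delta> by (simp add: power_divide)
          also have "\<dots> < \<epsilon>" using \<delta> C \<epsilon> by (simp add: field_simps) 
          finally show ?thesis .
        qed
        ultimately show ?thesis by (simp add: ennreal_less_iff)
      qed
      ultimately show ?thesis by blast
    qed
    then show ?thesis using C \<epsilon> by (intro exI[of _ "min 1 (\<epsilon> / (2 * C))"]) auto
  qed
  then have "s \<in> intermediate_exponents \<theta> A"
    by (simp add: intermediate_exponents_def s_def)
  then show ?thesis by blast
qed

lemma upper_intermediate_dim_nonneg:
  assumes "bounded A" "0 < \<theta>" "\<theta> < 1"
  shows "0 \<le> upper_intermediate_dim \<theta> A"
  unfolding upper_intermediate_dim_eq
  using intermediate_exponents_nonempty[OF assms]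
  by (intro cInf_greatest) (auto simp: intermediate_exponents_def)

lemma upper_intermediate_dim_mono:
  assumes "bounded A" "0 < \<theta>" "\<theta> \<le> \<theta>'" "\<theta>' < 1"
  shows "upper_intermediate_dim \<theta> A \<le> upper_intermediate_dim \<theta>' A"
  unfolding upper_intermediate_dim_eq
  using assms by (intro cInf_superset_mono intermediate_exponents_nonempty
      bdd_below_intermediate_exponents intermediate_exponents_antimono) auto

text \<open>Monotonicity in \<theta> makes the infimum over (0, 1) the limit at 0. Without an
  existing limit, \<open>Lim\<close> would be an arbitrary value.\<close>

lemma tendsto_quasi_hausdorff_dim:
  assumes "bounded A"
  shows "((\<lambda>\<theta>. upper_intermediate_dim \<theta> A) \<longlongrightarrow> quasi_hausdorff_dim A) (at_right 0)"
proof -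
  let ?d = "\<lambda>\<theta>. upper_intermediate_dim \<theta> A"
  define L where "L = Inf (?d ` {0<..<1})"
  have bdd: "bdd_below (?d ` {0<..<1})"
    by (rule bdd_belowI[of _ 0]) (auto intro: upper_intermediate_dim_nonneg assms)
  have "(?d \<longlongrightarrow> L) (at_right 0)"
  proof (rule order_tendstoI)
    fix a assume "a < L"
    moreover have "L \<le> ?d \<theta>" if "0 < \<theta>" "\<theta> < 1" for \<theta>
      unfolding L_def using that by (intro cInf_lower bdd) auto
    ultimately show "\<forall>\<^sub>F \<theta> in at_right 0. a < ?d \<theta>"
      unfolding eventually_at_right_field by (intro exI[of _ 1]) force
  next
    fix a assume "L < a"
    then obtain t where t: "0 < t" "t < 1" "?d t < a"
      unfolding L_def using cInf_less_iff[OF _ bdd, of a] by auto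
    have "?d \<theta> < a" if "0 < \<theta>" "\<theta> < t" for \<theta>
      using upper_intermediate_dim_mono[OF assms, of \<theta> t] that t by auto
    then show "\<forall>\<^sub>F \<theta> in at_right 0. ?d \<theta> < a"
      unfolding eventually_at_right_field using t by blast
  qed
  then show ?thesis
    unfolding quasi_hausdorff_dim_def by (simp add: tendsto_Lim)
qed

text \<open>The inequality holds for each \<theta> with the same factor 1 / \<alpha>, so it survives
  the limit.\<close>

theorem quasi_hausdorff_dim_hoelder_image:
  fixes E :: "'a::euclidean_space set" and f :: "'a \<Rightarrow> 'b::euclidean_space"
  assumes "bounded E" "bounded (f ` E)" "\<alpha> > 0"
    and hoelder: "\<And>x y. x \<in> E \<Longrightarrow> y \<in> E \<Longrightarrow> dist (f x) (f y) \<le> C * dist x y powr \<alpha>"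
  shows "quasi_hausdorff_dim (f ` E) \<le> quasi_hausdorff_dim E / \<alpha>"
proof (rule tendsto_le[OF _ _ tendsto_quasi_hausdorff_dim[OF assms(2)]])
  show "((\<lambda>\<theta>. upper_intermediate_dim \<theta> E / \<alpha>) \<longlongrightarrow> quasi_hausdorff_dim E / \<alpha>) (at_right 0)"
    using \<open>\<alpha> > 0\<close> by (intro tendsto_intros tendsto_quasi_hausdorff_dim assms) auto
  have "upper_intermediate_dim \<theta> (f ` E) \<le> upper_intermediate_dim \<theta> E / \<alpha>"
    if "0 < \<theta>" "\<theta> < 1" for \<theta>
  proof -
    have "upper_intermediate_dim \<theta> (f ` E) * \<alpha> \<le> upper_intermediate_dim \<theta> E"
      unfolding upper_intermediate_dim_eq[of _ E]
    proof (rule cInf_greatest)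
      fix s assume "s \<in> intermediate_exponents \<theta> E"
      then have "s / \<alpha> \<in> intermediate_exponents \<theta> (f ` E)"
        using that assms by (intro intermediate_exponents_hoelder_image[OF hoelder]) auto
      then have "upper_intermediate_dim \<theta> (f ` E) \<le> s / \<alpha>"
        unfolding upper_intermediate_dim_eq by (intro cInf_lower bdd_below_intermediate_exponents)
      then show "upper_intermediate_dim \<theta> (f ` E) * \<alpha> \<le> s" using \<open>\<alpha> > 0\<close> by (simp add: field_simps)
    qed (use that assms in \<open>simp add: intermediate_exponents_nonempty\<close>)
    then show ?thesis using \<open>\<alpha> > 0\<close> by (simp add: field_simps)
  qed
  then show "\<forall>\<^sub>F \<theta> in at_right 0. upper_intermediate_dim \<theta> (f ` E) \<le> upper_intermediate_dim \<theta> E / \<alpha>"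
    unfolding eventually_at_right_field by (intro exI[of _ 1]) auto
qed simp

section \<open>A Poincare inequality for double integrals\<close>

text \<open>The tangent of x^n at b lies below the graph; this is Bernoulli's inequality at a / b -
  1. Its linearity in \<open>a\<close> is what allows it to be integrated.\<close>

lemma young_tangent:
  fixes a b :: real
  assumes "a \<ge> 0" "b \<ge> 0" "n \<ge> 1"
  shows "n * b ^ (n - 1) * a \<le> a ^ n + (n - 1) * b ^ n"
proof (cases "b = 0")
  case True
  with assms show ?thesis by (cases "n = 1") (auto simp: power_0_left)
next
  case False
  then have b: "b > 0" using assms by simp
  have "1 + n * (a / b - 1) \<le> (1 + (a / b - 1)) ^ n"
    using assms b by (intro Bernoulli_inequality) auto
  then have "(1 + n * (a / b - 1)) * b ^ n \<le> (a / b) ^ n * b ^ n"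
    using b by (intro mult_right_mono) auto
  moreover have "a / b * b ^ n = b ^ (n - 1) * a" "(a / b) ^ n * b ^ n = a ^ n"
    using b assms by (cases n; auto simp: power_divide)+
  moreover have "(1 + n * (a / b - 1)) * b ^ n = b ^ n + n * (a / b * b ^ n) - n * b ^ n"
    by (simp add: algebra_simps)
  ultimately have "b ^ n + n * (b ^ (n - 1) * a) - n * b ^ n \<le> a ^ n"
    by metis
  then show ?thesis
    using assms by (simp add: algebra_simps of_nat_diff)
qed

lemma young_tangent_ennreal:
  fixes a b :: ennreal
  assumes "n \<ge> 1" "b < top"
  shows "of_nat n * b ^ (n - 1) * a \<le> a ^ n + of_nat (n - 1) * b ^ n"
proof (cases "a = top")
  case True
  then show ?thesis using assms by (simp add: top_power_ennreal)
next
  case False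
  then obtain x y where xy: "x \<ge> 0" "a = ennreal x" "y \<ge> 0" "b = ennreal y"
    using assms(2) by (cases a; cases b) auto
  have "real n * y ^ (n - 1) * x \<le> x ^ n + real (n - 1) * y ^ n"
    using young_tangent[OF xy(1,3) assms(1)] assms by (simp add: of_nat_diff)
  then show ?thesis
    unfolding xy using xy(1,3) by (simp add: ennreal_power ennreal_of_nat_eq_real_of_nat ennreal_leI flip: ennreal_mult ennreal_plus)
qed

text \<open>Integrating the tangent inequality at the mean m against w gives n m^n \<le> I + (n - 1)
  m^n. The last term may be cancelled only if m is finite, which follows from g \<le> 1 + g^n when I
  is finite.\<close>

lemma nn_integral_jensen_power:
  fixes w g :: "'a \<Rightarrow> ennreal"
  assumes [measurable]: "w \<in> borel_measurable M" "g \<in> borel_measurable M"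
    and w: "(\<integral>\<^sup>+x. w x \<partial>M) = 1" and n: "n \<ge> 1"
  shows "(\<integral>\<^sup>+x. w x * g x \<partial>M) ^ n \<le> (\<integral>\<^sup>+x. w x * g x ^ n \<partial>M)"
proof -
  define I where "I = (\<integral>\<^sup>+x. w x * g x ^ n \<partial>M)"
  define m where "m = (\<integral>\<^sup>+x. w x * g x \<partial>M)"
  show ?thesis
  proof (cases "I = top")
    case True
    then show ?thesis by (simp add: I_def)
  next
    case False
    have "g x \<le> 1 + g x ^ n" for x
    proof (cases "g x \<le> 1")
      case True
      then show ?thesis by (simp add: add_increasing2)
    next
      case False
      then have "g x ^ 1 \<le> g x ^ n" using n by (intro power_increasing) auto
      then show ?thesis by (simp add: add_increasing)
    qed
    then have "w x * g x \<le> w x + w x * g x ^ n" for x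
      using mult_left_mono[of "g x" "1 + g x ^ n" "w x"] by (simp add: distrib_left)
    then have "m \<le> (\<integral>\<^sup>+x. w x + w x * g x ^ n \<partial>M)"
      unfolding m_def by (intro nn_integral_mono) auto
    also have "\<dots> = 1 + I" by (subst nn_integral_add) (auto simp: w I_def)
    finally have m: "m < top" using False
      by (metis ennreal_add_eq_top ennreal_one_neq_top le_less_trans less_top)
    have "of_nat n * m ^ n = of_nat n * m ^ (n - 1) * m"
      using n by (cases n) (auto simp: mult_ac)
    also have "\<dots> = (\<integral>\<^sup>+x. w x * (of_nat n * m ^ (n - 1) * g x) \<partial>M)"
      unfolding m_def by (subst nn_integral_cmult[symmetric]) (auto simp: mult_ac)
    also have "\<dots> \<le> (\<integral>\<^sup>+x. w x * (g x ^ n + of_nat (n - 1) * m ^ n) \<partial>M)"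
      by (intro nn_integral_mono mult_left_mono young_tangent_ennreal n m) auto
    also have "\<dots> = (\<integral>\<^sup>+x. w x * g x ^ n + of_nat (n - 1) * m ^ n * w x \<partial>M)"
      by (simp add: distrib_left mult_ac)
    also have "\<dots> = I + of_nat (n - 1) * m ^ n"
      by (subst nn_integral_add) (auto simp: I_def nn_integral_cmult w)
    also have "of_nat n * m ^ n = m ^ n + of_nat (n - 1) * m ^ n"
      using n by (cases n) (auto simp: distrib_right)
    finally have "m ^ n \<le> I"
      using m by (auto simp: ennreal_add_left_cancel_le add.commute ennreal_mult_eq_top_iff power_eq_top_ennreal_iff less_top)
    then show ?thesis by (simp add: m_def I_def)
  qed
qed

lemma nn_integral_lborel_affine:
  fixes f :: "'a::euclidean_space \<Rightarrow> ennreal"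
  assumes [measurable]: "f \<in> borel_measurable borel" and "c \<noteq> 0"
  shows "(\<integral>\<^sup>+x. f x \<partial>lborel) = ennreal (\<bar>c\<bar> ^ DIM('a)) * (\<integral>\<^sup>+x. f (a + c *\<^sub>R x) \<partial>lborel)"
  by (subst lborel_affine[OF \<open>c \<noteq> 0\<close>, of a])
    (simp add: nn_integral_density nn_integral_distr nn_integral_cmult ennreal_power)

lemma power_add_le:
  fixes a b :: real
  assumes "a \<ge> 0" "b \<ge> 0"
  shows "(a + b) ^ n \<le> 2 ^ n * (a ^ n + b ^ n)"
proof -
  have "(a + b) ^ n \<le> (2 * max a b) ^ n" using assms by (intro power_mono) auto
  also have "\<dots> = 2 ^ n * max a b ^ n" by (rule power_mult_distrib)
  also have "max a b ^ n \<le> a ^ n + b ^ n" using assms by (simp add: max_def)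
  finally show ?thesis by simp
qed

lemma nn_integral_power_add_le:
  fixes a b c :: "'a::euclidean_space \<Rightarrow> real"
  assumes [measurable]: "a \<in> borel_measurable borel" "b \<in> borel_measurable borel" "S \<in> sets borel"
    and nonneg: "\<And>x. 0 \<le> a x" "\<And>x. 0 \<le> b x" "\<And>x. 0 \<le> c x" and le: "\<And>x. c x \<le> a x + b x"
  shows "(\<integral>\<^sup>+x\<in>S. ennreal (c x ^ n) \<partial>lborel) \<le>
    ennreal (2 ^ n) * ((\<integral>\<^sup>+x\<in>S. ennreal (a x ^ n) \<partial>lborel) + (\<integral>\<^sup>+x\<in>S. ennreal (b x ^ n) \<partial>lborel))"
proof -
  have "c x ^ n \<le> 2 ^ n * (a x ^ n + b x ^ n)" for x
    by (rule order_trans[OF power_mono[OF le nonneg(3)] power_add_le[OF nonneg(1,2)]])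
  then have "ennreal (c x ^ n) \<le> ennreal (2 ^ n) * (ennreal (a x ^ n) + ennreal (b x ^ n))" for x
    using nonneg by (simp add: ennreal_leI flip: ennreal_plus ennreal_mult)
  then have "(\<integral>\<^sup>+x\<in>S. ennreal (c x ^ n) \<partial>lborel) \<le>
      (\<integral>\<^sup>+x. ennreal (2 ^ n) * (ennreal (a x ^ n) * indicator S x + ennreal (b x ^ n) * indicator S x) \<partial>lborel)"
    by (intro nn_integral_mono) (auto simp: indicator_def)
  also have "\<dots> = ennreal (2 ^ n) * ((\<integral>\<^sup>+x\<in>S. ennreal (a x ^ n) \<partial>lborel) + (\<integral>\<^sup>+x\<in>S. ennreal (b x ^ n) \<partial>lborel))"
    by (simp add: nn_integral_cmult nn_integral_add)
  finally show ?thesis .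
qed

definition C1_map :: "(real ^ 'n::finite \<Rightarrow> real ^ 'n) \<Rightarrow> (real ^ 'n \<Rightarrow> real ^ 'n ^ 'n) \<Rightarrow> bool" where
  "C1_map u Du \<longleftrightarrow> (\<forall>x. (u has_derivative (\<lambda>h. Du x *v h)) (at x)) \<and> continuous_on UNIV Du"

lemma C1_mapD:
  assumes "C1_map u Du"
  shows "(u has_derivative (\<lambda>h. Du x *v h)) (at x within S)" "continuous_on S Du" "continuous_on S u"
    "u \<in> borel_measurable borel" "Du \<in> borel_measurable borel"
proof -
  have d: "(u has_derivative (\<lambda>h. Du x *v h)) (at x)" and c: "continuous_on UNIV Du" for x
    using assms by (auto simp: C1_map_def)
  show "(u has_derivative (\<lambda>h. Du x *v h)) (at x within S)"
    using d by (rule has_derivative_at_withinI)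
  have cu: "continuous_on UNIV u"
    using d by (intro has_derivative_continuous_on) (auto intro: has_derivative_at_withinI)
  show "continuous_on S Du" "continuous_on S u"
    using c cu by (auto intro: continuous_on_subset)
  show "u \<in> borel_measurable borel" "Du \<in> borel_measurable borel"
    using c cu by (auto intro: borel_measurable_continuous_onI)
qed

text \<open>The fundamental theorem of calculus on the segment from x to z, followed by Jensen's
  inequality for Lebesgue measure on [0, 1].\<close>

lemma C1_map_segment_bound:
  fixes u :: "real ^ 'n \<Rightarrow> real ^ 'n"
  assumes C1: "C1_map u Du" and d: "norm (x - z) \<le> d" and n: "n \<ge> 1"
  shows "ennreal (norm (u x - u z) ^ n) \<le>
    ennreal (d ^ n) * (\<integral>\<^sup>+t\<in>{0..1}. ennreal (norm (Du ((1 - t) *\<^sub>R x + t *\<^sub>R z)) ^ n) \<partial>lborel)"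
proof -
  define \<gamma> where "\<gamma> t = (1 - t) *\<^sub>R x + t *\<^sub>R z" for t
  have d0: "d \<ge> 0" using d norm_ge_zero order_trans by blast
  have cont: "continuous_on {0..1} (\<lambda>t. norm (Du (\<gamma> t)))"
    unfolding \<gamma>_def by (intro continuous_intros continuous_on_compose2[OF C1_mapD(2)[OF C1, of UNIV]]) auto
  have vd: "((\<lambda>t. u (\<gamma> t)) has_vector_derivative (Du (\<gamma> t) *v (z - x))) (at t within {0..1})" for t
  proof -
    have "((\<lambda>t. u (\<gamma> t)) has_derivative (\<lambda>s. Du (\<gamma> t) *v (s *\<^sub>R (z - x)))) (at t within {0..1})"
      unfolding \<gamma>_def
      by (rule has_derivative_compose[OF _ C1_mapD(1)[OF C1]])
        (auto intro!: derivative_eq_intros simp: algebra_simps)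
    then show ?thesis
      by (simp add: has_vector_derivative_def matrix_vector_mult_scaleR)
  qed
  have "((\<lambda>t. Du (\<gamma> t) *v (z - x)) has_integral (u (\<gamma> 1) - u (\<gamma> 0))) {0..1}"
    using vd by (intro fundamental_theorem_of_calculus) auto
  then have eq: "u z - u x = integral {0..1} (\<lambda>t. Du (\<gamma> t) *v (z - x))"
    and int: "(\<lambda>t. Du (\<gamma> t) *v (z - x)) integrable_on {0..1}"
    by (auto simp: \<gamma>_def integral_unique integrable_on_def)
  have "norm (u z - u x) \<le> integral {0..1} (\<lambda>t. norm (Du (\<gamma> t)) * d)"
    unfolding eq
  proof (rule integral_norm_bound_integral[OF int])
    show "(\<lambda>t. norm (Du (\<gamma> t)) * d) integrable_on {0..1}"
      by (intro integrable_continuous_real continuous_intros cont)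
    fix t
    have "norm (Du (\<gamma> t) *v (z - x)) \<le> norm (Du (\<gamma> t)) * norm (z - x)"
      by (rule norm_matrix_vector_mult_le)
    also have "\<dots> \<le> norm (Du (\<gamma> t)) * d" using d by (intro mult_left_mono) (auto simp: norm_minus_commute)
    finally show "norm (Du (\<gamma> t) *v (z - x)) \<le> norm (Du (\<gamma> t)) * d" .
  qed
  also have "\<dots> = d * integral {0..1} (\<lambda>t. norm (Du (\<gamma> t)))" by (simp add: mult.commute)
  finally have bound: "norm (u x - u z) \<le> d * integral {0..1} (\<lambda>t. norm (Du (\<gamma> t)))"
    by (simp add: norm_minus_commute)
  have nonneg: "integral {0..1} (\<lambda>t. norm (Du (\<gamma> t))) \<ge> 0" by (rule integral_nonneg) (auto intro!: integrable_continuous_real cont)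
  have [measurable]: "\<gamma> \<in> borel_measurable borel" unfolding \<gamma>_def by measurable
  note [measurable] = C1_mapD(4,5)[OF C1]
  have "ennreal (integral {0..1} (\<lambda>t. norm (Du (\<gamma> t)))) = (\<integral>\<^sup>+t\<in>{0..1}. ennreal (norm (Du (\<gamma> t))) \<partial>lborel)"
    by (rule nn_integral_has_integral_lebesgue'[symmetric, OF _ integrable_integral])
      (auto intro!: integrable_continuous_real cont)
  then have "ennreal (integral {0..1} (\<lambda>t. norm (Du (\<gamma> t)))) ^ n =
      (\<integral>\<^sup>+t. indicator {0..1} t * ennreal (norm (Du (\<gamma> t))) \<partial>lborel) ^ n"
    by (simp add: mult.commute)
  also have "\<dots> \<le> (\<integral>\<^sup>+t. indicator {0..1} t * ennreal (norm (Du (\<gamma> t))) ^ n \<partial>lborel)"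
    by (rule nn_integral_jensen_power) (use n in auto)
  finally have J: "ennreal (integral {0..1} (\<lambda>t. norm (Du (\<gamma> t))) ^ n) \<le>
      (\<integral>\<^sup>+t\<in>{0..1}. ennreal (norm (Du (\<gamma> t)) ^ n) \<partial>lborel)"
    using nonneg by (simp add: ennreal_power mult.commute)
  have "ennreal (norm (u x - u z) ^ n) \<le> ennreal ((d * integral {0..1} (\<lambda>t. norm (Du (\<gamma> t)))) ^ n)"
    using bound by (intro ennreal_leI power_mono) auto
  also have "\<dots> = ennreal (d ^ n) * ennreal (integral {0..1} (\<lambda>t. norm (Du (\<gamma> t))) ^ n)"
    using d0 nonneg by (simp add: power_mult_distrib ennreal_mult)
  also have "\<dots> \<le> ennreal (d ^ n) * (\<integral>\<^sup>+t\<in>{0..1}. ennreal (norm (Du (\<gamma> t)) ^ n) \<partial>lborel)"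
    by (intro mult_left_mono J) auto
  finally show ?thesis unfolding \<gamma>_def .
qed

text \<open>For \<open>S = T\<close> of finite positive measure this is comparable to the measure of
  \<open>S\<close> times the integral of the n-th power deviation of \<open>u\<close> from its mean
  over \<open>S\<close>, but no mean has to be named.\<close>

definition double_osc :: "nat \<Rightarrow> ('a::euclidean_space \<Rightarrow> 'b::euclidean_space) \<Rightarrow> 'a set \<Rightarrow> 'a set \<Rightarrow> ennreal" where
  "double_osc n u S T = (\<integral>\<^sup>+x\<in>S. (\<integral>\<^sup>+z\<in>T. ennreal (norm (u x - u z) ^ n) \<partial>lborel) \<partial>lborel)"

text \<open>
  At the point \<open>(1 - t) x + t z\<close> of the segment one substitutes in \<open>z\<close> if \<open>t \<ge> 1/2\<close> and in \<open>x\<close>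
  otherwise, so that the Jacobian factor stays bounded.
\<close>

theorem double_osc_le_convex:
  fixes u :: "real ^ 'n \<Rightarrow> real ^ 'n"
  assumes C1: "C1_map u Du" and P[measurable]: "P \<in> sets borel" and "convex P"
    and d: "\<And>x z. x \<in> P \<Longrightarrow> z \<in> P \<Longrightarrow> norm (x - z) \<le> d" and n: "n = CARD('n)"
  shows "double_osc n u P P \<le>
    ennreal ((2 * d) ^ n) * (emeasure lborel P * (\<integral>\<^sup>+x\<in>P. ennreal (norm (Du x) ^ n) \<partial>lborel))"
proof (cases "P = {}")
  case True
  then show ?thesis by (simp add: double_osc_def)
next
  case False
  then have d0: "d \<ge> 0" using d norm_ge_zero order_trans by (metis ex_in_conv)
  note [measurable] = C1_mapD(4,5)[OF C1]
  have n1: "n \<ge> 1" using n by (simp add: Suc_leI)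
  define G where "G x = ennreal (norm (Du x) ^ n) * indicator P x" for x
  have [measurable]: "G \<in> borel_measurable borel" unfolding G_def by measurable
  define D where "D = (\<integral>\<^sup>+x. G x \<partial>lborel)"
  define i where "i x = (indicator P x :: ennreal)" for x
  have [measurable]: "i \<in> borel_measurable borel" unfolding i_def by measurable
  have int_i: "(\<integral>\<^sup>+x. i x \<partial>lborel) = emeasure lborel P" unfolding i_def by simp
  \<comment> \<open>The substitution has Jacobian t^n \<ge> 2^(-n).\<close>
  have half: "(\<integral>\<^sup>+z. G (a + t *\<^sub>R z) \<partial>lborel) \<le> 2 ^ n * D" if "t \<ge> 1/2" for a and t :: real
  proof -
    have "D = ennreal (\<bar>t\<bar> ^ n) * (\<integral>\<^sup>+z. G (a + t *\<^sub>R z) \<partial>lborel)"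
      unfolding D_def using that by (subst nn_integral_lborel_affine[of G t a]) (auto simp: n)
    then have "ennreal (2 ^ n) * D = ennreal (2 ^ n * \<bar>t\<bar> ^ n) * (\<integral>\<^sup>+z. G (a + t *\<^sub>R z) \<partial>lborel)"
      by (simp add: ennreal_mult' mult.assoc)
    moreover have "1 \<le> 2 ^ n * \<bar>t\<bar> ^ n"
      using that one_le_power[of "2 * \<bar>t\<bar>" n] by (simp add: power_mult_distrib)
    ultimately have "1 * (\<integral>\<^sup>+z. G (a + t *\<^sub>R z) \<partial>lborel) \<le> ennreal (2 ^ n) * D"
      by (simp only:) (intro mult_right_mono, auto simp: ennreal_ge_1)
    then show ?thesis by (simp flip: ennreal_power)
  qed
  have inner: "(\<integral>\<^sup>+x. \<integral>\<^sup>+z. i x * i z * G ((1 - t) *\<^sub>R x + t *\<^sub>R z) \<partial>lborel \<partial>lborel)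
      \<le> 2 ^ n * (emeasure lborel P * D)" if t: "t \<in> {0..1}" for t
  proof (cases "t \<ge> 1/2")
    case True
    have "(\<integral>\<^sup>+x. \<integral>\<^sup>+z. i x * i z * G ((1 - t) *\<^sub>R x + t *\<^sub>R z) \<partial>lborel \<partial>lborel)
      \<le> (\<integral>\<^sup>+x. \<integral>\<^sup>+z. i x * G ((1 - t) *\<^sub>R x + t *\<^sub>R z) \<partial>lborel \<partial>lborel)"
      by (intro nn_integral_mono) (auto simp: i_def indicator_def)
    also have "\<dots> = (\<integral>\<^sup>+x. i x * (\<integral>\<^sup>+z. G ((1 - t) *\<^sub>R x + t *\<^sub>R z) \<partial>lborel) \<partial>lborel)"
      by (subst nn_integral_cmult) auto
    also have "\<dots> \<le> (\<integral>\<^sup>+x. i x * (2 ^ n * D) \<partial>lborel)"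
      by (intro nn_integral_mono mult_left_mono half True) auto
    also have "\<dots> = 2 ^ n * (emeasure lborel P * D)"
      by (subst nn_integral_multc) (auto simp: int_i mult_ac)
    finally show ?thesis .
  next
    case False
    then have t2: "1 - t \<ge> 1/2" by simp
    have "(\<integral>\<^sup>+x. \<integral>\<^sup>+z. i x * i z * G ((1 - t) *\<^sub>R x + t *\<^sub>R z) \<partial>lborel \<partial>lborel)
      = (\<integral>\<^sup>+z. \<integral>\<^sup>+x. i x * i z * G ((1 - t) *\<^sub>R x + t *\<^sub>R z) \<partial>lborel \<partial>lborel)"
      by (rule lborel_pair.Fubini') measurable
    also have "\<dots> \<le> (\<integral>\<^sup>+z. \<integral>\<^sup>+x. i z * G (t *\<^sub>R z + (1 - t) *\<^sub>R x) \<partial>lborel \<partial>lborel)"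
      by (intro nn_integral_mono) (auto simp: i_def indicator_def add.commute)
    also have "\<dots> = (\<integral>\<^sup>+z. i z * (\<integral>\<^sup>+x. G (t *\<^sub>R z + (1 - t) *\<^sub>R x) \<partial>lborel) \<partial>lborel)"
      by (subst nn_integral_cmult) auto
    also have "\<dots> \<le> (\<integral>\<^sup>+z. i z * (2 ^ n * D) \<partial>lborel)"
      by (intro nn_integral_mono mult_left_mono half t2) auto
    also have "\<dots> = 2 ^ n * (emeasure lborel P * D)"
      by (subst nn_integral_multc) (auto simp: int_i mult_ac)
    finally show ?thesis .
  qed
  \<comment> \<open>All restrictions are moved into indicators so that the three integrals run over
    whole spaces and may be interchanged.\<close>
  define H where "H x z t = indicator {0..1} t * (i x * i z * G ((1 - t) *\<^sub>R x + t *\<^sub>R z))" for x z and t :: real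
  have seg: "ennreal (norm (u x - u z) ^ n) * indicator P z * indicator P x \<le>
      ennreal (d ^ n) * (\<integral>\<^sup>+t. H x z t \<partial>lborel)" for x z
  proof (cases "x \<in> P \<and> z \<in> P")
    case True
    have "ennreal (norm (u x - u z) ^ n) \<le>
      ennreal (d ^ n) * (\<integral>\<^sup>+t\<in>{0..1}. ennreal (norm (Du ((1 - t) *\<^sub>R x + t *\<^sub>R z)) ^ n) \<partial>lborel)"
      using True d n1 by (intro C1_map_segment_bound[OF C1]) auto
    also have "(\<integral>\<^sup>+t\<in>{0..1}. ennreal (norm (Du ((1 - t) *\<^sub>R x + t *\<^sub>R z)) ^ n) \<partial>lborel) = (\<integral>\<^sup>+t. H x z t \<partial>lborel)"
    proof (rule nn_integral_cong)
      fix t :: real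
      \<comment> \<open>Convexity keeps the segment in \<open>P\<close>, so the indicator inside
        \<open>G\<close> is 1 along it.\<close>
      have "(1 - t) *\<^sub>R x + t *\<^sub>R z \<in> P" if "t \<in> {0..1}"
        using True that \<open>convex P\<close> by (auto simp: convex_alt)
      then show "ennreal (norm (Du ((1 - t) *\<^sub>R x + t *\<^sub>R z)) ^ n) * indicator {0..1} t = H x z t"
        using True by (auto simp: H_def G_def i_def indicator_def)
    qed
    finally show ?thesis using True by simp
  qed auto
  have mH[measurable]: "(\<lambda>(x, z, t). H x z t) \<in> borel_measurable (lborel \<Otimes>\<^sub>M lborel \<Otimes>\<^sub>M lborel)"
    unfolding H_def by measurable
  have "double_osc n u P P = (\<integral>\<^sup>+x. \<integral>\<^sup>+z. ennreal (norm (u x - u z) ^ n) * indicator P z * indicator P x \<partial>lborel \<partial>lborel)"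
    unfolding double_osc_def by (subst nn_integral_multc) auto
  also have "\<dots> \<le> (\<integral>\<^sup>+x. \<integral>\<^sup>+z. ennreal (d ^ n) * (\<integral>\<^sup>+t. H x z t \<partial>lborel) \<partial>lborel \<partial>lborel)"
    by (intro nn_integral_mono seg)
  also have "\<dots> = ennreal (d ^ n) * (\<integral>\<^sup>+x. \<integral>\<^sup>+z. \<integral>\<^sup>+t. H x z t \<partial>lborel \<partial>lborel \<partial>lborel)"
    unfolding H_def by (subst nn_integral_cmult nn_integral_cmult, measurable)+
  \<comment> \<open>The t integral is moved outermost, past z and then past x, because
    \<open>inner\<close> holds for each fixed t.\<close>
  also have "(\<integral>\<^sup>+x. \<integral>\<^sup>+z. \<integral>\<^sup>+t. H x z t \<partial>lborel \<partial>lborel \<partial>lborel)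
    = (\<integral>\<^sup>+x. \<integral>\<^sup>+t. \<integral>\<^sup>+z. H x z t \<partial>lborel \<partial>lborel \<partial>lborel)"
    unfolding H_def by (intro nn_integral_cong lborel_pair.Fubini') measurable
  also have "\<dots> = (\<integral>\<^sup>+t. \<integral>\<^sup>+x. \<integral>\<^sup>+z. H x z t \<partial>lborel \<partial>lborel \<partial>lborel)"
    unfolding H_def by (rule lborel_pair.Fubini') measurable
  also have "\<dots> = (\<integral>\<^sup>+t. indicator {0..1} t * (\<integral>\<^sup>+x. \<integral>\<^sup>+z. i x * i z * G ((1 - t) *\<^sub>R x + t *\<^sub>R z) \<partial>lborel \<partial>lborel) \<partial>lborel)"
    unfolding H_def by (intro nn_integral_cong) (simp add: nn_integral_cmult)
  also have "\<dots> \<le> (\<integral>\<^sup>+t. indicator {0..1::real} t * (2 ^ n * (emeasure lborel P * D)) \<partial>lborel)"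
    using inner by (intro nn_integral_mono) (auto simp: indicator_def)
  also have "\<dots> = 2 ^ n * (emeasure lborel P * D)"
    by (subst nn_integral_multc) auto
  finally have "double_osc n u P P \<le> ennreal (d ^ n) * (2 ^ n * (emeasure lborel P * D))"
    by (simp add: mult_left_mono)
  also have "\<dots> = ennreal ((2 * d) ^ n) * (emeasure lborel P * D)"
    using d0 by (simp add: power_mult_distrib ennreal_mult ennreal_power[symmetric] mult_ac)
  finally show ?thesis by (simp add: D_def G_def)
qed

section \<open>Hole filling for smooth maps\<close>

text \<open>Balls of the maximum norm. They are boxes, as \<open>integral_det_eq_0\<close> wants,
  and the difference of two concentric ones is a union of convex slabs.\<close>

definition cube :: "real ^ 'n::finite \<Rightarrow> real \<Rightarrow> (real ^ 'n) set" where
  "cube p r = {x. \<forall>i. \<bar>x $ i - p $ i\<bar> \<le> r}"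

lemma cube_eq_cbox: "cube p r = cbox (p - vec r) (p + vec r)"
  by (auto simp: cube_def mem_box_cart abs_le_iff algebra_simps)

lemma cube_borel [measurable, simp]: "cube p r \<in> sets borel"
  by (simp add: cube_eq_cbox)

lemma compact_cube [simp]: "compact (cube p r)"
  by (simp add: cube_eq_cbox)

lemma convex_cube [simp]: "convex (cube p r)"
  by (simp add: cube_eq_cbox)

lemma cube_mono: "r \<le> s \<Longrightarrow> cube p r \<subseteq> cube p s"
  by (auto simp: cube_def intro: order_trans)

lemma emeasure_cube:
  assumes "r \<ge> 0"
  shows "emeasure lborel (cube (p :: real ^ 'n) r) = ennreal ((2 * r) ^ CARD('n))"
proof -
  have "emeasure lborel (cube p r) = ennreal (Henstock_Kurzweil_Integration.content (cube p r))"
    unfolding cube_eq_cbox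
    by (intro emeasure_eq_ennreal_measure) (metis emeasure_lborel_cbox_finite infinity_ennreal_def less_irrefl)
  also have "Henstock_Kurzweil_Integration.content (cube p r) = (2 * r) ^ CARD('n)"
    using assms unfolding cube_eq_cbox by (subst content_cbox_cart) (auto simp: interval_ne_empty_cart vec_def)
  finally show ?thesis .
qed

lemma norm_le_card_times:
  fixes x :: "real ^ 'n"
  assumes "\<And>i. \<bar>x $ i\<bar> \<le> b"
  shows "norm x \<le> real (CARD('n)) * b"
proof -
  have "norm x \<le> (\<Sum>i\<in>UNIV. \<bar>x $ i\<bar>)" by (rule norm_le_l1_cart)
  also have "\<dots> \<le> (\<Sum>i\<in>(UNIV :: 'n set). b)" by (intro sum_mono assms)
  finally show ?thesis by simp
qed

section \<open>A cutoff function between concentric cubes\<close>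

text \<open>The square of the positive part is C1, and a C1 cutoff is all that
  \<open>integral_det_eq_0\<close> asks for.\<close>

definition pos_square :: "real \<Rightarrow> real" where
  "pos_square s = (max 0 s)\<^sup>2"

lemma DERIV_pos_square: "(pos_square has_field_derivative 2 * max 0 s) (at s)"
proof -
  consider "s > 0" | "s < 0" | "s = 0" by linarith
  then show ?thesis
  proof cases
    case 1
    have "((\<lambda>s. s\<^sup>2) has_field_derivative 2 * max 0 s) (at s)"
      using 1 by (auto intro!: derivative_eq_intros)
    then show ?thesis
      by (rule has_field_derivative_transform_within_open[of _ _ _ "{0<..}"])
        (use 1 in \<open>auto simp: pos_square_def\<close>)
  next
    case 2
    have "((\<lambda>s. 0) has_field_derivative 2 * max 0 s) (at s)"
      using 2 by (auto intro!: derivative_eq_intros)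
    then show ?thesis
      by (rule has_field_derivative_transform_within_open[of _ _ _ "{..<0}"])
        (use 2 in \<open>auto simp: pos_square_def\<close>)
  next
    case 3
    have "((\<lambda>h. pos_square h / h) \<longlongrightarrow> 0) (at 0)"
    proof (rule tendsto_rabs_zero_cancel[OF tendsto_0_le[where K = 1]])
      show "((\<lambda>h::real. h) \<longlongrightarrow> 0) (at 0)" by (rule tendsto_ident_at)
      show "\<forall>\<^sub>F h in at 0. norm \<bar>pos_square h / h\<bar> \<le> norm h * 1"
        by (rule always_eventually) (auto simp: pos_square_def max_def power2_eq_square)
    qed
    then show ?thesis using 3 by (simp add: DERIV_def pos_square_def)
  qed
qed

text \<open>The value is 1 for s \<le> 0 and 0 for s \<ge> 1. The inner square makes the derivative
  vanish at 0, the outer one at 1.\<close>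

definition cutoff1 :: "real \<Rightarrow> real" where
  "cutoff1 s = pos_square (1 - pos_square s)"

definition cutoff1' :: "real \<Rightarrow> real" where
  "cutoff1' s = 2 * max 0 (1 - pos_square s) * (- (2 * max 0 s))"

lemma DERIV_cutoff1: "(cutoff1 has_field_derivative cutoff1' s) (at s)"
  unfolding cutoff1_def[abs_def] cutoff1'_def
  by (rule DERIV_chain2[OF DERIV_pos_square]) (auto intro!: derivative_eq_intros DERIV_pos_square)

lemma cutoff1_simps:
  "0 \<le> cutoff1 s" "cutoff1 s \<le> 1" "s \<le> 0 \<Longrightarrow> cutoff1 s = 1" "s \<ge> 1 \<Longrightarrow> cutoff1 s = 0"
  "s \<le> 0 \<Longrightarrow> cutoff1' s = 0" "s \<ge> 1 \<Longrightarrow> cutoff1' s = 0" "\<bar>cutoff1' s\<bar> \<le> 4"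
proof -
  have ge1: "pos_square s \<ge> 1" if "s \<ge> 1"
    using that by (simp add: pos_square_def)
  show "0 \<le> cutoff1 s" by (simp add: cutoff1_def pos_square_def)
  show "cutoff1 s \<le> 1" unfolding cutoff1_def pos_square_def
    by (intro power_le_one) auto
  show "s \<le> 0 \<Longrightarrow> cutoff1 s = 1" by (simp add: cutoff1_def pos_square_def)
  show "s \<ge> 1 \<Longrightarrow> cutoff1 s = 0" using ge1 by (simp add: cutoff1_def pos_square_def[of "1 - _"])
  show "s \<le> 0 \<Longrightarrow> cutoff1' s = 0" by (simp add: cutoff1'_def)
  show z: "s \<ge> 1 \<Longrightarrow> cutoff1' s = 0" using ge1 by (simp add: cutoff1'_def)
  show "\<bar>cutoff1' s\<bar> \<le> 4"
  proof (cases "s \<ge> 1")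
    case False
    have "\<bar>max 0 (1 - pos_square s) * max 0 s\<bar> \<le> 1 * 1"
      unfolding abs_mult using False by (intro mult_mono) (auto simp: pos_square_def)
    then show ?thesis by (simp add: cutoff1'_def abs_mult)
  qed (simp add: z)
qed

lemma continuous_on_cutoff1': "continuous_on UNIV cutoff1'"
  unfolding cutoff1'_def pos_square_def by (intro continuous_intros)

lemma cube_cutoff:
  fixes p :: "real ^ 'n"
  assumes r: "r > 0"
  obtains \<eta> g where "\<And>x. (\<eta> has_derivative (\<lambda>h. g x \<bullet> h)) (at x)" "continuous_on UNIV g"
    "\<And>x. 0 \<le> \<eta> x" "\<And>x. \<eta> x \<le> 1" "\<And>x. x \<in> cube p r \<Longrightarrow> \<eta> x = 1" "\<And>x. x \<in> cube p r \<Longrightarrow> g x = 0"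
    "\<And>x. x \<notin> cube p (2 * r) \<Longrightarrow> \<eta> x = 0" "\<And>x. norm (g x) \<le> real (CARD('n)) * (6 / r)"
proof -
  define c where "c = 1 / (3 * r\<^sup>2)"
  \<comment> \<open>With t the distance in coordinate i this is ((t / r)^2 - 1) / 3, which is 0 at t
    = r and 1 at t = 2 r; squaring avoids the corner of the absolute value.\<close>
  define s where "s x i = c * (x $ i - p $ i)\<^sup>2 - 1 / 3" for x and i :: 'n
  define s' where "s' x i = c * (2 * (x $ i - p $ i))" for x and i :: 'n
  define \<eta> where "\<eta> x = (\<Prod>i\<in>UNIV. cutoff1 (s x i))" for x
  define g where "g x = (\<chi> k. cutoff1' (s x k) * s' x k * (\<Prod>i\<in>UNIV - {k}. cutoff1 (s x i)))" for x
  have s_alt: "s x i = ((x $ i - p $ i)\<^sup>2 / r\<^sup>2 - 1) / 3" for x i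
    by (simp add: s_def c_def diff_divide_distrib)
  have s_le: "s x i \<le> 0" if "\<bar>x $ i - p $ i\<bar> \<le> r" for x i
  proof -
    have "(x $ i - p $ i)\<^sup>2 \<le> r\<^sup>2" using that r by (simp add: abs_le_square_iff[symmetric])
    then show ?thesis using r by (simp add: s_alt)
  qed
  have s_ge: "s x i \<ge> 1" if "\<bar>x $ i - p $ i\<bar> > 2 * r" for x i
  proof -
    have "(2 * r)\<^sup>2 \<le> (x $ i - p $ i)\<^sup>2"
      using that r power_mono[of "2 * r" "\<bar>x $ i - p $ i\<bar>" 2] by simp
    then have "4 \<le> (x $ i - p $ i)\<^sup>2 / r\<^sup>2" using r by (simp add: field_simps)
    then show ?thesis by (simp add: s_alt)
  qed
  have ds: "((\<lambda>x. s x i) has_derivative (\<lambda>h. s' x i * h $ i)) (at x)" for x i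
    unfolding s_def s'_def
    by (auto intro!: derivative_eq_intros bounded_linear_imp_has_derivative[OF bounded_linear_vec_nth])
  have dc: "((\<lambda>x. cutoff1 (s x i)) has_derivative (\<lambda>h. cutoff1' (s x i) * (s' x i * h $ i))) (at x)" for x i
    by (rule has_derivative_compose[OF ds DERIV_cutoff1[unfolded has_field_derivative_def]])
  have d\<eta>: "(\<eta> has_derivative (\<lambda>h. g x \<bullet> h)) (at x)" for x
  proof -
    have "(\<eta> has_derivative (\<lambda>h. \<Sum>i\<in>UNIV. cutoff1' (s x i) * (s' x i * h $ i) * (\<Prod>j\<in>UNIV - {i}. cutoff1 (s x j)))) (at x)"
      unfolding \<eta>_def[abs_def] by (rule has_derivative_prod[OF dc])
    then show ?thesis by (simp add: inner_vec_def g_def mult_ac)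
  qed
  have cs: "continuous_on UNIV (\<lambda>x. s x i)" for i
    unfolding s_def using r by (intro continuous_intros) auto
  have cg: "continuous_on UNIV g"
    unfolding g_def s'_def using r
    by (intro continuous_intros continuous_on_compose2[OF continuous_on_cutoff1' cs]
        continuous_on_compose2[OF DERIV_continuous_on[OF has_field_derivative_at_within[OF DERIV_cutoff1]] cs]) auto
  have \<eta>01: "0 \<le> \<eta> x" "\<eta> x \<le> 1" for x
    unfolding \<eta>_def by (auto intro!: prod_nonneg prod_le_1 simp: cutoff1_simps)
  have g_bound: "norm (g x) \<le> real (CARD('n)) * (6 / r)" for x
  proof (rule norm_le_card_times)
    fix k
    show "\<bar>g x $ k\<bar> \<le> 6 / r"
    proof (cases "\<bar>x $ k - p $ k\<bar> > 2 * r")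
      case True
      then show ?thesis using s_ge[of x k] r by (simp add: g_def cutoff1_simps)
    next
      case False
      \<comment> \<open>Together with the bound 4 on \<open>cutoff1'\<close> this yields 16 / (3 r),
        which is below 6 / r. Beyond distance 2 r the factor \<open>cutoff1'\<close> is 0.\<close>
      have "\<bar>s' x k\<bar> \<le> 4 / (3 * r)"
        using False r by (simp add: s'_def c_def abs_mult field_simps power2_eq_square)
      moreover have "\<bar>\<Prod>i\<in>UNIV - {k}. cutoff1 (s x i)\<bar> \<le> 1"
        unfolding abs_prod by (intro prod_le_1) (auto simp: cutoff1_simps)
      ultimately have "\<bar>cutoff1' (s x k) * s' x k * (\<Prod>i\<in>UNIV - {k}. cutoff1 (s x i))\<bar> \<le> 4 * (4 / (3 * r)) * 1"
        unfolding abs_mult using r by (intro mult_mono) (auto simp: cutoff1_simps)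
      also have "\<dots> \<le> 6 / r" using r by (simp add: field_simps)
      finally show ?thesis by (simp add: g_def)
    qed
  qed
  show ?thesis
  proof (rule that[OF d\<eta> cg \<eta>01 _ _ _ g_bound])
    fix x assume x: "x \<in> cube p r"
    then have "s x i \<le> 0" for i using s_le by (simp add: cube_def)
    then show "\<eta> x = 1" "g x = 0"
      by (simp_all add: \<eta>_def g_def cutoff1_simps vec_eq_iff)
  next
    fix x assume "x \<notin> cube p (2 * r)"
    then obtain i where "\<bar>x $ i - p $ i\<bar> > 2 * r" by (auto simp: cube_def not_le)
    then have "cutoff1 (s x i) = 0" using s_ge cutoff1_simps by blast
    then show "\<eta> x = 0" unfolding \<eta>_def by (intro prod_zero) auto
  qed
qed

text \<open>The rank-one matrix w g^T is the part of the derivative of \<eta> (u - c) that comes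
  from the gradient of \<eta>.\<close>

lemma norm_outer: "norm (\<chi> j. (w :: real ^ 'm) $ j *\<^sub>R (g :: real ^ 'n)) = norm w * norm g"
  by (simp add: norm_vec_def[of "\<chi> j. _ j"] L2_set_left_distrib[symmetric] norm_vec_def[of w])

text \<open>The constant \<open>c\<close> is left free: \<open>hole_filling_C1\<close> puts c = u z
  and averages over z in the annulus. The integral on the left may be negative;
  \<open>ennreal\<close> then makes it 0.\<close>

lemma integral_det_cube_le:
  fixes u :: "real ^ 'n \<Rightarrow> real ^ 'n"
  assumes C1: "C1_map u Du" and r: "r > 0" and n: "n = CARD('n)"
  shows "ennreal (integral (cube p r) (\<lambda>x. det (Du x))) \<le> ennreal (fact n * n) *
    (\<integral>\<^sup>+x\<in>cube p (2 * r) - cube p r. ennreal ((norm (Du x) + n * (6 / r) * norm (u x - c)) ^ n) \<partial>lborel)"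
proof -
  obtain \<eta> g where \<eta>: "\<And>x. (\<eta> has_derivative (\<lambda>h. g x \<bullet> h)) (at x)" "continuous_on UNIV g"
    "\<And>x. 0 \<le> \<eta> x" "\<And>x. \<eta> x \<le> 1" "\<And>x. x \<in> cube p r \<Longrightarrow> \<eta> x = 1" "\<And>x. x \<in> cube p r \<Longrightarrow> g x = 0"
    "\<And>x. x \<notin> cube p (2 * r) \<Longrightarrow> \<eta> x = 0" "\<And>x. norm (g x) \<le> n * (6 / r)"
    unfolding n by (rule cube_cutoff[OF r, of p]) blast
  define A where "A = cube p (2 * r) - cube p r"
  define v where "v x = \<eta> x *\<^sub>R (u x - c)" for x
  define Dv where "Dv x = \<eta> x *\<^sub>R Du x + (\<chi> j. (u x - c) $ j *\<^sub>R g x)" for x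
  have c\<eta>: "continuous_on UNIV \<eta>"
    using \<eta>(1) by (intro has_derivative_continuous_on) (auto intro: has_derivative_at_withinI)
  have mv: "Dv x *v h = \<eta> x *\<^sub>R (Du x *v h) + (g x \<bullet> h) *\<^sub>R (u x - c)" for x h
    by (simp add: Dv_def matrix_vector_mult_add_rdistrib scaleR_matrix_vector_assoc vec_eq_iff
        matrix_vector_mul_component inner_commute)
  have dv: "(v has_derivative (\<lambda>h. Dv x *v h)) (at x)" for x
    unfolding mv unfolding v_def
    by (rule has_derivative_eq_rhs[OF has_derivative_scaleR[OF \<eta>(1) has_derivative_diff[OF C1_mapD(1)[OF C1] has_derivative_const]]])
      (auto simp: add.commute)
  have cDv: "continuous_on UNIV Dv"
    unfolding Dv_def by (intro continuous_intros c\<eta> \<eta>(2) C1_mapD[OF C1])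
  have v0: "v x = 0" if "x \<notin> cbox (p - vec (2 * r)) (p + vec (2 * r))" for x
    using \<eta>(7) that by (simp add: v_def cube_eq_cbox)
  have zero: "integral (cube p (2 * r)) (\<lambda>x. det (Dv x)) = 0"
    unfolding cube_eq_cbox by (rule integral_det_eq_0[OF dv cDv v0])
  have int: "(\<lambda>x. det (Dv x)) integrable_on cube p s" "(\<lambda>x. \<bar>det (Dv x)\<bar>) integrable_on cube p s" for s
    unfolding cube_eq_cbox by (intro integrable_continuous continuous_intros continuous_on_subset[OF cDv]; simp)+
  have sub: "cube p r - cube p (2 * r) = {}" using cube_mono[of r "2 * r" p] r by auto
  have intA: "(\<lambda>x. det (Dv x)) integrable_on A" "(\<lambda>x. \<bar>det (Dv x)\<bar>) integrable_on A"
    unfolding A_def by (rule integrable_setdiff[OF integrable_integral[OF int(1)] integrable_integral[OF int(1)]]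
        integrable_setdiff[OF integrable_integral[OF int(2)] integrable_integral[OF int(2)]], simp add: sub)+
  have "integral A (\<lambda>x. det (Dv x)) = integral (cube p (2 * r)) (\<lambda>x. det (Dv x)) - integral (cube p r) (\<lambda>x. det (Dv x))"
    unfolding A_def by (intro integral_setdiff int) (simp add: sub)
  also have "integral (cube p r) (\<lambda>x. det (Dv x)) = integral (cube p r) (\<lambda>x. det (Du x))"
    by (rule Henstock_Kurzweil_Integration.integral_cong) (simp add: Dv_def \<eta> vec_eq_iff flip: zero_vec_def)
  finally have "integral (cube p r) (\<lambda>x. det (Du x)) = - integral A (\<lambda>x. det (Dv x))"
    using zero by simp
  also have "\<dots> \<le> integral A (\<lambda>x. \<bar>det (Dv x)\<bar>)"
    using integral_norm_bound_integral[OF intA(1,2)] by simp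
  finally have "ennreal (integral (cube p r) (\<lambda>x. det (Du x))) \<le> ennreal (integral A (\<lambda>x. \<bar>det (Dv x)\<bar>))"
    by (rule ennreal_leI)
  also have "\<dots> = (\<integral>\<^sup>+x\<in>A. ennreal \<bar>det (Dv x)\<bar> \<partial>lborel)"
    by (rule nn_integral_has_integral_lebesgue'[symmetric]) (auto intro: integrable_integral intA)
  also have "\<dots> \<le> (\<integral>\<^sup>+x. ennreal (fact n * n) * (ennreal ((norm (Du x) + n * (6 / r) * norm (u x - c)) ^ n) * indicator A x) \<partial>lborel)"
  proof (rule nn_integral_mono)
    fix x
    have "norm (Dv x) \<le> norm (\<eta> x *\<^sub>R Du x) + norm (\<chi> j. (u x - c) $ j *\<^sub>R g x)"
      unfolding Dv_def by (rule norm_triangle_ineq)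
    also have "norm (\<chi> j. (u x - c) $ j *\<^sub>R g x) = norm (u x - c) * norm (g x)" by (rule norm_outer)
    also have "norm (\<eta> x *\<^sub>R Du x) \<le> 1 * norm (Du x)"
      using \<eta>(3,4) by (simp add: mult_left_le_one_le)
    also have "norm (u x - c) * norm (g x) \<le> norm (u x - c) * (n * (6 / r))"
      by (intro mult_left_mono \<eta>) auto
    finally have "norm (Dv x) ^ n \<le> (norm (Du x) + n * (6 / r) * norm (u x - c)) ^ n"
      by (intro power_mono) (auto simp: mult_ac)
    then have "fact n * n * norm (Dv x) ^ n \<le> fact n * n * (norm (Du x) + n * (6 / r) * norm (u x - c)) ^ n"
      by (intro mult_left_mono) auto
    with abs_det_le[of "Dv x"] have "\<bar>det (Dv x)\<bar> \<le> fact n * n * (norm (Du x) + n * (6 / r) * norm (u x - c)) ^ n"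
      unfolding n by linarith
    then have "ennreal \<bar>det (Dv x)\<bar> \<le> ennreal (fact n * n) * ennreal ((norm (Du x) + n * (6 / r) * norm (u x - c)) ^ n)"
      using r by (subst ennreal_mult[symmetric]) (auto intro!: ennreal_leI)
    then show "ennreal \<bar>det (Dv x)\<bar> * indicator A x \<le>
      ennreal (fact n * n) * (ennreal ((norm (Du x) + n * (6 / r) * norm (u x - c)) ^ n) * indicator A x)"
      by (auto simp: indicator_def)
  qed
  also have "\<dots> = ennreal (fact n * n) *
    (\<integral>\<^sup>+x\<in>A. ennreal ((norm (Du x) + n * (6 / r) * norm (u x - c)) ^ n) \<partial>lborel)"
    using C1_mapD(4,5)[OF C1] by (intro nn_integral_cmult) (auto simp: A_def)
  finally show ?thesis by (simp add: A_def)
qed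


section \<open>Oscillation on the annulus\<close>

lemma double_osc_mono: "S \<subseteq> S' \<Longrightarrow> T \<subseteq> T' \<Longrightarrow> double_osc n u S T \<le> double_osc n u S' T'"
  unfolding double_osc_def by (intro nn_integral_mono mult_mono) (auto simp: indicator_def)

text \<open>A point y is inserted between x and z, and the resulting inequality is integrated over y
  in \<open>M\<close> as well.\<close>

lemma double_osc_chain:
  fixes u :: "'a::euclidean_space \<Rightarrow> 'b::euclidean_space"
  assumes [measurable]: "S \<in> sets borel" "T \<in> sets borel" "M \<in> sets borel" "u \<in> borel_measurable borel"
  shows "emeasure lborel M * double_osc n u S T \<le>
    2 ^ n * (emeasure lborel T * double_osc n u S M + emeasure lborel S * double_osc n u M T)"
proof -
  define f where "f x y = ennreal (norm (u x - u y) ^ n)" for x y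
  have [measurable]: "(\<lambda>(x, y). f x y) \<in> borel_measurable (borel \<Otimes>\<^sub>M borel)"
    unfolding f_def by measurable
  define i where "i A x = (indicator A x :: ennreal)" for A and x :: 'a
  have [measurable]: "i S \<in> borel_measurable borel" "i T \<in> borel_measurable borel" "i M \<in> borel_measurable borel"
    unfolding i_def by measurable
  have int_i: "(\<integral>\<^sup>+x. i A x \<partial>lborel) = emeasure lborel A" if "A \<in> sets borel" for A
    unfolding i_def using that by simp
  have D: "double_osc n u A B = (\<integral>\<^sup>+x. \<integral>\<^sup>+z. i A x * (i B z * f x z) \<partial>lborel \<partial>lborel)"
    if [measurable]: "A \<in> sets borel" "B \<in> sets borel" for A B
  proof -
    have [measurable]: "i A \<in> borel_measurable borel" "i B \<in> borel_measurable borel"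
      unfolding i_def by measurable
    show ?thesis
      unfolding double_osc_def by (simp add: nn_integral_cmult i_def f_def mult.commute)
  qed
  have ptw: "f x z \<le> 2 ^ n * (f x y + f y z)" for x y z
  proof -
    have "norm (u x - u z) ^ n \<le> (norm (u x - u y) + norm (u y - u z)) ^ n"
      using norm_triangle_ineq[of "u x - u y" "u y - u z"] by (intro power_mono) auto
    also have "\<dots> \<le> 2 ^ n * (norm (u x - u y) ^ n + norm (u y - u z) ^ n)"
      by (rule power_add_le) auto
    finally have "f x z \<le> ennreal (2 ^ n * (norm (u x - u y) ^ n + norm (u y - u z) ^ n))"
      unfolding f_def by (rule ennreal_leI)
    then show ?thesis by (simp add: f_def ennreal_mult ennreal_power[symmetric])
  qed
  have "emeasure lborel M * double_osc n u S T =
    (\<integral>\<^sup>+x. \<integral>\<^sup>+z. i S x * (i T z * f x z) * emeasure lborel M \<partial>lborel \<partial>lborel)"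
    by (subst nn_integral_multc, measurable)+ (simp add: D mult.commute)
  also have "\<dots> = (\<integral>\<^sup>+x. \<integral>\<^sup>+z. \<integral>\<^sup>+y. i S x * (i T z * f x z) * i M y \<partial>lborel \<partial>lborel \<partial>lborel)"
    by (simp add: nn_integral_cmult int_i)
  also have "\<dots> \<le> (\<integral>\<^sup>+x. \<integral>\<^sup>+z. \<integral>\<^sup>+y. 2 ^ n * (i T z * (i S x * (i M y * f x y))) +
      2 ^ n * (i S x * (i M y * (i T z * f y z))) \<partial>lborel \<partial>lborel \<partial>lborel)"
    using ptw by (intro nn_integral_mono) (auto simp: i_def indicator_def distrib_left)
  also have "\<dots> = (\<integral>\<^sup>+x. \<integral>\<^sup>+z. \<integral>\<^sup>+y. 2 ^ n * (i T z * (i S x * (i M y * f x y))) \<partial>lborel \<partial>lborel \<partial>lborel)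
     + (\<integral>\<^sup>+x. \<integral>\<^sup>+z. \<integral>\<^sup>+y. 2 ^ n * (i S x * (i M y * (i T z * f y z))) \<partial>lborel \<partial>lborel \<partial>lborel)"
    by (simp add: nn_integral_add)
  also have "(\<integral>\<^sup>+x. \<integral>\<^sup>+z. \<integral>\<^sup>+y. 2 ^ n * (i T z * (i S x * (i M y * f x y))) \<partial>lborel \<partial>lborel \<partial>lborel)
    = 2 ^ n * (emeasure lborel T * double_osc n u S M)"
    by (simp add: D nn_integral_cmult nn_integral_multc int_i)
  also have "(\<integral>\<^sup>+x. \<integral>\<^sup>+z. \<integral>\<^sup>+y. 2 ^ n * (i S x * (i M y * (i T z * f y z))) \<partial>lborel \<partial>lborel \<partial>lborel)
    = (\<integral>\<^sup>+x. \<integral>\<^sup>+y. \<integral>\<^sup>+z. 2 ^ n * (i S x * (i M y * (i T z * f y z))) \<partial>lborel \<partial>lborel \<partial>lborel)"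
    by (intro nn_integral_cong lborel_pair.Fubini') measurable
  also have "\<dots> = 2 ^ n * (emeasure lborel S * double_osc n u M T)"
    by (simp add: D nn_integral_cmult nn_integral_multc int_i)
  finally show ?thesis by (simp add: distrib_left)
qed

text \<open>The price of a link \<open>M\<close> is the ratio of the measures of \<open>S\<close>
  and \<open>T\<close> to that of \<open>M\<close>, so links must be of comparable size.\<close>

lemma double_osc_chain_le:
  fixes u :: "'a::euclidean_space \<Rightarrow> 'b::euclidean_space"
  assumes meas: "S \<in> sets borel" "T \<in> sets borel" "M \<in> sets borel" "u \<in> borel_measurable borel"
    and a: "emeasure lborel S \<le> ennreal a" "emeasure lborel T \<le> ennreal a" "a \<ge> 0"
    and b: "emeasure lborel M \<ge> ennreal b" "b > 0"
    and B: "double_osc n u S M \<le> B" "double_osc n u M T \<le> B"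
  shows "double_osc n u S T \<le> ennreal (2 ^ (n + 1) * a / b) * B"
proof -
  have "ennreal b * double_osc n u S T \<le> emeasure lborel M * double_osc n u S T"
    using b by (intro mult_right_mono) auto
  also have "\<dots> \<le> 2 ^ n * (emeasure lborel T * double_osc n u S M + emeasure lborel S * double_osc n u M T)"
    by (rule double_osc_chain[OF meas])
  also have "\<dots> \<le> 2 ^ n * (ennreal a * B + ennreal a * B)"
    using a B by (intro mult_left_mono add_mono mult_mono) auto
  also have "\<dots> = ennreal (2 ^ (n + 1) * a) * B"
    using a by (simp add: ennreal_mult ennreal_power[symmetric] distrib_right[symmetric] mult_ac flip: mult_2)
  finally have "ennreal (1 / b) * (ennreal b * double_osc n u S T) \<le> ennreal (1 / b) * (ennreal (2 ^ (n + 1) * a) * B)"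
    by (intro mult_left_mono) auto
  then show ?thesis
    using a b by (simp add: mult.assoc[symmetric] ennreal_mult[symmetric])
qed

text \<open>
  The slabs are convex and cover the annulus. Two of them overlap in a large set unless they are
  opposite; opposite ones are compared through a third, which is where dimension at least \<open>2\<close> enters.
\<close>

definition slab :: "real ^ 'n::finite \<Rightarrow> real \<Rightarrow> 'n \<times> real \<Rightarrow> (real ^ 'n) set" where
  "slab p r k = {x \<in> cube p (2 * r). r < snd k * (x $ fst k - p $ fst k)}"

lemma slab_borel [measurable, simp]: "slab p r k \<in> sets borel"
  unfolding slab_def by measurable

lemma slab_subset: "slab p r k \<subseteq> cube p (2 * r)"
  by (auto simp: slab_def)

lemma convex_slab: "convex (slab p r k)"
proof -
  have "slab p r k = cube p (2 * r) \<inter> {x. x \<bullet> axis (fst k) (snd k) > r + snd k * p $ fst k}"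
    by (auto simp: slab_def inner_axis algebra_simps)
  moreover have "convex {x. x \<bullet> axis (fst k) (snd k) > r + snd k * p $ fst k}"
    using convex_halfspace_gt[of "r + snd k * p $ fst k" "axis (fst k) (snd k)"] by (simp add: inner_commute)
  ultimately show ?thesis by (simp add: convex_Int)
qed

lemma annulus_eq_slabs:
  "cube p (2 * r) - cube p r = (\<Union>k\<in>UNIV \<times> {1, -1}. slab p r k)"
proof (intro set_eqI iffI)
  fix x assume x: "x \<in> cube p (2 * r) - cube p r"
  then obtain i where i: "\<bar>x $ i - p $ i\<bar> > r" by (auto simp: cube_def not_le)
  then have "x \<in> slab p r (i, 1) \<or> x \<in> slab p r (i, -1)"
    using x by (auto simp: slab_def abs_if split: if_splits)
  then show "x \<in> (\<Union>k\<in>UNIV \<times> {1, -1}. slab p r k)" by auto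
next
  fix x assume "x \<in> (\<Union>k\<in>UNIV \<times> {1, -1}. slab p r k)"
  then obtain k where k: "k \<in> UNIV \<times> {1, -1}" "x \<in> slab p r k" by blast
  then have "\<bar>x $ fst k - p $ fst k\<bar> > r" by (auto simp: slab_def)
  then have "x \<notin> cube p r" by (auto simp: cube_def not_le)
  with k slab_subset show "x \<in> cube p (2 * r) - cube p r" by blast
qed

lemma slab_inter_large:
  fixes p :: "real ^ 'n"
  assumes "i \<noteq> j" "s \<in> {1, -1}" "t \<in> {1, -1}" "r > 0"
  shows "emeasure lborel (slab p r (i, s) \<inter> slab p r (j, t)) \<ge> ennreal ((r / 2) ^ CARD('n))"
proof -
  \<comment> \<open>Coordinates i and j lie 3/2 r away from the centre, midway between r and 2 r, so
    a cube of radius r / 4 about \<open>q\<close> fits into both slabs; its measure is (r /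
    2)^n.\<close>
  define q where "q = p + axis i (3 / 2 * r * s) + axis j (3 / 2 * r * t)"
  have "cube q (r / 4) \<subseteq> slab p r (i, s) \<inter> slab p r (j, t)"
  proof
    fix x assume "x \<in> cube q (r / 4)"
    then have x: "x $ k - q $ k \<le> r / 4" "q $ k - x $ k \<le> r / 4" for k
      unfolding cube_def abs_le_iff by auto
    have q: "q $ i = p $ i + 3 / 2 * r * s" "q $ j = p $ j + 3 / 2 * r * t"
      "k \<noteq> i \<Longrightarrow> k \<noteq> j \<Longrightarrow> q $ k = p $ k" for k
      using assms(1) by (auto simp: q_def axis_def)
    have "\<bar>x $ k - p $ k\<bar> \<le> 2 * r" for k
    proof -
      consider "k = i" | "k = j" | "k \<noteq> i" "k \<noteq> j" by blast
      then have "x $ k - p $ k \<le> 2 * r \<and> p $ k - x $ k \<le> 2 * r"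
        using x[of k] q assms by cases auto
      then show ?thesis unfolding abs_le_iff by linarith
    qed
    moreover have "r < s * (x $ i - p $ i)" "r < t * (x $ j - p $ j)"
      using x[of i] x[of j] q(1,2) assms by auto
    ultimately show "x \<in> slab p r (i, s) \<inter> slab p r (j, t)"
      by (auto simp: slab_def cube_def)
  qed
  then have "emeasure lborel (cube q (r / 4)) \<le> emeasure lborel (slab p r (i, s) \<inter> slab p r (j, t))"
    by (intro emeasure_mono) auto
  then show ?thesis using assms(4) by (simp add: emeasure_cube)
qed

lemma emeasure_slab_le:
  assumes "r > 0"
  shows "emeasure lborel (slab (p :: real ^ 'n) r k) \<le> ennreal ((4 * r) ^ CARD('n))"
proof -
  have "emeasure lborel (slab p r k) \<le> emeasure lborel (cube p (2 * r))"
    by (intro emeasure_mono slab_subset) auto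
  then show ?thesis using assms by (simp add: emeasure_cube)
qed

text \<open>The indicator of a union is at most the sum of the indicators, which leaves one term for
  each ordered pair of pieces.\<close>

lemma double_osc_Union_le:
  fixes u :: "'a::euclidean_space \<Rightarrow> 'b::euclidean_space"
  assumes I: "finite I" and [measurable]: "\<And>k. k \<in> I \<Longrightarrow> P k \<in> sets borel" "u \<in> borel_measurable borel"
    and B: "\<And>k l. k \<in> I \<Longrightarrow> l \<in> I \<Longrightarrow> double_osc n u (P k) (P l) \<le> B"
  shows "double_osc n u (\<Union>k\<in>I. P k) (\<Union>k\<in>I. P k) \<le> of_nat (card I) * (of_nat (card I) * B)"
proof -
  have ind: "indicator (\<Union>k\<in>I. P k) x \<le> (\<Sum>k\<in>I. indicator (P k) x :: ennreal)" for x
  proof (cases "x \<in> (\<Union>k\<in>I. P k)")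
    case True
    then obtain k where k: "k \<in> I" "x \<in> P k" by auto
    have "(1::ennreal) = indicator (P k) x" using k by simp
    also have "\<dots> \<le> (\<Sum>k\<in>I. indicator (P k) x)" using k I by (intro member_le_sum) auto
    finally show ?thesis using True by simp
  qed simp
  have "double_osc n u (\<Union>k\<in>I. P k) (\<Union>k\<in>I. P k) \<le>
    (\<integral>\<^sup>+x. (\<integral>\<^sup>+z. ennreal (norm (u x - u z) ^ n) * (\<Sum>l\<in>I. indicator (P l) z) \<partial>lborel) * (\<Sum>k\<in>I. indicator (P k) x) \<partial>lborel)"
    unfolding double_osc_def by (intro nn_integral_mono mult_mono ind mult_left_mono) auto
  also have "\<dots> = (\<Sum>k\<in>I. \<Sum>l\<in>I. double_osc n u (P k) (P l))"
    unfolding double_osc_def sum_distrib_left sum_distrib_right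
    by (simp add: nn_integral_sum nn_integral_sum sum_distrib_right cong: sum.cong)
  also have "\<dots> \<le> (\<Sum>k\<in>I. \<Sum>l\<in>I. B)" by (intro sum_mono B)
  finally show ?thesis by simp
qed

lemma ex_neq_if_card_ge_2:
  fixes i :: "'n::finite"
  assumes "CARD('n) \<ge> 2"
  shows "\<exists>j. j \<noteq> i"
proof (rule ccontr)
  assume "\<not> (\<exists>j. j \<noteq> i)"
  then have "(UNIV :: 'n set) = {i}" by auto
  then have "CARD('n) = card {i}" by simp
  then show False using assms by simp
qed

text \<open>The factors of the constant: (2 n)^2 ordered pairs of slabs; two links, each costing
  2^(n+1) 8^n; (8 n r)^n from twice the diameter bound 4 n r; (4 r)^n for the measure of a
  slab.\<close>

theorem double_osc_annulus_le:
  fixes u :: "real ^ 'n \<Rightarrow> real ^ 'n" and p :: "real ^ 'n"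
  assumes C1: "C1_map u Du" and r: "r > 0" and n: "n = CARD('n)" and n2: "n \<ge> 2"
  defines "A \<equiv> cube p (2 * r) - cube p r"
  shows "double_osc n u A A \<le> ennreal ((2 * real n)\<^sup>2 * (2 ^ (n + 1) * 8 ^ n)\<^sup>2 * (8 * real n * r) ^ n * (4 * r) ^ n) *
    (\<integral>\<^sup>+x\<in>A. ennreal (norm (Du x) ^ n) \<partial>lborel)"
proof -
  define D where "D = (\<integral>\<^sup>+x\<in>A. ennreal (norm (Du x) ^ n) \<partial>lborel)"
  \<comment> \<open>The cost of a link in \<open>double_osc_chain_le\<close> with a = (4 r)^n and b
    = (r / 2)^n; r cancels.\<close>
  define \<kappa> :: real where "\<kappa> = 2 ^ (n + 1) * (4 * r) ^ n / (r / 2) ^ n"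
  have \<kappa>_eq: "\<kappa> = 2 ^ (n + 1) * 8 ^ n"
    using r by (simp add: \<kappa>_def power_mult_distrib power_divide flip: power_mult_distrib[of 4 2])
  have \<kappa>1: "\<kappa> \<ge> 1" unfolding \<kappa>_eq by (simp add: mult_ge1_I del: power_Suc)
  define B where "B = ennreal ((8 * real n * r) ^ n) * (ennreal ((4 * r) ^ n) * D)"
  have mu: "u \<in> borel_measurable borel" using C1 by (rule C1_mapD)
  have slab_A: "slab p r (i, s) \<subseteq> A" if "s \<in> {1, -1}" for i s
    unfolding A_def annulus_eq_slabs using that by blast
  have same: "double_osc n u (slab p r (i, s)) (slab p r (i, s)) \<le> B" if s: "s \<in> {1, -1}" for i s
  proof -
    have diam: "norm (x - z) \<le> 4 * real n * r" if "x \<in> slab p r (i, s)" "z \<in> slab p r (i, s)" for x z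
    proof -
      have "\<bar>(x - z) $ k\<bar> \<le> 4 * r" for k
        using that slab_subset[of p r "(i, s)"] by (auto simp: cube_def abs_le_iff subset_iff) (smt (verit))+
      from norm_le_card_times[of "x - z", OF this] show ?thesis by (simp add: n mult_ac)
    qed
    have "double_osc n u (slab p r (i, s)) (slab p r (i, s)) \<le> ennreal ((2 * (4 * real n * r)) ^ n) *
      (emeasure lborel (slab p r (i, s)) * (\<integral>\<^sup>+x\<in>slab p r (i, s). ennreal (norm (Du x) ^ n) \<partial>lborel))"
      by (rule double_osc_le_convex[OF C1 slab_borel convex_slab diam n])
    also have "\<dots> \<le> ennreal ((2 * (4 * real n * r)) ^ n) * (ennreal ((4 * r) ^ n) * D)"
      unfolding D_def
    proof (intro mult_left_mono mult_mono nn_integral_mono)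
      show "emeasure lborel (slab p r (i, s)) \<le> ennreal ((4 * r) ^ n)"
        unfolding n by (rule emeasure_slab_le[OF r])
      show "indicator (slab p r (i, s)) x \<le> (indicator A x :: ennreal)" for x
        using slab_A[OF s] by (auto simp: indicator_def)
    qed auto
    finally show ?thesis by (simp add: B_def mult_ac)
  qed
  \<comment> \<open>The link is the intersection. It is contained in both slabs, so the convex case
    controls both of its sides.\<close>
  have two: "double_osc n u (slab p r (i, s)) (slab p r (j, t)) \<le> ennreal \<kappa> * B"
    if "i \<noteq> j" "s \<in> {1, -1}" "t \<in> {1, -1}" for i j s t
    unfolding \<kappa>_def
  proof (rule double_osc_chain_le[where M = "slab p r (i, s) \<inter> slab p r (j, t)"])
    show "double_osc n u (slab p r (i, s)) (slab p r (i, s) \<inter> slab p r (j, t)) \<le> B"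
      using double_osc_mono[of _ "slab p r (i, s)" _ "slab p r (i, s)"] same[of s i] that
      by (meson Int_lower1 order_refl order_trans)
    show "double_osc n u (slab p r (i, s) \<inter> slab p r (j, t)) (slab p r (j, t)) \<le> B"
      using double_osc_mono[of _ "slab p r (j, t)" _ "slab p r (j, t)"] same[of t j] that
      by (meson Int_lower2 order_refl order_trans)
    show "ennreal ((r / 2) ^ n) \<le> emeasure lborel (slab p r (i, s) \<inter> slab p r (j, t))"
      unfolding n using that r by (intro slab_inter_large)
  qed (use r emeasure_slab_le[OF r, of p] mu in \<open>auto simp: n\<close>)
  \<comment> \<open>Since \<kappa> \<ge> 1, the bound for pairs that need two links serves for all
    pairs.\<close>
  have "B \<le> ennreal \<kappa> * B" "ennreal \<kappa> * B \<le> ennreal \<kappa> * (ennreal \<kappa> * B)"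
    using mult_right_mono[of 1 "ennreal \<kappa>"] \<kappa>1 by (auto simp: ennreal_ge_1)
  then have \<kappa>B: "B \<le> ennreal \<kappa> * (ennreal \<kappa> * B)" "ennreal \<kappa> * B \<le> ennreal \<kappa> * (ennreal \<kappa> * B)"
    by (auto intro: order_trans)
  have pair: "double_osc n u (slab p r k) (slab p r l) \<le> ennreal \<kappa> * (ennreal \<kappa> * B)"
    if kl: "k \<in> UNIV \<times> {1, -1}" "l \<in> UNIV \<times> {1, -1}" for k l
  proof -
    obtain i s j t where k: "k = (i, s)" "s \<in> {1, -1}" and l: "l = (j, t)" "t \<in> {1, -1}"
      using kl by (metis mem_Times_iff prod.collapse)
    show ?thesis
    proof (cases "i = j")
      case False
      then show ?thesis using two[OF False k(2) l(2)] \<kappa>B k l by (auto intro: order_trans)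
    next
      case True
      \<comment> \<open>Equal or opposite slabs are linked through a slab in another direction,
        which meets both in a large set.\<close>
      obtain m where m: "m \<noteq> i"
        using ex_neq_if_card_ge_2[of i] n n2 by blast
      have "double_osc n u (slab p r (i, s)) (slab p r (j, t)) \<le>
        ennreal (2 ^ (n + 1) * (4 * r) ^ n / (r / 2) ^ n) * (ennreal \<kappa> * B)"
      proof (rule double_osc_chain_le[where M = "slab p r (m, 1)"])
        show "double_osc n u (slab p r (i, s)) (slab p r (m, 1)) \<le> ennreal \<kappa> * B"
          using two[of i m s 1] m k by auto
        show "double_osc n u (slab p r (m, 1)) (slab p r (j, t)) \<le> ennreal \<kappa> * B"
          using two[of m j 1 t] m l True by auto
        have "ennreal ((r / 2) ^ n) \<le> emeasure lborel (slab p r (m, 1) \<inter> slab p r (i, 1))"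
          unfolding n using m r by (intro slab_inter_large) auto
        also have "\<dots> \<le> emeasure lborel (slab p r (m, 1))" by (intro emeasure_mono) auto
        finally show "ennreal ((r / 2) ^ n) \<le> emeasure lborel (slab p r (m, 1))" .
      qed (use r emeasure_slab_le[OF r, of p] mu in \<open>auto simp: n\<close>)
      then show ?thesis by (simp only: k l \<kappa>_def)
    qed
  qed
  have "double_osc n u A A \<le> of_nat (card (UNIV \<times> {1, -1 :: real} :: ('n \<times> real) set)) *
     (of_nat (card (UNIV \<times> {1, -1 :: real} :: ('n \<times> real) set)) * (ennreal \<kappa> * (ennreal \<kappa> * B)))"
    unfolding A_def annulus_eq_slabs by (rule double_osc_Union_le) (use pair mu in auto)
  also have "card (UNIV \<times> {1, -1 :: real} :: ('n \<times> real) set) = 2 * n"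
    by (simp add: card_cartesian_product n)
  also have "of_nat (2 * n) * (of_nat (2 * n) * (ennreal \<kappa> * (ennreal \<kappa> * B))) =
    ennreal ((2 * real n)\<^sup>2 * \<kappa>\<^sup>2 * (8 * real n * r) ^ n * (4 * r) ^ n) * D"
    using r \<kappa>1 unfolding B_def
    by (simp add: ennreal_of_nat_eq_real_of_nat ennreal_mult[symmetric] mult.assoc[symmetric] power2_eq_square)
  finally show ?thesis by (simp add: \<kappa>_eq D_def)
qed

text \<open>With c = u z, averaging over z in the annulus bounds the term without derivatives by the
  double integral, hence by the energy on the annulus. It also multiplies the left side by the
  measure of the annulus, which therefore has to be bounded from below.\<close>

theorem hole_filling_C1:
  assumes n: "n = CARD('n)" and n2: "n \<ge> 2"
  shows "\<exists>C>0. \<forall>(u :: real ^ 'n \<Rightarrow> real ^ 'n) Du p r. C1_map u Du \<and> r > 0 \<longrightarrow>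
    ennreal (integral (cube p r) (\<lambda>x. det (Du x))) \<le>
      ennreal C * (\<integral>\<^sup>+x\<in>cube p (2 * r) - cube p r. ennreal (norm (Du x) ^ n) \<partial>lborel)"
proof -
  define K where "K = fact n * real n"
  define c where "c = (2 * real n)\<^sup>2 * (2 ^ (n + 1) * 8 ^ n)\<^sup>2"
  \<comment> \<open>48 n^2 is the product of b = 6 n / r and 8 n r; 8^n is the quotient of (4 r)^n,
    which bounds the measure of the annulus from above, and (r / 2)^n, which bounds it from
    below.\<close>
  define C where "C = K * 2 ^ n * (1 + (48 * real n * real n) ^ n * c) * 8 ^ n"
  have n0: "real n > 0" using n2 by simp
  have K: "K > 0" and c: "c > 0" using n0 by (auto simp: K_def c_def)
  then have "C > 0" using n0 unfolding C_def by (intro mult_pos_pos add_pos_pos) auto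
  moreover have "ennreal (integral (cube p r) (\<lambda>x. det (Du x))) \<le>
      ennreal C * (\<integral>\<^sup>+x\<in>cube p (2 * r) - cube p r. ennreal (norm (Du x) ^ n) \<partial>lborel)"
    if C1: "C1_map u Du" and r: "r > 0" for u :: "real ^ 'n \<Rightarrow> real ^ 'n" and Du p r
  proof -
    note [measurable] = C1_mapD(4,5)[OF C1]
    define A where "A = cube p (2 * r) - cube p r"
    have [measurable]: "A \<in> sets borel" by (simp add: A_def)
    define X where "X = ennreal (integral (cube p r) (\<lambda>x. det (Du x)))"
    define D where "D = (\<integral>\<^sup>+x\<in>A. ennreal (norm (Du x) ^ n) \<partial>lborel)"
    define b where "b = 6 * real n / r"
    have b: "b > 0" using n0 r by (simp add: b_def)
    have Xz: "X \<le> ennreal (K * 2 ^ n) * (D + ennreal (b ^ n) * (\<integral>\<^sup>+x\<in>A. ennreal (norm (u z - u x) ^ n) \<partial>lborel))" for z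
    proof -
      have "X \<le> ennreal K * (\<integral>\<^sup>+x\<in>A. ennreal ((norm (Du x) + n * (6 / r) * norm (u x - u z)) ^ n) \<partial>lborel)"
        unfolding X_def A_def K_def by (rule integral_det_cube_le[OF C1 r n])
      also have "\<dots> \<le> ennreal K * (ennreal (2 ^ n) * ((\<integral>\<^sup>+x\<in>A. ennreal (norm (Du x) ^ n) \<partial>lborel) +
          (\<integral>\<^sup>+x\<in>A. ennreal ((b * norm (u z - u x)) ^ n) \<partial>lborel)))"
        by (intro mult_left_mono nn_integral_power_add_le) (use b r in \<open>auto simp: b_def norm_minus_commute mult_ac\<close>)
      also have "(\<integral>\<^sup>+x\<in>A. ennreal ((b * norm (u z - u x)) ^ n) \<partial>lborel) = ennreal (b ^ n) * (\<integral>\<^sup>+x\<in>A. ennreal (norm (u z - u x) ^ n) \<partial>lborel)"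
        using b by (simp add: power_mult_distrib ennreal_mult mult.assoc nn_integral_cmult)
      finally show ?thesis
        using K by (simp add: D_def ennreal_mult mult.assoc)
    qed
    have "X * emeasure lborel A = (\<integral>\<^sup>+z. X * indicator A z \<partial>lborel)"
      by (simp add: nn_integral_cmult)
    also have "\<dots> \<le> (\<integral>\<^sup>+z. ennreal (K * 2 ^ n) * (D * indicator A z +
        ennreal (b ^ n) * ((\<integral>\<^sup>+x\<in>A. ennreal (norm (u z - u x) ^ n) \<partial>lborel) * indicator A z)) \<partial>lborel)"
      using Xz by (intro nn_integral_mono) (auto simp: indicator_def)
    also have "\<dots> = ennreal (K * 2 ^ n) * (D * emeasure lborel A + ennreal (b ^ n) * double_osc n u A A)"
      by (simp add: nn_integral_cmult nn_integral_add double_osc_def)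
    also have "\<dots> \<le> ennreal (K * 2 ^ n) * (D * ennreal ((4 * r) ^ n) +
        ennreal (b ^ n) * (ennreal (c * (8 * real n * r) ^ n * (4 * r) ^ n) * D))"
    proof (intro mult_left_mono add_mono)
      have "emeasure lborel A \<le> emeasure lborel (cube p (2 * r))"
        unfolding A_def by (intro emeasure_mono) auto
      then show "emeasure lborel A \<le> ennreal ((4 * r) ^ n)" using r by (simp add: emeasure_cube n)
      show "double_osc n u A A \<le> ennreal (c * (8 * real n * r) ^ n * (4 * r) ^ n) * D"
        unfolding A_def D_def c_def by (rule double_osc_annulus_le[OF C1 r n n2])
    qed auto
    also have "\<dots> = ennreal (K * 2 ^ n * ((4 * r) ^ n + b ^ n * (c * (8 * real n * r) ^ n * (4 * r) ^ n))) * D"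
    proof -
      have D1: "D * ennreal P + ennreal Q * (ennreal R * D) = ennreal (P + Q * R) * D"
        if "P \<ge> 0" "Q \<ge> 0" "R \<ge> 0" for P Q R
        using that by (simp add: ennreal_plus ennreal_mult distrib_left mult_ac)
      have D2: "ennreal P * (ennreal Q * D) = ennreal (P * Q) * D" if "P \<ge> 0" "Q \<ge> 0" for P Q
        using that by (simp add: ennreal_mult mult.assoc)
      have h: "0 \<le> c * (8 * real n * r) ^ n * (4 * r) ^ n" "0 \<le> b ^ n" "0 \<le> K * 2 ^ n" "0 \<le> (4 * r) ^ n"
        using K c b r n0 by auto
      show ?thesis
        unfolding D1[OF h(4,2,1)] D2[OF h(3) add_nonneg_nonneg[OF h(4) mult_nonneg_nonneg[OF h(2,1)]]]
        by (rule refl)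
    qed
    also have "K * 2 ^ n * ((4 * r) ^ n + b ^ n * (c * (8 * real n * r) ^ n * (4 * r) ^ n)) =
      K * 2 ^ n * (4 * r) ^ n * (1 + (b * (8 * real n * r)) ^ n * c)"
      unfolding power_mult_distrib[of b] by (simp only: distrib_left mult_1_right mult_ac)
    also have "b * (8 * real n * r) = 48 * real n * real n" using r by (simp add: b_def)
    finally have main: "X * emeasure lborel A \<le> ennreal (K * 2 ^ n * (4 * r) ^ n * (1 + (48 * real n * real n) ^ n * c)) * D" .
    \<comment> \<open>Already the overlap of two slabs gives the annulus measure at least (r /
      2)^n.\<close>
    obtain i j :: 'n where ij: "j \<noteq> i"
      using ex_neq_if_card_ge_2 n n2 by blast
    have "ennreal ((r / 2) ^ n) \<le> emeasure lborel (slab p r (i, 1) \<inter> slab p r (j, 1))"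
      unfolding n using ij r by (intro slab_inter_large) auto
    also have "\<dots> \<le> emeasure lborel A"
      unfolding A_def annulus_eq_slabs by (intro emeasure_mono) auto
    finally have "X * ennreal ((r / 2) ^ n) \<le> X * emeasure lborel A"
      by (rule mult_left_mono) simp
    with main have "X * ennreal ((r / 2) ^ n) \<le> ennreal (K * 2 ^ n * (4 * r) ^ n * (1 + (48 * real n * real n) ^ n * c)) * D"
      by (rule order_trans[rotated])
    then have "X * ennreal ((r / 2) ^ n) * ennreal ((2 / r) ^ n) \<le>
        ennreal (K * 2 ^ n * (4 * r) ^ n * (1 + (48 * real n * real n) ^ n * c)) * D * ennreal ((2 / r) ^ n)"
      by (rule mult_right_mono) simp
    also have "X * ennreal ((r / 2) ^ n) * ennreal ((2 / r) ^ n) = X"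
    proof -
      have "(r / 2) ^ n * (2 / r) ^ n = (r / 2 * (2 / r)) ^ n" by (rule power_mult_distrib[symmetric])
      also have "r / 2 * (2 / r) = 1" using r by simp
      finally have "ennreal ((r / 2) ^ n) * ennreal ((2 / r) ^ n) = 1"
        using r by (subst ennreal_mult[symmetric]) auto
      then show ?thesis by (simp add: mult.assoc)
    qed
    also have "ennreal (K * 2 ^ n * (4 * r) ^ n * (1 + (48 * real n * real n) ^ n * c)) * D * ennreal ((2 / r) ^ n) = ennreal C * D"
    proof -
      have "(4 * r) ^ n * (2 / r) ^ n = (4 * r * (2 / r)) ^ n" by (rule power_mult_distrib[symmetric])
      also have "4 * r * (2 / r) = 8" using r by simp
      finally have eight: "(4 * r) ^ n * (2 / r) ^ n = 8 ^ n" .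
      have "K * 2 ^ n * (4 * r) ^ n * (1 + (48 * real n * real n) ^ n * c) * (2 / r) ^ n =
          K * 2 ^ n * (1 + (48 * real n * real n) ^ n * c) * ((4 * r) ^ n * (2 / r) ^ n)"
        by (simp only: mult_ac)
      then have C_eq: "K * 2 ^ n * (4 * r) ^ n * (1 + (48 * real n * real n) ^ n * c) * (2 / r) ^ n = C"
        unfolding eight C_def .
      have nn: "K * 2 ^ n * (4 * r) ^ n * (1 + (48 * real n * real n) ^ n * c) \<ge> 0" "(2 / r) ^ n \<ge> 0"
        using K c r by auto
      have comm: "ennreal P * D * ennreal Q = ennreal (P * Q) * D" if "P \<ge> 0" "Q \<ge> 0" for P Q
        using that by (simp add: ennreal_mult mult_ac)
      show ?thesis
        unfolding comm[OF nn] C_eq by (rule refl)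
    qed
    finally show ?thesis by (simp add: X_def D_def A_def)
  qed
  ultimately show ?thesis by blast
qed

section \<open>Mollification in Lp\<close>

definition moll :: "(real ^ 'n::finite \<Rightarrow> real) \<Rightarrow> (real ^ 'n \<Rightarrow> real) \<Rightarrow> real ^ 'n \<Rightarrow> real" where
  "moll \<rho> g x = (\<integral>y. \<rho> (x - y) * g y \<partial>lborel)"

text \<open>Local p-th power integrability of a Borel function, tested on cubes; no global bound is
  meant.\<close>

definition Lp_bounded :: "nat \<Rightarrow> (real ^ 'n::finite \<Rightarrow> real) \<Rightarrow> bool" where
  "Lp_bounded p g \<longleftrightarrow> g \<in> borel_measurable borel \<and>
     (\<forall>q r. (\<integral>\<^sup>+x\<in>cube q r. ennreal (\<bar>g x\<bar> ^ p) \<partial>lborel) < top)"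

lemma cube_sym: "x \<in> cube y r \<longleftrightarrow> y \<in> cube x r"
  by (simp add: cube_def abs_minus_commute)

lemma mollifierD:
  assumes "mollifier \<epsilon> \<rho>"
  shows "\<rho> x \<ge> 0" "continuous_on S \<rho>" "\<rho> \<in> borel_measurable borel"
    "\<rho> (x - y) \<noteq> 0 \<Longrightarrow> y \<in> cube x \<epsilon>" "\<exists>B\<ge>0. \<forall>x. \<rho> x \<le> B"
    "(\<integral>\<^sup>+y. ennreal (\<rho> (x - y)) \<partial>lborel) = 1" "(\<integral>\<^sup>+x. ennreal (\<rho> (x - y)) \<partial>lborel) = 1"
proof -
  show nonneg: "\<rho> x \<ge> 0" for x using assms by (simp add: mollifier_def)
  have ck: "C_k 1 \<rho>" using assms by (simp add: mollifier_def)
  have cont: "continuous_on UNIV \<rho>"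
    using C_k_1_has_derivative(1)[OF ck] by (intro has_derivative_continuous_on) (auto intro: has_derivative_at_withinI)
  then show "continuous_on S \<rho>" by (rule continuous_on_subset) simp
  show [measurable]: "\<rho> \<in> borel_measurable borel" using cont by (rule borel_measurable_continuous_onI)
  have supp: "\<rho> x = 0" if "\<epsilon> \<le> \<bar>x $ i\<bar>" for x i
    using assms that by (auto simp: mollifier_def)
  show "y \<in> cube x \<epsilon>" if "\<rho> (x - y) \<noteq> 0" for x y
  proof (rule ccontr)
    assume "y \<notin> cube x \<epsilon>"
    then obtain i where "\<epsilon> < \<bar>y $ i - x $ i\<bar>" by (auto simp: cube_def not_le)
    then have "\<epsilon> \<le> \<bar>(x - y) $ i\<bar>" by (simp add: abs_minus_commute)
    then show False using supp that by blast
  qed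
  have "bounded (\<rho> ` cube 0 \<epsilon>)"
    by (intro compact_imp_bounded compact_continuous_image continuous_on_subset[OF cont]) auto
  then obtain B where B: "B > 0" "\<And>x. x \<in> cube 0 \<epsilon> \<Longrightarrow> \<bar>\<rho> x\<bar> \<le> B"
    unfolding bounded_pos by auto
  have "\<rho> x \<le> B" for x
  proof (cases "x \<in> cube 0 \<epsilon>")
    case True
    then show ?thesis using B by fastforce
  next
    case False
    then obtain i where "\<epsilon> < \<bar>x $ i\<bar>" by (auto simp: cube_def not_le)
    then show ?thesis using supp[of x i] B by simp
  qed
  then show "\<exists>B\<ge>0. \<forall>x. \<rho> x \<le> B" using B by (intro exI[of _ B]) auto
  have "(\<integral>\<^sup>+y. ennreal (\<rho> y) \<partial>lborel) = ennreal (integral\<^sup>L lborel \<rho>)"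
    using assms nonneg by (intro nn_integral_eq_integral) (auto simp: mollifier_def)
  then have one: "(\<integral>\<^sup>+y. ennreal (\<rho> y) \<partial>lborel) = 1"
    using assms by (simp add: mollifier_def)
  show "(\<integral>\<^sup>+y. ennreal (\<rho> (x - y)) \<partial>lborel) = 1"
    using nn_integral_lborel_affine[of "\<lambda>y. ennreal (\<rho> y)" "-1" x] one by simp
  show "(\<integral>\<^sup>+x. ennreal (\<rho> (x - y)) \<partial>lborel) = 1"
    using nn_integral_lborel_affine[of "\<lambda>y. ennreal (\<rho> y)" "1" "- y"] one by simp
qed

lemma Lp_boundedD1:
  assumes "Lp_bounded p g" "p \<ge> 1"
  shows "Lp_bounded 1 g"
proof -
  have [measurable]: "g \<in> borel_measurable borel" using assms by (simp add: Lp_bounded_def)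
  have "(\<integral>\<^sup>+x\<in>cube q r. ennreal \<bar>g x\<bar> \<partial>lborel) < top" for q r
  proof -
    have "\<bar>g x\<bar> \<le> 1 + \<bar>g x\<bar> ^ p" for x
    proof (cases "\<bar>g x\<bar> \<le> 1")
      case False
      then have "\<bar>g x\<bar> ^ 1 \<le> \<bar>g x\<bar> ^ p" using assms by (intro power_increasing) auto
      then show ?thesis by simp
    qed (simp add: add_increasing2)
    then have "ennreal \<bar>g x\<bar> \<le> ennreal (1 + \<bar>g x\<bar> ^ p)" for x
      by (rule ennreal_leI)
    then have "ennreal \<bar>g x\<bar> \<le> 1 + ennreal (\<bar>g x\<bar> ^ p)" for x
      by (simp add: ennreal_plus)
    then have "ennreal \<bar>g x\<bar> * indicator (cube q r) x \<le> indicator (cube q r) x + ennreal (\<bar>g x\<bar> ^ p) * indicator (cube q r) x" for x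
      by (auto simp: indicator_def)
    then have "(\<integral>\<^sup>+x\<in>cube q r. ennreal \<bar>g x\<bar> \<partial>lborel) \<le>
        (\<integral>\<^sup>+x. indicator (cube q r) x + ennreal (\<bar>g x\<bar> ^ p) * indicator (cube q r) x \<partial>lborel)"
      by (intro nn_integral_mono)
    also have "\<dots> = emeasure lborel (cube q r) + (\<integral>\<^sup>+x\<in>cube q r. ennreal (\<bar>g x\<bar> ^ p) \<partial>lborel)"
      by (subst nn_integral_add) auto
    also have "\<dots> < top"
      using assms emeasure_lborel_cbox_finite[of "q - vec r" "q + vec r"]
      by (auto simp: Lp_bounded_def cube_eq_cbox)
    finally show ?thesis .
  qed
  then show ?thesis by (simp add: Lp_bounded_def)
qed

lemma Lp_bounded_continuous:
  assumes "continuous_on UNIV h"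
  shows "Lp_bounded p h"
proof -
  have [measurable]: "h \<in> borel_measurable borel" using assms by (rule borel_measurable_continuous_onI)
  have "(\<integral>\<^sup>+x\<in>cube q r. ennreal (\<bar>h x\<bar> ^ p) \<partial>lborel) < top" for q r
  proof -
    have "integrable lborel (\<lambda>x. indicator (cube q r) x *\<^sub>R \<bar>h x\<bar> ^ p)"
      by (intro borel_integrable_compact continuous_intros continuous_on_subset[OF assms]) auto
    then have "(\<integral>\<^sup>+x. ennreal (norm (indicator (cube q r) x *\<^sub>R \<bar>h x\<bar> ^ p)) \<partial>lborel) < top"
      by (simp add: integrable_iff_bounded)
    also have "(\<integral>\<^sup>+x. ennreal (norm (indicator (cube q r) x *\<^sub>R \<bar>h x\<bar> ^ p)) \<partial>lborel) = (\<integral>\<^sup>+x\<in>cube q r. ennreal (\<bar>h x\<bar> ^ p) \<partial>lborel)"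
      by (intro nn_integral_cong) (auto simp: indicator_def)
    finally show ?thesis .
  qed
  then show ?thesis by (simp add: Lp_bounded_def)
qed

lemma Lp_bounded_diff:
  assumes "Lp_bounded p g" "Lp_bounded p h"
  shows "Lp_bounded p (\<lambda>x. g x - h x)"
proof -
  have [measurable]: "g \<in> borel_measurable borel" "h \<in> borel_measurable borel"
    using assms by (auto simp: Lp_bounded_def)
  have "(\<integral>\<^sup>+x\<in>cube q r. ennreal (\<bar>g x - h x\<bar> ^ p) \<partial>lborel) < top" for q r
  proof -
    have "(\<integral>\<^sup>+x\<in>cube q r. ennreal (\<bar>g x - h x\<bar> ^ p) \<partial>lborel) \<le>
      ennreal (2 ^ p) * ((\<integral>\<^sup>+x\<in>cube q r. ennreal (\<bar>g x\<bar> ^ p) \<partial>lborel) + (\<integral>\<^sup>+x\<in>cube q r. ennreal (\<bar>h x\<bar> ^ p) \<partial>lborel))"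
      by (rule nn_integral_power_add_le) auto
    also have "\<dots> < top" using assms by (auto simp: Lp_bounded_def ennreal_mult_less_top)
    finally show ?thesis .
  qed
  then show ?thesis by (simp add: Lp_bounded_def)
qed

lemma moll_integrable:
  assumes M: "mollifier \<epsilon> \<rho>" and g: "Lp_bounded 1 g"
  shows "integrable lborel (\<lambda>y. \<rho> (x - y) * g y)"
proof -
  note [measurable] = mollifierD(3)[OF M]
  have [measurable]: "g \<in> borel_measurable borel" using g by (simp add: Lp_bounded_def)
  obtain B where B: "B \<ge> 0" "\<And>x. \<rho> x \<le> B" using mollifierD(5)[OF M] by blast
  have "ennreal (norm (\<rho> (x - y) * g y)) \<le> ennreal B * (ennreal \<bar>g y\<bar> * indicator (cube x \<epsilon>) y)" for y
  proof (cases "\<rho> (x - y) = 0")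
    case False
    then have "y \<in> cube x \<epsilon>" by (rule mollifierD(4)[OF M])
    moreover have "norm (\<rho> (x - y) * g y) \<le> B * \<bar>g y\<bar>"
      using B mollifierD(1)[OF M, of "x - y"] by (auto simp: abs_mult intro!: mult_right_mono)
    ultimately show ?thesis using B by (simp add: ennreal_leI flip: ennreal_mult)
  qed simp
  then have "(\<integral>\<^sup>+y. ennreal (norm (\<rho> (x - y) * g y)) \<partial>lborel) \<le> (\<integral>\<^sup>+y. ennreal B * (ennreal \<bar>g y\<bar> * indicator (cube x \<epsilon>) y) \<partial>lborel)"
    by (rule nn_integral_mono)
  also have "\<dots> = ennreal B * (\<integral>\<^sup>+y\<in>cube x \<epsilon>. ennreal (\<bar>g y\<bar> ^ 1) \<partial>lborel)"
    by (simp add: nn_integral_cmult)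
  also have "\<dots> < top" using g by (simp add: Lp_bounded_def ennreal_mult_less_top)
  finally show ?thesis by (simp add: integrable_iff_bounded)
qed

lemma moll_diff:
  assumes "mollifier \<epsilon> \<rho>" "Lp_bounded 1 g" "Lp_bounded 1 h"
  shows "moll \<rho> (\<lambda>y. g y - h y) x = moll \<rho> g x - moll \<rho> h x"
  unfolding moll_def right_diff_distrib
  by (intro Bochner_Integration.integral_diff moll_integrable[OF assms(1)] assms)

lemma moll_measurable:
  assumes M: "mollifier \<epsilon> \<rho>" and [measurable]: "g \<in> borel_measurable borel"
  shows "moll \<rho> g \<in> borel_measurable borel"
proof -
  note [measurable] = mollifierD(3)[OF M]
  show ?thesis unfolding moll_def[abs_def] by measurable
qed

lemma abs_moll_le: "ennreal \<bar>moll \<rho> g x\<bar> \<le> (\<integral>\<^sup>+y. ennreal \<bar>\<rho> (x - y) * g y\<bar> \<partial>lborel)"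
proof (cases "integrable lborel (\<lambda>y. \<rho> (x - y) * g y)")
  case True
  then show ?thesis using integral_norm_bound_ennreal[OF True] by (simp add: moll_def)
next
  case False
  \<comment> \<open>The Bochner integral of a non-integrable function is 0, so the left side
    vanishes.\<close>
  then show ?thesis by (simp add: moll_def not_integrable_integral_eq)
qed

text \<open>Jensen's inequality with the weight y \<mapsto> \<open>\<rho> (x - y)\<close>, whose
  integral is 1.\<close>

lemma abs_moll_power_le:
  assumes M: "mollifier \<epsilon> \<rho>" and [measurable]: "g \<in> borel_measurable borel" and p: "p \<ge> 1"
  shows "ennreal (\<bar>moll \<rho> g x\<bar> ^ p) \<le> (\<integral>\<^sup>+y. ennreal (\<rho> (x - y)) * ennreal (\<bar>g y\<bar> ^ p) \<partial>lborel)"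
proof -
  note [measurable] = mollifierD(3)[OF M]
  have "ennreal (\<bar>moll \<rho> g x\<bar> ^ p) = ennreal \<bar>moll \<rho> g x\<bar> ^ p" by (simp add: ennreal_power)
  also have "\<dots> \<le> (\<integral>\<^sup>+y. ennreal (\<rho> (x - y)) * ennreal \<bar>g y\<bar> \<partial>lborel) ^ p"
  proof (rule power_mono)
    show "ennreal \<bar>moll \<rho> g x\<bar> \<le> (\<integral>\<^sup>+y. ennreal (\<rho> (x - y)) * ennreal \<bar>g y\<bar> \<partial>lborel)"
      using abs_moll_le[of \<rho> g x] mollifierD(1)[OF M] by (simp add: abs_mult ennreal_mult)
  qed simp
  also have "\<dots> \<le> (\<integral>\<^sup>+y. ennreal (\<rho> (x - y)) * ennreal \<bar>g y\<bar> ^ p \<partial>lborel)"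
    using p by (intro nn_integral_jensen_power mollifierD(6)[OF M]) auto
  finally show ?thesis by (simp add: ennreal_power)
qed

text \<open>The pointwise bound is integrated and the integrals are interchanged;
  \<open>\<rho> (x - y)\<close> has mass 1 also as a function of x. Enlarging the cube by 1 covers
  every \<epsilon> \<le> 1 at once.\<close>

lemma nn_integral_moll_le:
  assumes M: "mollifier \<epsilon> \<rho>" "\<epsilon> \<le> 1" and g[measurable]: "g \<in> borel_measurable borel" and p: "p \<ge> 1"
  shows "(\<integral>\<^sup>+x\<in>cube q r. ennreal (\<bar>moll \<rho> g x\<bar> ^ p) \<partial>lborel) \<le> (\<integral>\<^sup>+x\<in>cube q (r + 1). ennreal (\<bar>g x\<bar> ^ p) \<partial>lborel)"
proof -
  note [measurable] = mollifierD(3)[OF M(1)]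
  have "(\<integral>\<^sup>+x\<in>cube q r. ennreal (\<bar>moll \<rho> g x\<bar> ^ p) \<partial>lborel) \<le>
    (\<integral>\<^sup>+x. (\<integral>\<^sup>+y. ennreal (\<rho> (x - y)) * ennreal (\<bar>g y\<bar> ^ p) \<partial>lborel) * indicator (cube q r) x \<partial>lborel)"
    by (intro nn_integral_mono mult_right_mono abs_moll_power_le[OF M(1) g p]) auto
  also have "\<dots> = (\<integral>\<^sup>+x. (\<integral>\<^sup>+y. ennreal (\<rho> (x - y)) * ennreal (\<bar>g y\<bar> ^ p) * indicator (cube q r) x \<partial>lborel) \<partial>lborel)"
    by (subst nn_integral_multc) auto
  also have "\<dots> \<le> (\<integral>\<^sup>+x. (\<integral>\<^sup>+y. (ennreal (\<bar>g y\<bar> ^ p) * indicator (cube q (r + 1)) y) * ennreal (\<rho> (x - y)) \<partial>lborel) \<partial>lborel)"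
  proof (intro nn_integral_mono)
    fix x y
    have "y \<in> cube q (r + 1)" if "\<rho> (x - y) \<noteq> 0" "x \<in> cube q r"
    proof -
      have "y \<in> cube x \<epsilon>" using that(1) by (rule mollifierD(4)[OF M(1)])
      then have "\<bar>y $ i - q $ i\<bar> \<le> r + 1" for i
      proof -
        have "\<bar>y $ i - x $ i\<bar> \<le> \<epsilon>" "\<bar>x $ i - q $ i\<bar> \<le> r"
          using \<open>y \<in> cube x \<epsilon>\<close> that(2) by (auto simp: cube_def)
        then show ?thesis using M(2) by linarith
      qed
      then show ?thesis by (simp add: cube_def)
    qed
    then show "ennreal (\<rho> (x - y)) * ennreal (\<bar>g y\<bar> ^ p) * indicator (cube q r) x \<le>
      (ennreal (\<bar>g y\<bar> ^ p) * indicator (cube q (r + 1)) y) * ennreal (\<rho> (x - y))"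
      by (cases "\<rho> (x - y) = 0") (auto simp: indicator_def mult.commute)
  qed
  also have "\<dots> = (\<integral>\<^sup>+y. (\<integral>\<^sup>+x. (ennreal (\<bar>g y\<bar> ^ p) * indicator (cube q (r + 1)) y) * ennreal (\<rho> (x - y)) \<partial>lborel) \<partial>lborel)"
    by (rule lborel_pair.Fubini') measurable
  also have "\<dots> = (\<integral>\<^sup>+x\<in>cube q (r + 1). ennreal (\<bar>g x\<bar> ^ p) \<partial>lborel)"
    by (simp add: nn_integral_cmult mollifierD(7)[OF M(1)])
  finally show ?thesis .
qed

lemma abs_moll_minus_le:
  assumes M: "mollifier \<epsilon> \<rho>" and h: "Lp_bounded 1 h"
    and \<omega>: "\<And>y. y \<in> cube x \<epsilon> \<Longrightarrow> \<bar>h y - h x\<bar> \<le> \<omega>" "\<omega> \<ge> 0"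
  shows "\<bar>moll \<rho> h x - h x\<bar> \<le> \<omega>"
proof -
  note [measurable] = mollifierD(3)[OF M]
  have [measurable]: "h \<in> borel_measurable borel" using h by (simp add: Lp_bounded_def)
  have c: "moll \<rho> (\<lambda>_. h x) x = h x"
  proof -
    have "(\<integral>y. \<rho> (x - y) \<partial>lborel) = 1"
      using mollifierD(6)[OF M, of x] mollifierD(1)[OF M]
      by (subst integral_eq_nn_integral) auto
    then show ?thesis by (simp add: moll_def)
  qed
  have "moll \<rho> h x - h x = moll \<rho> (\<lambda>y. h y - h x) x"
    by (subst moll_diff[OF M h]) (auto intro!: Lp_bounded_continuous simp: c)
  then have "ennreal \<bar>moll \<rho> h x - h x\<bar> \<le> (\<integral>\<^sup>+y. ennreal \<bar>\<rho> (x - y) * (h y - h x)\<bar> \<partial>lborel)"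
    using abs_moll_le by metis
  also have "\<dots> \<le> (\<integral>\<^sup>+y. ennreal \<omega> * ennreal (\<rho> (x - y)) \<partial>lborel)"
  proof (rule nn_integral_mono)
    fix y
    have "\<bar>\<rho> (x - y) * (h y - h x)\<bar> \<le> \<omega> * \<rho> (x - y)"
    proof (cases "\<rho> (x - y) = 0")
      case False
      then have "\<bar>h y - h x\<bar> \<le> \<omega>" using mollifierD(4)[OF M] \<omega> by blast
      then show ?thesis using mollifierD(1)[OF M, of "x - y"] by (simp add: abs_mult) (metis mult.commute mult_left_mono)
    qed simp
    then show "ennreal \<bar>\<rho> (x - y) * (h y - h x)\<bar> \<le> ennreal \<omega> * ennreal (\<rho> (x - y))"
      using \<omega>(2) mollifierD(1)[OF M] by (simp add: ennreal_leI flip: ennreal_mult)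
  qed
  also have "\<dots> = ennreal \<omega>" by (simp add: nn_integral_cmult mollifierD(6)[OF M])
  finally show ?thesis using \<omega>(2) by simp
qed

lemma moll_uniform_limit:
  assumes h: "continuous_on UNIV h" and e: "e > 0"
  shows "\<exists>d>0. \<forall>\<epsilon> \<rho>. mollifier \<epsilon> \<rho> \<and> \<epsilon> \<le> d \<longrightarrow> (\<forall>x\<in>cube q r. \<bar>moll \<rho> h x - h x\<bar> \<le> e)"
proof -
  have "uniformly_continuous_on (cube q (r + 1)) h"
    by (intro compact_uniformly_continuous continuous_on_subset[OF h]) auto
  then obtain d where d: "d > 0" "\<And>x y. x \<in> cube q (r + 1) \<Longrightarrow> y \<in> cube q (r + 1) \<Longrightarrow> dist y x < d \<Longrightarrow> dist (h y) (h x) < e"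
    using e unfolding uniformly_continuous_on_def by metis
  \<comment> \<open>With N the dimension, a coordinatewise distance d / (2 N) gives Euclidean
    distance at most d / 2, and the bound 1 keeps y in the larger cube.\<close>
  define d' where "d' = min 1 (d / (2 * real CARD('a)))"
  have N: "real CARD('a) > 0" by simp
  have "\<bar>moll \<rho> h x - h x\<bar> \<le> e" if M: "mollifier \<epsilon> \<rho>" "\<epsilon> \<le> d'" and x: "x \<in> cube q r" for \<epsilon> \<rho> x
  proof (rule abs_moll_minus_le[OF M(1) Lp_bounded_continuous[OF h]])
    fix y assume y: "y \<in> cube x \<epsilon>"
    have "\<bar>(y - x) $ i\<bar> \<le> d / (2 * real CARD('a))" for i
      using y M(2) by (auto simp: cube_def d'_def intro: order_trans)
    then have "norm (y - x) \<le> real CARD('a) * (d / (2 * real CARD('a)))" by (rule norm_le_card_times)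
    also have "\<dots> < d" using d N by simp
    finally have "dist y x < d" by (simp add: dist_norm)
    moreover have "\<bar>y $ i - q $ i\<bar> \<le> r + 1" for i
    proof -
      have "\<bar>y $ i - x $ i\<bar> \<le> 1" "\<bar>x $ i - q $ i\<bar> \<le> r"
        using y x M(2) by (auto simp: cube_def d'_def intro: order_trans)
      then show ?thesis by linarith
    qed
    then have "y \<in> cube q (r + 1)" by (simp add: cube_def)
    moreover have "x \<in> cube q (r + 1)" using x cube_mono[of r "r + 1" q] by auto
    ultimately show "\<bar>h y - h x\<bar> \<le> e" using d(2) by (fastforce simp: dist_real_def)
  qed (use e in simp)
  moreover have "d' > 0" using d N by (simp add: d'_def)
  ultimately show ?thesis by blast
qed

section \<open>Density of continuous functions\<close>

text \<open>Measurability provides continuous functions converging to \<open>v\<close> almost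
  everywhere; truncating them at \<open>M\<close> keeps the limit and supplies the dominating
  constant (2 M)^p.\<close>

lemma continuous_approx_bounded:
  fixes v :: "real ^ 'n \<Rightarrow> real"
  assumes v[measurable]: "v \<in> borel_measurable borel" and bd: "\<And>x. \<bar>v x\<bar> \<le> M" and \<delta>: "\<delta> > 0" and p: "p \<ge> 1"
  shows "\<exists>h. continuous_on UNIV h \<and> (\<integral>\<^sup>+x\<in>cube q r. ennreal (\<bar>v x - h x\<bar> ^ p) \<partial>lborel) < ennreal \<delta>"
proof -
  have "M \<ge> 0" using bd[of 0] by linarith
  have "v measurable_on UNIV"
    by (subst measurable_on_iff_borel_measurable) (auto intro!: measurable_restrict_space1 measurable_completion v)
  then obtain N g where N: "negligible N" and g: "\<And>k. continuous_on UNIV (g k)"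
    and lim: "\<And>x. x \<notin> N \<Longrightarrow> (\<lambda>k. g k x) \<longlonglongrightarrow> v x"
    unfolding measurable_on_def by auto
  define h where "h k x = max (- M) (min M (g k x))" for k x
  have ch: "continuous_on UNIV (h k)" for k
    unfolding h_def by (intro continuous_intros g)
  have [measurable]: "h k \<in> borel_measurable borel" for k
    using ch by (rule borel_measurable_continuous_onI)
  have hM: "\<bar>h k x\<bar> \<le> M" for k x using \<open>M \<ge> 0\<close> by (auto simp: h_def)
  have limh: "(\<lambda>k. h k x) \<longlonglongrightarrow> v x" if "x \<notin> N" for x
  proof -
    have "(\<lambda>k. h k x) \<longlonglongrightarrow> max (- M) (min M (v x))"
      unfolding h_def by (intro tendsto_max tendsto_min tendsto_const lim that)
    then show ?thesis using bd[of x] by (simp add: min_def max_def abs_le_iff split: if_splits)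
  qed
  have "(\<lambda>k. \<integral>\<^sup>+x\<in>cube q r. ennreal (\<bar>v x - h k x\<bar> ^ p) \<partial>lborel) \<longlonglongrightarrow> (\<integral>\<^sup>+x. 0 \<partial>(lborel :: (real ^ 'n) measure))"
  proof (rule nn_integral_dominated_convergence[where w = "\<lambda>x. ennreal ((2 * M) ^ p) * indicator (cube q r) x"])
    show "AE x in lborel. ennreal (\<bar>v x - h k x\<bar> ^ p) * indicator (cube q r) x \<le> ennreal ((2 * M) ^ p) * indicator (cube q r) x" for k
    proof (rule AE_I2, rule mult_right_mono)
      fix x
      have "\<bar>v x - h k x\<bar> \<le> 2 * M" using bd[of x] hM[of k x] by linarith
      then show "ennreal (\<bar>v x - h k x\<bar> ^ p) \<le> ennreal ((2 * M) ^ p)" by (intro ennreal_leI power_mono) auto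
    qed simp
    have "emeasure lborel (cube q r) < \<infinity>" unfolding cube_eq_cbox by (rule emeasure_lborel_cbox_finite)
    then show "(\<integral>\<^sup>+x\<in>cube q r. ennreal ((2 * M) ^ p) \<partial>lborel) < \<infinity>"
      by (simp add: nn_integral_cmult ennreal_mult_less_top)
    have "N \<in> null_sets lebesgue" using N by (simp add: negligible_iff_null_sets)
    then have "AE x in lborel. x \<notin> N"
      by (metis AE_completion_iff AE_not_in)
    then show "AE x in lborel. (\<lambda>k. ennreal (\<bar>v x - h k x\<bar> ^ p) * indicator (cube q r) x) \<longlonglongrightarrow> 0"
    proof eventually_elim
      case (elim x)
      have "(\<lambda>k. \<bar>v x - h k x\<bar> ^ p) \<longlonglongrightarrow> \<bar>v x - v x\<bar> ^ p"
        by (intro tendsto_intros limh elim)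
      then have "(\<lambda>k. ennreal (\<bar>v x - h k x\<bar> ^ p)) \<longlonglongrightarrow> ennreal 0"
        using p by (intro tendsto_ennrealI) (simp add: power_0_left)
      then show ?case by (cases "x \<in> cube q r") auto
    qed
  qed auto
  then have "\<forall>\<^sub>F k in sequentially. (\<integral>\<^sup>+x\<in>cube q r. ennreal (\<bar>v x - h k x\<bar> ^ p) \<partial>lborel) < ennreal \<delta>"
    using \<delta> by (intro order_tendstoD(2)[where y = 0]) auto
  then obtain k where "(\<integral>\<^sup>+x\<in>cube q r. ennreal (\<bar>v x - h k x\<bar> ^ p) \<partial>lborel) < ennreal \<delta>"
    by (auto simp: eventually_sequentially)
  with ch show ?thesis by blast
qed

text \<open>Truncations of \<open>v\<close> converge to \<open>v\<close> in L^p on the cube by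
  dominated convergence, so a bounded function may be approximated instead.\<close>

lemma Lp_bounded_approx:
  fixes v :: "real ^ 'n \<Rightarrow> real"
  assumes v: "Lp_bounded p v" and \<delta>: "\<delta> > 0" and p: "p \<ge> 1"
  shows "\<exists>h. continuous_on UNIV h \<and> (\<integral>\<^sup>+x\<in>cube q r. ennreal (\<bar>v x - h x\<bar> ^ p) \<partial>lborel) < ennreal \<delta>"
proof -
  have [measurable]: "v \<in> borel_measurable borel" using v by (simp add: Lp_bounded_def)
  define c where "c M x = max (- real M) (min (real M) (v x))" for M :: nat and x
  have [measurable]: "c M \<in> borel_measurable borel" for M unfolding c_def by measurable
  define \<delta>' where "\<delta>' = \<delta> / (2 * 2 ^ p)"
  have \<delta>': "\<delta>' > 0" using \<delta> by (simp add: \<delta>'_def)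
  have "(\<lambda>M. \<integral>\<^sup>+x\<in>cube q r. ennreal (\<bar>v x - c M x\<bar> ^ p) \<partial>lborel) \<longlonglongrightarrow> (\<integral>\<^sup>+x. 0 \<partial>(lborel :: (real ^ 'n) measure))"
  proof (rule nn_integral_dominated_convergence[where w = "\<lambda>x. ennreal (\<bar>v x\<bar> ^ p) * indicator (cube q r) x"])
    show "AE x in lborel. ennreal (\<bar>v x - c M x\<bar> ^ p) * indicator (cube q r) x \<le> ennreal (\<bar>v x\<bar> ^ p) * indicator (cube q r) x" for M
      by (intro AE_I2 mult_right_mono ennreal_leI power_mono) (auto simp: c_def min_def max_def abs_if)
    show "(\<integral>\<^sup>+x\<in>cube q r. ennreal (\<bar>v x\<bar> ^ p) \<partial>lborel) < \<infinity>"
      using v by (simp add: Lp_bounded_def)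
    have "\<forall>\<^sub>F M in sequentially. ennreal (\<bar>v x - c M x\<bar> ^ p) * indicator (cube q r) x = 0" for x
    proof -
      obtain N :: nat where "\<bar>v x\<bar> \<le> real N" using real_arch_simple by blast
      then have "c M x = v x" if "M \<ge> N" for M using that by (simp add: c_def abs_le_iff min_def max_def)
      then show ?thesis using p unfolding eventually_sequentially by (intro exI[of _ N]) (auto simp: power_0_left)
    qed
    then show "AE x in lborel. (\<lambda>M. ennreal (\<bar>v x - c M x\<bar> ^ p) * indicator (cube q r) x) \<longlonglongrightarrow> 0"
      by (intro AE_I2 tendsto_eventually)
  qed auto
  then have "\<forall>\<^sub>F M in sequentially. (\<integral>\<^sup>+x\<in>cube q r. ennreal (\<bar>v x - c M x\<bar> ^ p) \<partial>lborel) < ennreal \<delta>'"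
    using \<delta>' by (intro order_tendstoD(2)[where y = 0]) auto
  then obtain M where M: "(\<integral>\<^sup>+x\<in>cube q r. ennreal (\<bar>v x - c M x\<bar> ^ p) \<partial>lborel) < ennreal \<delta>'"
    by (auto simp: eventually_sequentially)
  have "\<bar>c M x\<bar> \<le> real M" for x by (auto simp: c_def)
  then obtain h where h: "continuous_on UNIV h" "(\<integral>\<^sup>+x\<in>cube q r. ennreal (\<bar>c M x - h x\<bar> ^ p) \<partial>lborel) < ennreal \<delta>'"
    using continuous_approx_bounded[of "c M" "real M" \<delta>' p q r] \<delta>' p by auto
  have [measurable]: "h \<in> borel_measurable borel" using h(1) by (rule borel_measurable_continuous_onI)
  have "(\<integral>\<^sup>+x\<in>cube q r. ennreal (\<bar>v x - h x\<bar> ^ p) \<partial>lborel) \<le>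
      ennreal (2 ^ p) * ((\<integral>\<^sup>+x\<in>cube q r. ennreal (\<bar>v x - c M x\<bar> ^ p) \<partial>lborel) + (\<integral>\<^sup>+x\<in>cube q r. ennreal (\<bar>c M x - h x\<bar> ^ p) \<partial>lborel))"
    by (rule nn_integral_power_add_le) auto
  also have "\<dots> < ennreal (2 ^ p) * (ennreal \<delta>' + ennreal \<delta>')"
    using M h(2) by (intro ennreal_mult_strict_left_mono add_strict_mono) auto
  also have "\<dots> = ennreal \<delta>" using \<delta> by (simp add: \<delta>'_def flip: ennreal_plus ennreal_mult)
  finally show ?thesis using h(1) by blast
qed

lemma ennreal_tendsto_0I:
  fixes f :: "'a \<Rightarrow> ennreal"
  assumes "\<And>e. e > 0 \<Longrightarrow> \<forall>\<^sub>F x in F. f x \<le> ennreal e"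
  shows "(f \<longlongrightarrow> 0) F"
proof (rule order_tendstoI)
  fix a :: ennreal assume "0 < a"
  then obtain e where e: "e > 0" "ennreal e < a"
    by (metis dense ennreal_cases ennreal_less_zero_iff less_top not_less_zero order_less_trans top.extremum_strict)
  have "\<forall>\<^sub>F x in F. f x \<le> ennreal e" using e assms by simp
  then show "\<forall>\<^sub>F x in F. f x < a" by eventually_elim (use e in auto)
qed simp

text \<open>With a continuous \<open>h\<close> close to \<open>v\<close> on the enlarged cube, the
  difference splits into the mollification of v - h, controlled by
  \<open>nn_integral_moll_le\<close>, the difference of h and its mollification, controlled by
  uniform continuity, and h - v.\<close>

theorem moll_tendsto_Lp:
  fixes v :: "real ^ 'n \<Rightarrow> real"
  assumes v: "Lp_bounded p v" and p: "p \<ge> 1"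
    and M: "\<And>k. mollifier (\<epsilon> k) (\<rho> k)" and \<epsilon>: "\<epsilon> \<longlonglongrightarrow> 0"
  shows "(\<lambda>k. \<integral>\<^sup>+x\<in>cube q r. ennreal (\<bar>moll (\<rho> k) v x - v x\<bar> ^ p) \<partial>lborel) \<longlonglongrightarrow> 0"
proof (rule ennreal_tendsto_0I)
  fix e :: real assume e: "e > 0"
  \<comment> \<open>Splitting a sum costs 2^p, and it happens twice: 2^p (\<delta> + 2^p 2 \<delta>)
    \<le> 3 4^p \<delta>.\<close>
  define \<delta> where "\<delta> = e / (3 * 4 ^ p)"
  have \<delta>: "\<delta> > 0" using e by (simp add: \<delta>_def)
  obtain h where h: "continuous_on UNIV h" "(\<integral>\<^sup>+x\<in>cube q (r + 1). ennreal (\<bar>v x - h x\<bar> ^ p) \<partial>lborel) < ennreal \<delta>"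
    using Lp_bounded_approx[OF v \<delta> p] by blast
  have [measurable]: "v \<in> borel_measurable borel" "h \<in> borel_measurable borel"
    using v h(1) by (auto simp: Lp_bounded_def intro: borel_measurable_continuous_onI)
  have [measurable]: "moll (\<rho> k) g \<in> borel_measurable borel" if "g \<in> borel_measurable borel" for k g
    using that by (rule moll_measurable[OF M])
  have vL1: "Lp_bounded 1 v" using Lp_boundedD1[OF v p] .
  have "emeasure lborel (cube q r) < top" unfolding cube_eq_cbox using emeasure_lborel_cbox_finite by simp
  then obtain m where m: "m \<ge> 0" "emeasure lborel (cube q r) = ennreal m"
    by (metis ennreal_cases less_irrefl)
  \<comment> \<open>As \<omega> \<le> 1, its p-th power is at most \<omega>, so \<omega>^p m \<le>
    \<delta> for every p; m + 1 avoids a division by 0.\<close>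
  define \<omega> where "\<omega> = min 1 (\<delta> / (m + 1))"
  have \<omega>: "\<omega> > 0" "\<omega> \<le> 1" using \<delta> m by (auto simp: \<omega>_def)
  have "\<omega> ^ p * m \<le> \<delta>"
  proof -
    have "\<omega> ^ p \<le> \<omega> ^ 1" using \<omega> p by (intro power_decreasing) auto
    then have "\<omega> ^ p * m \<le> \<delta> / (m + 1) * m" using m by (intro mult_right_mono) (auto simp: \<omega>_def)
    also have "\<dots> \<le> \<delta>" using m \<delta> by (simp add: field_simps)
    finally show ?thesis .
  qed
  obtain d where d: "d > 0" "\<And>\<epsilon> \<rho> x. mollifier \<epsilon> \<rho> \<Longrightarrow> \<epsilon> \<le> d \<Longrightarrow> x \<in> cube q r \<Longrightarrow> \<bar>moll \<rho> h x - h x\<bar> \<le> \<omega>"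
    using moll_uniform_limit[OF h(1) \<omega>(1), of q r] by blast
  have "\<forall>\<^sub>F k in sequentially. \<epsilon> k < min 1 d" using d(1) by (intro order_tendstoD(2)[OF \<epsilon>]) auto
  then show "\<forall>\<^sub>F k in sequentially. (\<integral>\<^sup>+x\<in>cube q r. ennreal (\<bar>moll (\<rho> k) v x - v x\<bar> ^ p) \<partial>lborel) \<le> ennreal e"
  proof eventually_elim
    case (elim k)
    let ?w = "\<lambda>y. v y - h y"
    let ?I = "\<lambda>g::real ^ 'n \<Rightarrow> real. \<integral>\<^sup>+x\<in>cube q r. ennreal (\<bar>g x\<bar> ^ p) \<partial>lborel"
    have split: "moll (\<rho> k) v x - v x = moll (\<rho> k) ?w x + ((moll (\<rho> k) h x - h x) + (h x - v x))" for x
      by (simp add: moll_diff[OF M vL1 Lp_bounded_continuous[OF h(1)]])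
    have "?I (\<lambda>x. moll (\<rho> k) v x - v x) \<le> ennreal (2 ^ p) * (?I (moll (\<rho> k) ?w) + ?I (\<lambda>x. (moll (\<rho> k) h x - h x) + (h x - v x)))"
      unfolding split by (rule nn_integral_power_add_le) auto
    also have "\<dots> \<le> ennreal (2 ^ p) * (?I (moll (\<rho> k) ?w) + ennreal (2 ^ p) * (?I (\<lambda>x. moll (\<rho> k) h x - h x) + ?I (\<lambda>x. h x - v x)))"
      by (intro mult_left_mono add_left_mono nn_integral_power_add_le) auto
    also have "\<dots> \<le> ennreal (2 ^ p) * (ennreal \<delta> + ennreal (2 ^ p) * (ennreal \<delta> + ennreal \<delta>))"
    proof (intro mult_left_mono add_mono)
      show "?I (moll (\<rho> k) ?w) \<le> ennreal \<delta>"
        using nn_integral_moll_le[OF M[of k], of ?w p q r] elim p h(2) by auto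
      have "?I (\<lambda>x. h x - v x) \<le> (\<integral>\<^sup>+x\<in>cube q (r + 1). ennreal (\<bar>v x - h x\<bar> ^ p) \<partial>lborel)"
        using cube_mono[of r "r + 1" q] by (intro nn_integral_mono mult_mono) (auto simp: abs_minus_commute indicator_def)
      then show "?I (\<lambda>x. h x - v x) \<le> ennreal \<delta>" using h(2) by auto
      have "?I (\<lambda>x. moll (\<rho> k) h x - h x) \<le> (\<integral>\<^sup>+x. ennreal (\<omega> ^ p) * indicator (cube q r) x \<partial>lborel)"
        using d(2)[OF M[of k]] elim by (intro nn_integral_mono) (auto simp: indicator_def intro!: ennreal_leI power_mono)
      also have "\<dots> = ennreal (\<omega> ^ p * m)" using m \<omega> by (simp add: nn_integral_cmult ennreal_mult)
      also have "\<dots> \<le> ennreal \<delta>" by (intro ennreal_leI) fact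
      finally show "?I (\<lambda>x. moll (\<rho> k) h x - h x) \<le> ennreal \<delta>" .
    qed auto
    also have "\<dots> = ennreal (2 ^ p * (\<delta> + 2 ^ p * (\<delta> + \<delta>)))"
      using less_imp_le[OF \<delta>]
      by (simp only: ennreal_mult ennreal_plus add_nonneg_nonneg mult_nonneg_nonneg zero_le_power zero_le_numeral)
    also have "\<dots> \<le> ennreal e"
    proof (rule ennreal_leI)
      have "2 ^ p * (\<delta> + 2 ^ p * (\<delta> + \<delta>)) = \<delta> * 2 ^ p + 2 * \<delta> * (2 * 2) ^ p"
        unfolding power_mult_distrib by (simp add: algebra_simps)
      also have "\<delta> * 2 ^ p \<le> \<delta> * 4 ^ p" using \<delta> by (intro mult_left_mono power_mono) auto
      finally show "2 ^ p * (\<delta> + 2 ^ p * (\<delta> + \<delta>)) \<le> e" by (simp add: \<delta>_def)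
    qed
    finally show ?case .
  qed
qed

section \<open>Differentiating mollifications\<close>

lemma lborel_integral_eq_cbox:
  fixes w :: "'a::euclidean_space \<Rightarrow> real"
  assumes "continuous_on UNIV w" "\<And>y. y \<notin> cbox a b \<Longrightarrow> w y = 0"
  shows "integral\<^sup>L lborel w = integral (cbox a b) w"
proof -
  have "set_integrable lborel (cbox a b) w"
    unfolding set_integrable_def by (intro borel_integrable_compact continuous_on_subset[OF assms(1)]) auto
  then have "(LINT y : cbox a b | lborel. w y) = integral (cbox a b) w"
    by (rule set_borel_integral_eq_integral)
  moreover have "(\<lambda>y. indicator (cbox a b) y *\<^sub>R w y) = w"
    using assms(2) by (intro ext) (auto simp: indicator_def)
  ultimately show ?thesis by (simp add: set_lebesgue_integral_def)
qed

text \<open>The derivative falls on \<open>\<rho>\<close>, since \<open>f\<close> is only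
  continuous; in this form the weak derivative can take it over.\<close>

lemma moll_has_derivative:
  fixes f :: "real ^ 'n \<Rightarrow> real"
  assumes M: "mollifier \<epsilon> \<rho>" and f: "continuous_on UNIV f"
  shows "(moll \<rho> f has_derivative (\<lambda>h. \<Sum>i\<in>UNIV. (\<integral>y. f y * partial_deriv i \<rho> (x - y) \<partial>lborel) * h $ i)) (at x)"
    and "continuous_on UNIV (\<lambda>x. \<integral>y. f y * partial_deriv i \<rho> (x - y) \<partial>lborel)"
proof -
  have ck: "C_k 1 \<rho>" using M by (simp add: mollifier_def)
  define G where "G z = (\<chi> i. partial_deriv i \<rho> z)" for z
  have cG: "continuous_on UNIV G"
    unfolding G_def by (intro continuous_intros C_k_1_has_derivative(2)[OF ck])
  have c\<rho>: "continuous_on UNIV \<rho>" using M by (rule mollifierD)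
  have d\<rho>: "(\<rho> has_derivative (\<lambda>h. G z \<bullet> h)) (at z within S)" for z S
    by (rule has_derivative_at_withinI)
      (use C_k_1_has_derivative(1)[OF ck, of z] in \<open>simp add: G_def inner_vec_def\<close>)
  have \<rho>0: "\<rho> (x - y) = 0" if "y \<notin> cube x \<epsilon>" for x y
    using mollifierD(4)[OF M] that by blast
  have G0: "G (x - y) = 0" if "y \<notin> cube x \<epsilon>" for x y
  proof -
    have "open (- cube 0 \<epsilon>)" by (intro open_Compl compact_imp_closed) simp
    moreover have mem: "z \<notin> cube 0 \<epsilon> \<longleftrightarrow> 0 \<notin> cube z \<epsilon>" for z :: "real ^ 'n" using cube_sym[of z 0 \<epsilon>] by simp
    have "x - y \<in> - cube 0 \<epsilon>" using that by (simp add: cube_def abs_minus_commute)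
    moreover have "\<rho> z = 0" if "z \<in> - cube 0 \<epsilon>" for z using \<rho>0[of 0 z] that mem by simp
    ultimately have "((\<lambda>z. 0) has_derivative (\<lambda>h. G (x - y) \<bullet> h)) (at (x - y))"
      by (intro has_derivative_transform_within_open[OF d\<rho>]) auto
    then have "(\<lambda>h. G (x - y) \<bullet> h) = (\<lambda>h. 0)"
      by (intro has_derivative_unique[OF _ has_derivative_const])
    then have "G (x - y) \<bullet> G (x - y) = 0" by meson
    then show ?thesis by simp
  qed
  \<comment> \<open>Differentiation under the integral sign needs a fixed compact domain. This cube
    contains the support of y \<mapsto> \<open>\<rho> (x - y)\<close> for all x in the unit ball
    about \<open>x0\<close>.\<close>
  define q where "q x0 = cube x0 (\<epsilon> + 1)" for x0 :: "real ^ 'n"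
  have q: "q x0 = cbox (x0 - vec (\<epsilon> + 1)) (x0 + vec (\<epsilon> + 1))" for x0
    unfolding q_def by (rule cube_eq_cbox)
  have outside: "y \<notin> cube x \<epsilon>" if "x \<in> ball x0 1" "y \<notin> q x0" for x y x0
  proof
    assume "y \<in> cube x \<epsilon>"
    moreover have "\<bar>x $ i - x0 $ i\<bar> \<le> 1" for i
      using that(1) component_le_norm_cart[of "x - x0" i] by (simp add: dist_norm norm_minus_commute)
    ultimately have "\<bar>y $ i - x0 $ i\<bar> \<le> \<epsilon> + 1" for i
    proof -
      have "\<bar>y $ i - x $ i\<bar> \<le> \<epsilon>" using \<open>y \<in> cube x \<epsilon>\<close> by (simp add: cube_def)
      then show ?thesis using \<open>\<And>i. \<bar>x $ i - x0 $ i\<bar> \<le> 1\<close>[of i] by linarith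
    qed
    then show False using that(2) by (simp add: q_def cube_def)
  qed
  have cxy: "continuous_on S (\<lambda>y. \<rho> (x - y))" "continuous_on S (\<lambda>y. G (x - y))" for x S
    by (intro continuous_on_compose2[OF c\<rho>] continuous_on_compose2[OF cG] continuous_intros; simp)+
  have cxy2: "continuous_on S (\<lambda>(x, y). G (x - y))" "continuous_on S (\<lambda>(x :: real^'n, y). f y)" for S
    unfolding case_prod_unfold by (intro continuous_on_compose2[OF cG] continuous_on_compose2[OF f] continuous_intros; simp)+
  have cf: "continuous_on S f" for S by (rule continuous_on_subset[OF f]) simp
  have int1: "moll \<rho> f x = integral (q x0) (\<lambda>y. \<rho> (x - y) * f y)" if "x \<in> ball x0 1" for x x0
    unfolding moll_def q
    by (rule lborel_integral_eq_cbox) (use outside[OF that] \<rho>0 in \<open>auto simp: q intro!: continuous_intros cxy cf\<close>)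
  have int2: "(\<integral>y. f y * partial_deriv i \<rho> (x - y) \<partial>lborel) = integral (q x0) (\<lambda>y. f y * G (x - y) $ i)"
    if "x \<in> ball x0 1" for x x0 i
  proof -
    have "(\<integral>y. f y * G (x - y) $ i \<partial>lborel) = integral (q x0) (\<lambda>y. f y * G (x - y) $ i)"
      unfolding q
      by (rule lborel_integral_eq_cbox) (use outside[OF that] G0 in \<open>auto simp: q intro!: continuous_intros cxy cf\<close>)
    then show ?thesis by (simp add: G_def)
  qed
  show "continuous_on UNIV (\<lambda>x. \<integral>y. f y * partial_deriv i \<rho> (x - y) \<partial>lborel)"
  proof (rule continuous_at_imp_continuous_on, rule ballI)
    fix x0
    have "continuous_on (ball x0 1) (\<lambda>x. integral (q x0) (\<lambda>y. f y * G (x - y) $ i))"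
      unfolding q by (rule integral_continuous_on_param) (use cxy2 in \<open>auto simp: case_prod_unfold intro!: continuous_intros\<close>)
    then have "continuous_on (ball x0 1) (\<lambda>x. \<integral>y. f y * partial_deriv i \<rho> (x - y) \<partial>lborel)"
      by (rule continuous_on_eq) (simp add: int2)
    then show "isCont (\<lambda>x. \<integral>y. f y * partial_deriv i \<rho> (x - y) \<partial>lborel) x0"
      by (simp add: continuous_on_eq_continuous_at)
  qed
  have "((\<lambda>x. integral (q x0) (\<lambda>y. \<rho> (x - y) * f y)) has_derivative
      integral (q x0) (\<lambda>y. blinfun_inner_left (f y *\<^sub>R G (x0 - y)))) (at x0 within ball x0 1)" for x0
    unfolding q
  proof (rule leibniz_rule)
    fix x y
    show "((\<lambda>x. \<rho> (x - y) * f y) has_derivative blinfun_apply (blinfun_inner_left (f y *\<^sub>R G (x - y)))) (at x within ball x0 1)"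
    proof -
      have "((\<lambda>x. \<rho> (x - y)) has_derivative (\<lambda>h. G (x - y) \<bullet> h)) (at x within ball x0 1)"
        by (rule has_derivative_compose[OF _ d\<rho>[of _ UNIV, simplified], where f = "\<lambda>x. x - y"]) (auto intro!: derivative_eq_intros)
      from has_derivative_mult_left[OF this, of "f y"] show ?thesis
        by (simp add: inner_commute mult.commute)
    qed
    show "(\<lambda>y. \<rho> (x - y) * f y) integrable_on cbox (x0 - vec (\<epsilon> + 1)) (x0 + vec (\<epsilon> + 1))"
      by (intro integrable_continuous continuous_intros cxy cf)
  next
    show "continuous_on (ball x0 1 \<times> cbox (x0 - vec (\<epsilon> + 1)) (x0 + vec (\<epsilon> + 1)))
      (\<lambda>(x, y). blinfun_inner_left (f y *\<^sub>R G (x - y)))"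
      using cxy2 unfolding case_prod_unfold
      by (intro bounded_linear.continuous_on[OF bounded_linear_blinfun_inner_left] continuous_intros)
  qed auto
  moreover have int: "(\<lambda>y. f y *\<^sub>R G (x0 - y)) integrable_on q x0" for x0
    unfolding q by (intro integrable_continuous continuous_intros cxy cf)
  have "integral (q x0) (\<lambda>y. blinfun_inner_left (f y *\<^sub>R G (x0 - y))) =
      blinfun_inner_left (integral (q x0) (\<lambda>y. f y *\<^sub>R G (x0 - y)))" for x0
    using integral_linear[OF int bounded_linear_blinfun_inner_left] by (simp add: o_def)
  moreover have "integral (q x0) (\<lambda>y. f y *\<^sub>R G (x0 - y)) $ i = integral (q x0) (\<lambda>y. f y * G (x0 - y) $ i)" for x0 i
    using integral_linear[OF int bounded_linear_vec_nth, of x0 i] by (simp add: o_def)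
  ultimately have "((\<lambda>x. integral (q x0) (\<lambda>y. \<rho> (x - y) * f y)) has_derivative
      (\<lambda>h. \<Sum>i\<in>UNIV. (\<integral>y. f y * partial_deriv i \<rho> (x0 - y) \<partial>lborel) * h $ i)) (at x0 within ball x0 1)" for x0
    by (simp add: inner_vec_def int2[of x0 x0] mult.commute)
  then have "((\<lambda>x. integral (q x0) (\<lambda>y. \<rho> (x - y) * f y)) has_derivative
      (\<lambda>h. \<Sum>i\<in>UNIV. (\<integral>y. f y * partial_deriv i \<rho> (x0 - y) \<partial>lborel) * h $ i)) (at x0)" for x0
    by (metis (no_types, lifting) at_within_open centre_in_ball open_ball zero_less_one)
  then show "(moll \<rho> f has_derivative (\<lambda>h. \<Sum>i\<in>UNIV. (\<integral>y. f y * partial_deriv i \<rho> (x - y) \<partial>lborel) * h $ i)) (at x)"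
    by (rule has_derivative_transform_within_open[of _ _ _ _ "ball x 1"]) (auto simp: int1)
qed

text \<open>For the test function y \<mapsto> \<open>\<rho> (x - y)\<close> the chain rule brings in
  a minus sign, which cancels that of integration by parts. The Borel version \<open>v'\<close>
  stands in for \<open>v\<close> because \<open>moll\<close> integrates with respect to
  \<open>lborel\<close>.\<close>

lemma weak_partial_deriv_moll:
  fixes u v :: "real ^ 'n \<Rightarrow> real"
  assumes w: "weak_partial_deriv UNIV i u v" and u: "continuous_on UNIV u"
    and v: "v \<in> borel_measurable lebesgue"
    and v': "v' \<in> borel_measurable borel" "AE x in lborel. v x = v' x" and M: "mollifier \<epsilon> \<rho>"
  shows "(\<integral>y. u y * partial_deriv i \<rho> (x - y) \<partial>lborel) = moll \<rho> v' x"
proof -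
  have ck: "C_k 1 \<rho>" using M by (simp add: mollifier_def)
  note [measurable] = mollifierD(3)[OF M] v'(1)
  have [measurable]: "u \<in> borel_measurable borel" "partial_deriv i \<rho> \<in> borel_measurable borel"
    using u C_k_1_has_derivative(2)[OF ck] by (auto intro: borel_measurable_continuous_onI)
  have pd: "partial_deriv i (\<lambda>y. \<rho> (x - y)) y = - partial_deriv i \<rho> (x - y)" for y
  proof -
    have "((\<lambda>y. \<rho> (x - y)) has_derivative (\<lambda>h. \<Sum>k\<in>UNIV. partial_deriv k \<rho> (x - y) * (- h) $ k)) (at y)"
      by (rule has_derivative_compose[OF _ C_k_1_has_derivative(1)[OF ck], where f = "\<lambda>y. x - y"])
        (auto intro!: derivative_eq_intros)
    from partial_deriv_eq[OF this] show ?thesis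
      by (simp add: axis_def if_distrib[of "\<lambda>a. _ * a"] sum_negf cong: if_cong)
  qed
  have "test_function UNIV (\<lambda>y. \<rho> (x - y))" using M by (simp add: mollifier_def)
  with w have "(LINT y:UNIV|lebesgue. u y * partial_deriv i (\<lambda>y. \<rho> (x - y)) y) = - (LINT y:UNIV|lebesgue. v y * \<rho> (x - y))"
    by (simp add: weak_partial_deriv_def)
  moreover have "(LINT y:UNIV|lebesgue. u y * partial_deriv i (\<lambda>y. \<rho> (x - y)) y) = - (\<integral>y. u y * partial_deriv i \<rho> (x - y) \<partial>lborel)"
    unfolding pd by (simp add: set_lebesgue_integral_def integral_completion)
  moreover have "(LINT y:UNIV|lebesgue. v y * \<rho> (x - y)) = moll \<rho> v' x"
  proof -
    have "(LINT y:UNIV|lebesgue. v y * \<rho> (x - y)) = (\<integral>y. v' y * \<rho> (x - y) \<partial>lebesgue)"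
      unfolding set_lebesgue_integral_def
    proof (rule integral_cong_AE)
      have ae: "AE y in lebesgue. v y = v' y" using v'(2) by (rule AE_completion)
      then show "AE y in lebesgue. indicator UNIV y *\<^sub>R (v y * \<rho> (x - y)) = v' y * \<rho> (x - y)" by eventually_elim simp
      show m: "(\<lambda>y. v' y * \<rho> (x - y)) \<in> borel_measurable lebesgue" by (rule measurable_completion) measurable
      have "(\<lambda>y. \<rho> (x - y)) \<in> borel_measurable lebesgue" by (rule measurable_completion) measurable
      then show "(\<lambda>y. indicator UNIV y *\<^sub>R (v y * \<rho> (x - y))) \<in> borel_measurable lebesgue"
        using v by simp
    qed
    also have "\<dots> = (\<integral>y. v' y * \<rho> (x - y) \<partial>lborel)" by (rule integral_completion) measurable
    finally show ?thesis by (simp add: moll_def mult.commute)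
  qed
  ultimately show ?thesis by simp
qed

section \<open>Energy decay\<close>

text \<open>The weak derivative, tested only against translates of mollifiers.\<close>

definition has_moll_deriv :: "(real ^ 'n::finite \<Rightarrow> real ^ 'n) \<Rightarrow> (real ^ 'n \<Rightarrow> real ^ 'n ^ 'n) \<Rightarrow> bool" where
  "has_moll_deriv f G \<longleftrightarrow> continuous_on UNIV f \<and>
     (\<forall>j i. Lp_bounded CARD('n) (\<lambda>x. G x $ j $ i)) \<and>
     (\<forall>j i \<epsilon> \<rho> x. mollifier \<epsilon> \<rho> \<longrightarrow>
        (\<integral>y. f y $ j * partial_deriv i \<rho> (x - y) \<partial>lborel) = moll \<rho> (\<lambda>y. G y $ j $ i) x)"

section \<open>From local Sobolev classes to smooth approximations\<close>

text \<open>\<open>Lp_loc\<close> speaks of compact sets only; measurability on the whole space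
  comes from exhausting it by cubes.\<close>

lemma Lp_loc_measurable:
  fixes v :: "real ^ 'n \<Rightarrow> real"
  assumes "Lp_loc p UNIV v"
  shows "v \<in> borel_measurable lebesgue"
proof (rule borel_measurable_LIMSEQ_real)
  show "(\<lambda>x. indicator (cube 0 (real k)) x *\<^sub>R v x) \<in> borel_measurable lebesgue" for k
    using assms by (simp add: Lp_loc_def set_borel_measurable_def del: real_scaleR_def)
  fix x :: "real ^ 'n"
  obtain N :: nat where N: "norm x \<le> real N" using real_arch_simple by blast
  have "x \<in> cube 0 (real k)" if "k \<ge> N" for k
  proof -
    have "\<bar>x $ i\<bar> \<le> real k" for i using component_le_norm_cart[of x i] N that by linarith
    then show ?thesis by (simp add: cube_def)
  qed
  then have "\<forall>\<^sub>F k in sequentially. indicator (cube 0 (real k)) x *\<^sub>R v x = v x"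
    unfolding eventually_sequentially by (intro exI[of _ N]) auto
  then show "(\<lambda>k. indicator (cube 0 (real k)) x *\<^sub>R v x) \<longlonglongrightarrow> v x" by (rule tendsto_eventually)
qed

lemma Lp_bounded_if_Lp_loc:
  fixes w :: "real ^ 'n \<Rightarrow> 'b::euclidean_space" and v :: "real ^ 'n \<Rightarrow> real"
  assumes w: "Lp_loc (real p) UNIV w" and v[measurable]: "v \<in> borel_measurable borel"
    and le: "AE x in lborel. \<bar>v x\<bar> \<le> norm (w x)" and p: "p \<ge> 1"
  shows "Lp_bounded p v"
proof -
  have "(\<integral>\<^sup>+x\<in>cube q r. ennreal (\<bar>v x\<bar> ^ p) \<partial>lborel) < top" for q r
  proof -
    have "integrable lebesgue (\<lambda>x. indicator (cube q r) x *\<^sub>R (norm (w x) powr real p))"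
      using w by (simp add: Lp_loc_def set_integrable_def)
    then have fin: "(\<integral>\<^sup>+x. ennreal (norm (indicator (cube q r) x *\<^sub>R (norm (w x) powr real p))) \<partial>lebesgue) < top"
      by (simp add: integrable_iff_bounded)
    have "(\<integral>\<^sup>+x\<in>cube q r. ennreal (\<bar>v x\<bar> ^ p) \<partial>lborel) = (\<integral>\<^sup>+x\<in>cube q r. ennreal (\<bar>v x\<bar> ^ p) \<partial>lebesgue)"
      by (rule nn_integral_completion[symmetric])
    also have "\<dots> \<le> (\<integral>\<^sup>+x. ennreal (norm (indicator (cube q r) x *\<^sub>R (norm (w x) powr real p))) \<partial>lebesgue)"
    proof (rule nn_integral_mono_AE)
      show "AE x in lebesgue. ennreal (\<bar>v x\<bar> ^ p) * indicator (cube q r) x \<le>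
          ennreal (norm (indicator (cube q r) x *\<^sub>R (norm (w x) powr real p)))"
        using AE_completion[OF le]
      proof eventually_elim
        case (elim x)
        have "\<bar>v x\<bar> ^ p \<le> norm (w x) ^ p" using elim by (intro power_mono) auto
        also have "\<dots> = norm (w x) powr real p"
          \<comment> \<open>Where w vanishes both sides are 0, as \<open>0 powr real p = 0\<close>
            and p \<ge> 1.\<close>
          using p by (cases "w x = 0") (auto simp: powr_realpow)
        finally show ?case by (auto simp: indicator_def ennreal_leI)
      qed
    qed
    finally show ?thesis using fin by (rule le_less_trans)
  qed
  then show ?thesis by (simp add: Lp_bounded_def)
qed

lemma norm_matrix_le_sum: "norm (A :: real ^ 'n ^ 'm) \<le> (\<Sum>(j, i)\<in>UNIV. \<bar>A $ j $ i\<bar>)"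
proof -
  have "norm A \<le> (\<Sum>j\<in>UNIV. norm (A $ j))" unfolding norm_vec_def by (rule L2_set_le_sum) simp
  also have "\<dots> \<le> (\<Sum>j\<in>UNIV. \<Sum>i\<in>UNIV. \<bar>A $ j $ i\<bar>)" by (intro sum_mono norm_le_l1_cart)
  also have "\<dots> = (\<Sum>(j, i)\<in>UNIV. \<bar>A $ j $ i\<bar>)" by (simp add: sum.cartesian_product)
  finally show ?thesis .
qed

lemma sum_power_le:
  fixes c :: "'i \<Rightarrow> real"
  assumes "finite I" "\<And>a. a \<in> I \<Longrightarrow> c a \<ge> 0" and n1: "n \<ge> 1"
  shows "(\<Sum>a\<in>I. c a) ^ n \<le> real (card I) ^ n * (\<Sum>a\<in>I. c a ^ n)"
proof (cases "I = {}")
  case True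
  then show ?thesis using n1 by (simp add: power_0_left)
next
  case False
  define m where "m = Max (c ` I)"
  have "m \<in> c ` I" unfolding m_def using assms(1) False by (intro Max_in) auto
  then obtain b where b: "b \<in> I" "m = c b" by auto
  have "(\<Sum>a\<in>I. c a) \<le> (\<Sum>a\<in>I. m)" unfolding m_def using assms(1) by (intro sum_mono Max_ge) auto
  then have "(\<Sum>a\<in>I. c a) ^ n \<le> (real (card I) * m) ^ n"
    using assms by (intro power_mono sum_nonneg) auto
  also have "\<dots> = real (card I) ^ n * c b ^ n" unfolding b(2) by (rule power_mult_distrib)
  also have "c b ^ n \<le> (\<Sum>a\<in>I. c a ^ n)" using assms b by (intro member_le_sum) auto
  finally show ?thesis by (simp add: mult_left_mono)
qed

lemma nn_integral_norm_matrix_power_le: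
  fixes M :: "real ^ 'k::finite \<Rightarrow> real ^ 'n ^ 'm"
  assumes [measurable]: "\<And>j i. (\<lambda>x. M x $ j $ i) \<in> borel_measurable borel" "S \<in> sets borel" and n1: "n \<ge> 1"
  shows "(\<integral>\<^sup>+x\<in>S. ennreal (norm (M x) ^ n) \<partial>lborel) \<le> ennreal (real CARD('m \<times> 'n) ^ n) *
    (\<Sum>a\<in>UNIV. \<integral>\<^sup>+x\<in>S. ennreal (\<bar>M x $ fst a $ snd a\<bar> ^ n) \<partial>lborel)"
proof -
  define c where "c = real CARD('m \<times> 'n) ^ n"
  have "norm (M x) ^ n \<le> c * (\<Sum>a\<in>UNIV. \<bar>M x $ fst a $ snd a\<bar> ^ n)" for x
  proof -
    have "norm (M x) ^ n \<le> (\<Sum>a\<in>UNIV. \<bar>M x $ fst a $ snd a\<bar>) ^ n"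
      using norm_matrix_le_sum[of "M x"] by (intro power_mono) (auto simp: case_prod_unfold)
    also have "\<dots> \<le> c * (\<Sum>a\<in>UNIV. \<bar>M x $ fst a $ snd a\<bar> ^ n)"
      unfolding c_def using n1 by (intro sum_power_le) auto
    finally show ?thesis .
  qed
  then have "ennreal (norm (M x) ^ n) \<le> ennreal c * (\<Sum>a\<in>UNIV. ennreal (\<bar>M x $ fst a $ snd a\<bar> ^ n))" for x
    by (simp add: ennreal_mult[symmetric] sum_nonneg c_def ennreal_leI)
  then have "(\<integral>\<^sup>+x\<in>S. ennreal (norm (M x) ^ n) \<partial>lborel) \<le>
      (\<integral>\<^sup>+x. ennreal c * (\<Sum>a\<in>UNIV. ennreal (\<bar>M x $ fst a $ snd a\<bar> ^ n) * indicator S x) \<partial>lborel)"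
    by (intro nn_integral_mono) (auto simp: indicator_def)
  also have "\<dots> = ennreal c * (\<Sum>a\<in>UNIV. \<integral>\<^sup>+x\<in>S. ennreal (\<bar>M x $ fst a $ snd a\<bar> ^ n) \<partial>lborel)"
    by (subst nn_integral_cmult, measurable) (subst nn_integral_sum, measurable)
  finally show ?thesis by (simp only: c_def)
qed

lemma continuous_imp_moll_tendsto:
  assumes "continuous_on UNIV h" and M: "\<And>k. mollifier (\<epsilon> k) (\<rho> k)" and \<epsilon>: "\<epsilon> \<longlonglongrightarrow> 0"
  shows "(\<lambda>k. moll (\<rho> k) h x) \<longlonglongrightarrow> h x"
proof (rule tendstoI)
  fix e :: real assume e: "e > 0"
  obtain d where d: "d > 0" "\<And>\<epsilon> \<rho> y. mollifier \<epsilon> \<rho> \<Longrightarrow> \<epsilon> \<le> d \<Longrightarrow> y \<in> cube x 0 \<Longrightarrow> \<bar>moll \<rho> h y - h y\<bar> \<le> e / 2"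
    using moll_uniform_limit[OF assms(1), of "e / 2" x 0] e by auto
  have "\<forall>\<^sub>F k in sequentially. \<epsilon> k < d" using d(1) by (intro order_tendstoD(2)[OF \<epsilon>])
  then show "\<forall>\<^sub>F k in sequentially. dist (moll (\<rho> k) h x) (h x) < e"
  proof eventually_elim
    case (elim k)
    then have "\<bar>moll (\<rho> k) h x - h x\<bar> \<le> e / 2" using d(2)[OF M[of k], of x] by (simp add: cube_def)
    then show ?case using e by (simp add: dist_real_def)
  qed
qed

lemma mollifier_sequence: "\<exists>\<rho>. \<forall>k. mollifier (1 / real (Suc k)) (\<rho> k :: real ^ 'n::finite \<Rightarrow> real)"
  by (intro choice allI mollifier_exists) simp

text \<open>By \<open>has_moll_deriv\<close> the derivative of the mollified \<open>f\<close> is the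
  mollification of \<open>G\<close>, which converges to \<open>G\<close> in L^n on cubes.\<close>

lemma moll_deriv_approx:
  fixes f :: "real ^ 'n \<Rightarrow> real ^ 'n"
  assumes fG: "has_moll_deriv f G" and n: "n = CARD('n)"
  shows "\<exists>u Du. (\<forall>k. C1_map (u k) (Du k)) \<and> (\<forall>x. (\<lambda>k. u k x) \<longlonglongrightarrow> f x) \<and>
    (\<forall>q r. (\<lambda>k. \<integral>\<^sup>+x\<in>cube q r. ennreal (norm (Du k x - G x) ^ n) \<partial>lborel) \<longlonglongrightarrow> 0)"
proof -
  have n1: "n \<ge> 1" by (simp add: n Suc_leI)
  obtain \<rho> :: "nat \<Rightarrow> real ^ 'n \<Rightarrow> real" where \<rho>: "\<And>k. mollifier (1 / real (Suc k)) (\<rho> k)"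
    using mollifier_sequence by blast
  have lim: "(\<lambda>k. 1 / real (Suc k)) \<longlonglongrightarrow> 0"
    by (rule LIMSEQ_Suc[OF lim_1_over_n])
  have cf: "continuous_on UNIV (\<lambda>x. f x $ j)" for j
    using fG by (auto simp: has_moll_deriv_def intro: continuous_intros)
  have Lp: "Lp_bounded n (\<lambda>x. G x $ j $ i)" for j i
    using fG by (simp add: has_moll_deriv_def n)
  have mG[measurable]: "(\<lambda>x. G x $ j $ i) \<in> borel_measurable borel" for j i
    using Lp[of j i] by (simp add: Lp_bounded_def)
  have eq: "(\<integral>y. f y $ j * partial_deriv i (\<rho> k) (x - y) \<partial>lborel) = moll (\<rho> k) (\<lambda>y. G y $ j $ i) x" for i j k x
    using fG \<rho>[of k] unfolding has_moll_deriv_def by blast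
  define u where "u k x = (\<chi> j. moll (\<rho> k) (\<lambda>y. f y $ j) x)" for k x
  define Du where "Du k x = (\<chi> j i. moll (\<rho> k) (\<lambda>y. G y $ j $ i) x)" for k x
  have C1: "C1_map (u k) (Du k)" for k
    unfolding C1_map_def
  proof (intro conjI allI)
    fix x
    have "((\<lambda>x. u k x $ j) has_derivative (\<lambda>h. (Du k x *v h) $ j)) (at x)" for j
      using moll_has_derivative(1)[OF \<rho>[of k] cf[of j], of x]
      by (simp add: u_def Du_def matrix_vector_mult_def eq)
    then show "(u k has_derivative (\<lambda>h. Du k x *v h)) (at x)"
      by (subst has_derivative_componentwise_within) (auto simp: Basis_vec_def inner_axis)
    show "continuous_on UNIV (Du k)"
      unfolding Du_def using moll_has_derivative(2)[OF \<rho>[of k] cf]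
      by (intro continuous_intros) (simp add: eq)
  qed
  moreover have "(\<lambda>k. u k x) \<longlonglongrightarrow> f x" for x
    by (rule vec_tendstoI) (simp add: u_def continuous_imp_moll_tendsto[OF cf \<rho> lim])
  moreover have "(\<lambda>k. \<integral>\<^sup>+x\<in>cube q r. ennreal (norm (Du k x - G x) ^ n) \<partial>lborel) \<longlonglongrightarrow> 0" for q r
  proof -
    let ?I = "\<lambda>k a. \<integral>\<^sup>+x\<in>cube q r. ennreal (\<bar>moll (\<rho> k) (\<lambda>y. G y $ fst a $ snd a) x - G x $ fst a $ snd a\<bar> ^ n) \<partial>lborel"
    define c where "c = real (CARD('n \<times> 'n)) ^ n"
    have le: "(\<integral>\<^sup>+x\<in>cube q r. ennreal (norm (Du k x - G x) ^ n) \<partial>lborel) \<le> ennreal c * (\<Sum>a\<in>UNIV. ?I k a)" for k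
    proof -
      have [measurable]: "moll (\<rho> k) (\<lambda>y. G y $ j $ i) \<in> borel_measurable borel" for j i
        by (rule moll_measurable[OF \<rho>]) measurable
      show ?thesis
        using nn_integral_norm_matrix_power_le[of "\<lambda>x. Du k x - G x" "cube q r" n] n1 by (simp add: Du_def c_def)
    qed
    have "(\<lambda>k. ennreal c * (\<Sum>a\<in>UNIV. ?I k a)) \<longlonglongrightarrow> ennreal c * (\<Sum>a\<in>(UNIV :: ('n \<times> 'n) set). 0)"
      by (intro ennreal_tendsto_cmult tendsto_sum moll_tendsto_Lp[OF Lp n1 \<rho> lim]) simp
    then have L: "(\<lambda>k. ennreal c * (\<Sum>a\<in>UNIV. ?I k a)) \<longlonglongrightarrow> 0" by simp
    show ?thesis
      by (rule tendsto_sandwich[OF _ _ tendsto_const L]) (intro always_eventually allI zero_le le)+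
  qed
  ultimately show ?thesis by (intro exI[of _ u] exI[of _ Du] conjI allI)
qed

section \<open>Passage to the limit in the hole filling inequality\<close>

text \<open>A Young inequality with a small parameter: the term with \<alpha> will be absorbed into
  the left side of the energy estimate, while the term with \<beta> tends to 0 along the
  approximation.\<close>

lemma abs_det_diff_le_eps:
  assumes "\<alpha> > 0"
  shows "\<exists>\<beta>\<ge>0. \<forall>A B :: real ^ 'n ^ 'n. \<bar>det A - det B\<bar> \<le> \<alpha> * norm A ^ CARD('n) + \<beta> * norm (A - B) ^ CARD('n)"
proof -
  define n where "n = CARD('n)"
  have n1: "n \<ge> 1" by (simp add: n_def Suc_leI)
  define c where "c = fact n * real n"
  have c: "c > 0" using n1 by (simp add: c_def)
  \<comment> \<open>Chosen so that c 4^n \<tau> = \<alpha>, where 4^n comes from bounding (norm A +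
    norm B)^n.\<close>
  define \<tau> where "\<tau> = \<alpha> / (c * 4 ^ n)"
  have \<tau>: "\<tau> > 0" using assms c by (simp add: \<tau>_def)
  define \<beta> where "\<beta> = c * (\<tau> * 2 ^ n + (1 / \<tau>) ^ (n - 1))"
  have "\<beta> \<ge> 0" using c \<tau> by (simp add: \<beta>_def)
  moreover have "\<bar>det A - det B\<bar> \<le> \<alpha> * norm A ^ n + \<beta> * norm (A - B) ^ n" for A B :: "real ^ 'n ^ 'n"
  proof -
    define a b where "a = norm (A - B)" and "b = norm A + norm B"
    have ab: "a \<ge> 0" "b \<ge> 0" by (auto simp: a_def b_def)
    have pw: "x * x ^ (n - 1) = x ^ n" for x :: real using n1 by (cases n) auto
    have "a * b ^ (n - 1) \<le> \<tau> * b ^ n + (1 / \<tau>) ^ (n - 1) * a ^ n"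
    \<comment> \<open>In place of Young's inequality: either a is at most \<tau> b, or b is at most
      a / \<tau>, and the smaller quantity is replaced accordingly.\<close>
    proof (cases "a \<le> \<tau> * b")
      case True
      then have "a * b ^ (n - 1) \<le> \<tau> * b * b ^ (n - 1)" using ab by (intro mult_right_mono) auto
      also have "\<dots> = \<tau> * b ^ n" by (simp only: mult.assoc pw)
      finally show ?thesis using ab \<tau> by (simp add: add_increasing2)
    next
      case False
      then have "b \<le> 1 / \<tau> * a" using \<tau> by (simp add: field_simps)
      then have "a * b ^ (n - 1) \<le> a * (1 / \<tau> * a) ^ (n - 1)" using ab by (intro mult_left_mono power_mono) auto
      also have "\<dots> = (1 / \<tau>) ^ (n - 1) * a ^ n" unfolding power_mult_distrib pw[symmetric, of a] by (simp only: mult_ac)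
      finally show ?thesis using ab \<tau> by (simp add: add_increasing)
    qed
    moreover have "b ^ n \<le> 4 ^ n * norm A ^ n + 2 ^ n * a ^ n"
    proof -
      have "norm B \<le> norm A + a" using norm_triangle_ineq[of A "B - A"] by (simp add: a_def norm_minus_commute)
      then have "b ^ n \<le> (2 * norm A + a) ^ n" using ab by (intro power_mono) (auto simp: b_def)
      also have "\<dots> \<le> 2 ^ n * ((2 * norm A) ^ n + a ^ n)" using ab by (intro power_add_le) auto
      also have "\<dots> = (2 * 2) ^ n * norm A ^ n + 2 ^ n * a ^ n"
        unfolding power_mult_distrib by (simp only: distrib_left mult.assoc)
      finally show ?thesis by simp
    qed
    ultimately have "a * b ^ (n - 1) \<le> \<tau> * (4 ^ n * norm A ^ n + 2 ^ n * a ^ n) + (1 / \<tau>) ^ (n - 1) * a ^ n"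
      using \<tau> by (smt (verit) mult_left_mono)
    then have "c * (a * b ^ (n - 1)) \<le> c * (\<tau> * (4 ^ n * norm A ^ n + 2 ^ n * a ^ n) + (1 / \<tau>) ^ (n - 1) * a ^ n)"
      using c by (intro mult_left_mono) auto
    also have "\<dots> = (c * 4 ^ n * \<tau>) * norm A ^ n + \<beta> * a ^ n" by (simp add: \<beta>_def algebra_simps)
    also have "c * 4 ^ n * \<tau> = \<alpha>" using c by (simp add: \<tau>_def)
    finally have "c * (a * b ^ (n - 1)) \<le> \<alpha> * norm A ^ n + \<beta> * a ^ n" .
    moreover have "\<bar>det A - det B\<bar> \<le> c * (a * b ^ (n - 1))"
      using abs_det_diff_le[of A b B] by (simp add: c_def n_def a_def b_def mult.assoc)
    ultimately show ?thesis by (simp add: a_def)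
  qed
  ultimately show ?thesis unfolding n_def by blast
qed

lemma ennreal_add_le: "b \<ge> 0 \<Longrightarrow> ennreal (a + b) \<le> ennreal a + ennreal b"
  by (cases "a \<ge> 0") (auto simp: ennreal_plus ennreal_neg intro!: ennreal_leI)

text \<open>Used with g the Jacobian det G and w the Jacobian of a smooth approximation, to which
  hole filling applies. If the integral of \<open>w\<close> is negative, \<open>ennreal\<close>
  replaces it by 0, which only weakens the bound.\<close>

lemma nn_integral_le_via_approx:
  fixes g w :: "'a::euclidean_space \<Rightarrow> real"
  assumes g: "set_integrable lborel S g" and w: "set_integrable lborel S w"
    and pos: "AE x in lborel. x \<in> S \<longrightarrow> g x \<ge> 0"
  shows "(\<integral>\<^sup>+x\<in>S. ennreal (g x) \<partial>lborel) \<le> ennreal (LINT x:S|lborel. w x) + (\<integral>\<^sup>+x\<in>S. ennreal \<bar>g x - w x\<bar> \<partial>lborel)"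
proof -
  have d: "set_integrable lborel S (\<lambda>x. g x - w x)" using g w by (rule set_integral_diff)
  have ad: "set_integrable lborel S (\<lambda>x. \<bar>g x - w x\<bar>)" using set_integrable_abs[OF d] .
  have "(\<integral>\<^sup>+x\<in>S. ennreal (g x) \<partial>lborel) = (\<integral>\<^sup>+x. ennreal (indicator S x *\<^sub>R g x) \<partial>lborel)"
    by (intro nn_integral_cong) (auto simp: indicator_def)
  also have "\<dots> = ennreal (LINT x:S|lborel. g x)"
    unfolding set_lebesgue_integral_def
    using g pos by (intro nn_integral_eq_integral) (auto simp: set_integrable_def indicator_def)
  also have "(LINT x:S|lborel. g x) = (LINT x:S|lborel. w x) + (LINT x:S|lborel. g x - w x)"
    using g w by (simp add: set_integral_diff)
  also have "ennreal \<dots> \<le> ennreal ((LINT x:S|lborel. w x) + (LINT x:S|lborel. \<bar>g x - w x\<bar>))"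
    using d ad by (intro ennreal_leI add_left_mono set_integral_mono) auto
  also have "\<dots> \<le> ennreal (LINT x:S|lborel. w x) + ennreal (LINT x:S|lborel. \<bar>g x - w x\<bar>)"
    by (intro ennreal_add_le) (auto simp: set_lebesgue_integral_def intro!: Bochner_Integration.integral_nonneg)
  also have "ennreal (LINT x:S|lborel. \<bar>g x - w x\<bar>) = (\<integral>\<^sup>+x. ennreal (indicator S x *\<^sub>R \<bar>g x - w x\<bar>) \<partial>lborel)"
    unfolding set_lebesgue_integral_def
    using ad by (intro nn_integral_eq_integral[symmetric]) (auto simp: set_integrable_def)
  also have "\<dots> = (\<integral>\<^sup>+x\<in>S. ennreal \<bar>g x - w x\<bar> \<partial>lborel)"
    by (intro nn_integral_cong) (auto simp: indicator_def)
  finally show ?thesis .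
qed


definition deriv_energy :: "(real ^ 'n::finite \<Rightarrow> real ^ 'n ^ 'n) \<Rightarrow> (real ^ 'n) set \<Rightarrow> ennreal" where
  "deriv_energy G S = (\<integral>\<^sup>+x\<in>S. ennreal (norm (G x) ^ CARD('n)) \<partial>lborel)"

lemma deriv_energy_mono: "S \<subseteq> T \<Longrightarrow> deriv_energy G S \<le> deriv_energy G T"
  unfolding deriv_energy_def by (intro nn_integral_mono mult_left_mono) (auto simp: indicator_def)

lemma matrix_borel_measurable:
  fixes G :: "real ^ 'n::finite \<Rightarrow> real ^ 'n ^ 'n"
  assumes "\<And>j i. (\<lambda>x. G x $ j $ i) \<in> borel_measurable borel"
  shows "G \<in> borel_measurable borel"
proof (rule borel_measurable_euclidean_space[THEN iffD2], rule ballI)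
  fix b :: "real ^ 'n ^ 'n" assume "b \<in> Basis"
  then obtain j i where "b = axis j (axis i 1)" by (auto simp: Basis_vec_def)
  then show "(\<lambda>x. G x \<bullet> b) \<in> borel_measurable borel" using assms by (simp add: inner_axis)
qed

lemma borel_measurable_det [measurable (raw)]:
  fixes F :: "'a \<Rightarrow> real ^ 'n ^ 'n"
  assumes "F \<in> borel_measurable M"
  shows "(\<lambda>x. det (F x)) \<in> borel_measurable M"
  by (rule borel_measurable_continuous_on[OF continuous_on_det[OF continuous_on_id] assms])

lemma has_moll_deriv_measurable:
  assumes "has_moll_deriv f G"
  shows "f \<in> borel_measurable borel" "G \<in> borel_measurable borel"
proof -
  show "f \<in> borel_measurable borel"
    using assms by (intro borel_measurable_continuous_onI) (simp add: has_moll_deriv_def)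
  show "G \<in> borel_measurable borel"
    using assms by (intro matrix_borel_measurable) (simp add: has_moll_deriv_def Lp_bounded_def)
qed

lemma deriv_energy_finite:
  fixes G :: "real ^ 'n::finite \<Rightarrow> real ^ 'n ^ 'n"
  assumes fG: "has_moll_deriv f G"
  shows "deriv_energy G (cube q r) < top"
proof -
  let ?n = "CARD('n)"
  have [measurable]: "(\<lambda>x. G x $ j $ i) \<in> borel_measurable borel" for j i
    using fG by (simp add: has_moll_deriv_def Lp_bounded_def)
  have "deriv_energy G (cube q r) \<le> ennreal (real CARD('n \<times> 'n) ^ ?n) *
      (\<Sum>a\<in>UNIV. \<integral>\<^sup>+x\<in>cube q r. ennreal (\<bar>G x $ fst a $ snd a\<bar> ^ ?n) \<partial>lborel)"
    unfolding deriv_energy_def by (intro nn_integral_norm_matrix_power_le) (auto simp: Suc_leI)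
  also have "\<dots> < top"
    using fG by (auto simp: has_moll_deriv_def Lp_bounded_def ennreal_mult_less_top)
  finally show ?thesis .
qed

lemma det_set_integrable:
  fixes G :: "real ^ 'n::finite \<Rightarrow> real ^ 'n ^ 'n"
  assumes fG: "has_moll_deriv f G"
  shows "set_integrable lborel (cube q r) (\<lambda>x. det (G x))"
proof -
  let ?n = "CARD('n)"
  note [measurable] = has_moll_deriv_measurable[OF fG]
  have [measurable]: "(\<lambda>x. G x $ j $ i) \<in> borel_measurable borel" for j i
    using fG by (simp add: has_moll_deriv_def Lp_bounded_def)
  define c where "c = fact ?n * real ?n"
  have "(\<integral>\<^sup>+x. ennreal (norm (indicator (cube q r) x *\<^sub>R det (G x))) \<partial>lborel) \<le>
      (\<integral>\<^sup>+x. ennreal c * (ennreal (norm (G x) ^ ?n) * indicator (cube q r) x) \<partial>lborel)"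
  proof (rule nn_integral_mono)
    fix x
    have "\<bar>det (G x)\<bar> \<le> c * norm (G x) ^ ?n" using abs_det_le[of "G x"] by (simp add: c_def)
    then have "ennreal \<bar>det (G x)\<bar> \<le> ennreal c * ennreal (norm (G x) ^ ?n)"
      by (simp add: c_def ennreal_leI flip: ennreal_mult)
    then show "ennreal (norm (indicator (cube q r) x *\<^sub>R det (G x))) \<le> ennreal c * (ennreal (norm (G x) ^ ?n) * indicator (cube q r) x)"
      by (auto simp: indicator_def)
  qed
  also have "\<dots> = ennreal c * deriv_energy G (cube q r)"
    unfolding deriv_energy_def by (rule nn_integral_cmult) measurable
  also have "\<dots> < top" using deriv_energy_finite[OF fG] by (simp add: ennreal_mult_less_top)
  finally show ?thesis
    unfolding set_integrable_def integrable_iff_bounded det_def by simp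
qed

theorem deriv_energy_decay:
  fixes f :: "real ^ 'n \<Rightarrow> real ^ 'n"
  assumes fG: "has_moll_deriv f G" and n: "n = CARD('n)" and n2: "n \<ge> 2"
    and qc: "AE x in lborel. norm (G x) ^ n \<le> K * det (G x)" and K: "K > 0"
  shows "\<exists>\<kappa>>0. \<kappa> < 1 \<and> (\<forall>p r. r > 0 \<longrightarrow> deriv_energy G (cube p r) \<le> ennreal \<kappa> * deriv_energy G (cube p (2 * r)))"
proof -
  obtain C where C: "C > 0" and hole: "\<forall>(u :: real ^ 'n \<Rightarrow> real ^ 'n) Du p r. C1_map u Du \<and> r > 0 \<longrightarrow>
    ennreal (integral (cube p r) (\<lambda>x. det (Du x))) \<le>
      ennreal C * (\<integral>\<^sup>+x\<in>cube p (2 * r) - cube p r. ennreal (norm (Du x) ^ n) \<partial>lborel)"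
    by (rule exE[OF hole_filling_C1[OF n n2]], elim conjE, rule that)
  \<comment> \<open>With K \<alpha> = 1/2, half of the energy goes back to the left side.\<close>
  define \<alpha> where "\<alpha> = 1 / (2 * K)"
  have \<alpha>: "\<alpha> > 0" using K by (simp add: \<alpha>_def)
  obtain \<beta> where \<beta>: "\<beta> \<ge> 0" and det: "\<And>A B :: real ^ 'n ^ 'n. \<bar>det A - det B\<bar> \<le> \<alpha> * norm A ^ n + \<beta> * norm (A - B) ^ n"
    using abs_det_diff_le_eps[OF \<alpha>, where 'n = 'n] unfolding n by metis
  obtain u Du where approx: "\<forall>k. C1_map (u k) (Du k)" "\<forall>x. (\<lambda>k. u k x) \<longlonglongrightarrow> f x"
    "\<forall>q r. (\<lambda>k. \<integral>\<^sup>+x\<in>cube q r. ennreal (norm (Du k x - G x) ^ n) \<partial>lborel) \<longlonglongrightarrow> 0"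
    using moll_deriv_approx[OF fG n] by (elim exE conjE) (rule that)
  note C1 = approx(1)[rule_format] and pw = approx(2)[rule_format] and lim = approx(3)[rule_format]
  note [measurable] = has_moll_deriv_measurable[OF fG] C1_mapD(5)[OF C1]
  \<comment> \<open>Solves d \<le> K C 2^n a + (d + a) / 2 for d, the energy of the cube, in terms
    of a, that of the annulus; 2^n comes from separating \<open>Du k\<close> into \<open>G\<close>
    and an error.\<close>
  define B where "B = 2 * K * C * 2 ^ n + 1"
  have B: "B > 0" using K C by (simp add: B_def add_pos_pos)
  define \<kappa> where "\<kappa> = B / (1 + B)"
  have "\<kappa> > 0" "\<kappa> < 1" using B by (auto simp: \<kappa>_def)
  moreover have "deriv_energy G (cube p r) \<le> ennreal \<kappa> * deriv_energy G (cube p (2 * r))" if r: "r > 0" for p r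
  proof -
    define A where "A = cube p (2 * r) - cube p r"
    have [measurable]: "A \<in> sets borel" by (simp add: A_def)
    define \<Delta> where "\<Delta> k = (\<integral>\<^sup>+x\<in>cube p (2 * r). ennreal (norm (Du k x - G x) ^ n) \<partial>lborel)" for k
    have lim\<Delta>: "\<Delta> \<longlonglongrightarrow> 0" unfolding \<Delta>_def by (rule lim)
    have sub: "cube p r \<subseteq> cube p (2 * r)" "A \<subseteq> cube p (2 * r)" using r by (auto simp: A_def intro!: cube_mono)
    have sum: "deriv_energy G (cube p (2 * r)) = deriv_energy G (cube p r) + deriv_energy G A"
    proof -
      have "deriv_energy G (cube p (2 * r)) = (\<integral>\<^sup>+x. ennreal (norm (G x) ^ n) * indicator (cube p r) x + ennreal (norm (G x) ^ n) * indicator A x \<partial>lborel)"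
        unfolding deriv_energy_def n[symmetric] using sub by (intro nn_integral_cong) (auto simp: indicator_def A_def)
      also have "\<dots> = deriv_energy G (cube p r) + deriv_energy G A"
        unfolding deriv_energy_def n[symmetric] by (rule nn_integral_add) measurable
      finally show ?thesis .
    qed
    have fin: "deriv_energy G (cube p (2 * r)) < top" by (rule deriv_energy_finite[OF fG])
    \<comment> \<open>Absorption subtracts energies, so real values are needed.\<close>
    then have "deriv_energy G (cube p r) < top" "deriv_energy G A < top" unfolding sum by auto
    then obtain a d where d: "d \<ge> 0" "deriv_energy G (cube p r) = ennreal d" and a: "a \<ge> 0" "deriv_energy G A = ennreal a"
      by (metis ennreal_cases less_irrefl)
    have bound: "ennreal d \<le> ennreal K * (ennreal (C * 2 ^ n) * (ennreal a + \<Delta> k) + (ennreal (\<alpha> * (d + a)) + ennreal \<beta> * \<Delta> k))" for k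
    proof -
      have cDu: "continuous_on UNIV (\<lambda>x. det (Du k x))" by (intro continuous_on_det C1_mapD[OF C1])
      have intDu: "set_integrable lborel (cube p r) (\<lambda>x. det (Du k x))"
        unfolding set_integrable_def by (intro borel_integrable_compact continuous_on_subset[OF cDu]) auto
      have pos: "AE x in lborel. det (G x) \<ge> 0"
        using qc
      proof eventually_elim
        case (elim x)
        have "0 \<le> norm (G x) ^ n" by simp
        then have "0 \<le> K * det (G x)" using elim by linarith
        then show ?case using K by (simp add: zero_le_mult_iff)
      qed
      have "ennreal d = (\<integral>\<^sup>+x\<in>cube p r. ennreal (norm (G x) ^ n) \<partial>lborel)"
        using d by (simp add: deriv_energy_def n)
      also have "\<dots> \<le> (\<integral>\<^sup>+x. ennreal K * (ennreal (det (G x)) * indicator (cube p r) x) \<partial>lborel)"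
      proof (rule nn_integral_mono_AE)
        show "AE x in lborel. ennreal (norm (G x) ^ n) * indicator (cube p r) x \<le> ennreal K * (ennreal (det (G x)) * indicator (cube p r) x)"
          using qc pos
        proof eventually_elim
          case (elim x)
          then have "ennreal (norm (G x) ^ n) \<le> ennreal K * ennreal (det (G x))"
            using K by (simp add: ennreal_leI flip: ennreal_mult)
          then show ?case by (simp add: indicator_def)
        qed
      qed
      also have "\<dots> = ennreal K * (\<integral>\<^sup>+x\<in>cube p r. ennreal (det (G x)) \<partial>lborel)"
        by (rule nn_integral_cmult) measurable
      finally have e1: "ennreal d \<le> ennreal K * (\<integral>\<^sup>+x\<in>cube p r. ennreal (det (G x)) \<partial>lborel)" .
      have LINT_eq: "(LINT x:cube p r|lborel. det (Du k x)) = integral (cube p r) (\<lambda>x. det (Du k x))"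
        by (rule set_borel_integral_eq_integral[OF intDu])
      have e2: "(\<integral>\<^sup>+x\<in>cube p r. ennreal (det (G x)) \<partial>lborel) \<le>
          ennreal (LINT x:cube p r|lborel. det (Du k x)) + (\<integral>\<^sup>+x\<in>cube p r. ennreal \<bar>det (G x) - det (Du k x)\<bar> \<partial>lborel)"
        using pos by (intro nn_integral_le_via_approx det_set_integrable[OF fG] intDu) auto
      have e3: "ennreal (integral (cube p r) (\<lambda>x. det (Du k x))) \<le> ennreal C * (\<integral>\<^sup>+x\<in>A. ennreal (norm (Du k x) ^ n) \<partial>lborel)"
        unfolding A_def by (rule hole[rule_format, OF conjI[OF C1 r]])
      have e4: "(\<integral>\<^sup>+x\<in>A. ennreal (norm (Du k x) ^ n) \<partial>lborel) \<le> ennreal (2 ^ n) * (ennreal a + \<Delta> k)"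
      proof -
        have "(\<integral>\<^sup>+x\<in>A. ennreal (norm (Du k x) ^ n) \<partial>lborel) \<le>
          ennreal (2 ^ n) * (deriv_energy G A + (\<integral>\<^sup>+x\<in>A. ennreal (norm (Du k x - G x) ^ n) \<partial>lborel))"
          unfolding deriv_energy_def n[symmetric]
          by (rule nn_integral_power_add_le) (auto intro: norm_triangle_sub simp: add.commute)
        also have "\<dots> \<le> ennreal (2 ^ n) * (ennreal a + \<Delta> k)"
          unfolding a(2) \<Delta>_def using sub
          by (intro mult_left_mono add_left_mono nn_integral_mono) (auto simp: indicator_def)
        finally show ?thesis .
      qed
      have e5: "(\<integral>\<^sup>+x\<in>cube p r. ennreal \<bar>det (G x) - det (Du k x)\<bar> \<partial>lborel) \<le> ennreal (\<alpha> * (d + a)) + ennreal \<beta> * \<Delta> k"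
      proof -
        have "ennreal \<bar>det (G x) - det (Du k x)\<bar> \<le> ennreal \<alpha> * ennreal (norm (G x) ^ n) + ennreal \<beta> * ennreal (norm (Du k x - G x) ^ n)" for x
          using det[of "G x" "Du k x"] \<alpha> \<beta>
          by (simp add: ennreal_leI norm_minus_commute flip: ennreal_plus ennreal_mult)
        then have "(\<integral>\<^sup>+x\<in>cube p r. ennreal \<bar>det (G x) - det (Du k x)\<bar> \<partial>lborel) \<le>
          (\<integral>\<^sup>+x. ennreal \<alpha> * (ennreal (norm (G x) ^ n) * indicator (cube p (2 * r)) x) + ennreal \<beta> * (ennreal (norm (Du k x - G x) ^ n) * indicator (cube p (2 * r)) x) \<partial>lborel)"
          using sub by (intro nn_integral_mono) (auto simp: indicator_def)
        also have "\<dots> = ennreal \<alpha> * deriv_energy G (cube p (2 * r)) + ennreal \<beta> * \<Delta> k"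
          by (simp add: nn_integral_cmult nn_integral_add deriv_energy_def \<Delta>_def n)
        also have "ennreal \<alpha> * deriv_energy G (cube p (2 * r)) = ennreal (\<alpha> * (d + a))"
          using \<alpha> a d unfolding sum by (simp add: ennreal_mult)
        finally show ?thesis .
      qed
      have e6: "ennreal C * (\<integral>\<^sup>+x\<in>A. ennreal (norm (Du k x) ^ n) \<partial>lborel) \<le> ennreal (C * 2 ^ n) * (ennreal a + \<Delta> k)"
        using mult_left_mono[OF e4, of "ennreal C"] C by (simp only: ennreal_mult mult.assoc less_imp_le zero_le_power zero_le_numeral zero_le)
      have "(\<integral>\<^sup>+x\<in>cube p r. ennreal (det (G x)) \<partial>lborel) \<le> ennreal (C * 2 ^ n) * (ennreal a + \<Delta> k) + (ennreal (\<alpha> * (d + a)) + ennreal \<beta> * \<Delta> k)"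
        using e2 unfolding LINT_eq by (rule order_trans) (intro add_mono e5 order_trans[OF e3 e6])
      then show ?thesis by (intro order_trans[OF e1] mult_left_mono) auto
    qed
    \<comment> \<open>Only the right side of \<open>bound\<close> depends on k, so the approximation
      errors disappear in the limit.\<close>
    have "(\<lambda>k. ennreal K * (ennreal (C * 2 ^ n) * (ennreal a + \<Delta> k) + (ennreal (\<alpha> * (d + a)) + ennreal \<beta> * \<Delta> k))) \<longlonglongrightarrow>
        ennreal K * (ennreal (C * 2 ^ n) * (ennreal a + 0) + (ennreal (\<alpha> * (d + a)) + ennreal \<beta> * 0))"
      by (intro ennreal_tendsto_cmult tendsto_add tendsto_const lim\<Delta>) auto
    then have "ennreal d \<le> ennreal K * (ennreal (C * 2 ^ n) * (ennreal a + 0) + (ennreal (\<alpha> * (d + a)) + ennreal \<beta> * 0))"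
      by (rule LIMSEQ_le_const) (intro exI[of _ 0] allI impI bound)
    also have "\<dots> = ennreal (K * (C * 2 ^ n * a + \<alpha> * (d + a)))"
    proof -
      have "0 \<le> C * 2 ^ n" "0 \<le> a" "0 \<le> \<alpha> * (d + a)" "0 \<le> K" using K C \<alpha> a d by auto
      then show ?thesis
        by (simp only: add_0_right mult_zero_right ennreal_mult ennreal_plus mult_nonneg_nonneg add_nonneg_nonneg)
    qed
    finally have "d \<le> K * (C * 2 ^ n * a + \<alpha> * (d + a))"
      using K C \<alpha> a d by (subst (asm) ennreal_le_iff) auto
    also have "\<dots> = K * C * 2 ^ n * a + K * \<alpha> * (d + a)" by (simp add: algebra_simps)
    also have "K * \<alpha> = 1 / 2" using K by (simp add: \<alpha>_def)
    finally have le: "d \<le> K * C * 2 ^ n * a + 1 / 2 * (d + a)" .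
    have "y \<le> z + 1 / 2 * (y + x) \<Longrightarrow> y \<le> 2 * z + x" for x y z :: real by (simp add: field_simps)
    from this[OF le] have "d \<le> 2 * (K * C * 2 ^ n * a) + a" .
    also have "\<dots> = B * a" by (simp add: B_def algebra_simps)
    finally have "d \<le> B * a" .
    \<comment> \<open>Adding B d to both sides fills the hole: (1 + B) d \<le> B (d + a).\<close>
    then have "d \<le> \<kappa> * (d + a)" using B by (simp add: \<kappa>_def field_simps)
    then have "ennreal d \<le> ennreal (\<kappa> * (d + a))" by (rule ennreal_leI)
    also have "\<dots> = ennreal \<kappa> * ennreal (d + a)"
      using \<open>\<kappa> > 0\<close> a d by (intro ennreal_mult) auto
    finally have "ennreal d \<le> ennreal \<kappa> * ennreal (d + a)" .
    then show ?thesis unfolding sum using a d by simp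
  qed
  ultimately show ?thesis by blast
qed

text \<open>The convex case holds for the smooth approximations. Fatou's lemma, once for each
  variable, carries it over to \<open>f\<close>, for which their pointwise convergence is
  enough.\<close>

lemma double_osc_le_energy:
  fixes f :: "real ^ 'n \<Rightarrow> real ^ 'n"
  assumes fG: "has_moll_deriv f G" and n: "n = CARD('n)" and r: "r > 0"
  shows "double_osc n f (cube p r) (cube p r) \<le>
    ennreal ((4 * real n * r) ^ n * (2 * r) ^ n * 2 ^ n) * deriv_energy G (cube p r)"
proof -
  obtain u Du where approx: "\<forall>k. C1_map (u k) (Du k)" "\<forall>x. (\<lambda>k. u k x) \<longlonglongrightarrow> f x"
    "\<forall>q r. (\<lambda>k. \<integral>\<^sup>+x\<in>cube q r. ennreal (norm (Du k x - G x) ^ n) \<partial>lborel) \<longlonglongrightarrow> 0"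
    using moll_deriv_approx[OF fG n] by (elim exE conjE) (rule that)
  note C1 = approx(1)[rule_format] and pw = approx(2)[rule_format] and lim = approx(3)[rule_format]
  note [measurable] = has_moll_deriv_measurable[OF fG] C1_mapD(4,5)[OF C1]
  let ?Q = "cube p r"
  define \<Delta> where "\<Delta> k = (\<integral>\<^sup>+x\<in>?Q. ennreal (norm (Du k x - G x) ^ n) \<partial>lborel)" for k
  define c where "c = (4 * real n * r) ^ n * (2 * r) ^ n * 2 ^ n"
  have bound: "double_osc n (u k) ?Q ?Q \<le> ennreal c * (deriv_energy G ?Q + \<Delta> k)" for k
  proof -
    have diam: "norm (x - z) \<le> 2 * real n * r" if "x \<in> ?Q" "z \<in> ?Q" for x z
    proof -
      have "\<bar>(x - z) $ i\<bar> \<le> 2 * r" for i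
      proof -
        have "\<bar>x $ i - p $ i\<bar> \<le> r" "\<bar>z $ i - p $ i\<bar> \<le> r" using that by (auto simp: cube_def)
        then show ?thesis by simp
      qed
      from norm_le_card_times[of "x - z", OF this] show ?thesis by (simp add: n mult_ac)
    qed
    have e1: "double_osc n (u k) ?Q ?Q \<le> ennreal ((2 * (2 * real n * r)) ^ n) *
       (emeasure lborel ?Q * (\<integral>\<^sup>+x\<in>?Q. ennreal (norm (Du k x) ^ n) \<partial>lborel))"
      by (rule double_osc_le_convex[OF C1 cube_borel convex_cube diam n])
    have e2: "emeasure lborel ?Q = ennreal ((2 * r) ^ n)" using r by (simp add: emeasure_cube n)
    have e3: "(\<integral>\<^sup>+x\<in>?Q. ennreal (norm (Du k x) ^ n) \<partial>lborel) \<le> ennreal (2 ^ n) * (deriv_energy G ?Q + \<Delta> k)"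
      unfolding \<Delta>_def deriv_energy_def n[symmetric]
      by (rule nn_integral_power_add_le) (auto intro: norm_triangle_sub)
    have "double_osc n (u k) ?Q ?Q \<le> ennreal ((2 * (2 * real n * r)) ^ n) *
       (ennreal ((2 * r) ^ n) * (ennreal (2 ^ n) * (deriv_energy G ?Q + \<Delta> k)))"
      using e1 unfolding e2 by (rule order_trans) (intro mult_left_mono e3; simp)
    also have "\<dots> = ennreal c * (deriv_energy G ?Q + \<Delta> k)"
    proof -
      have "2 * (2 * real n * r) = 4 * real n * r" by simp
      moreover have "0 \<le> (4 * real n * r) ^ n" "0 \<le> (2 * r) ^ n" using r by auto
      ultimately show ?thesis
        unfolding c_def mult.assoc by (simp only: ennreal_mult mult_nonneg_nonneg zero_le_power zero_le_numeral mult.assoc)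
    qed
    finally show ?thesis .
  qed
  have "double_osc n f ?Q ?Q \<le> liminf (\<lambda>k. double_osc n (u k) ?Q ?Q)"
  proof -
    have L: "ennreal (norm (f x - f z) ^ n) * indicator ?Q z \<le>
        liminf (\<lambda>k. ennreal (norm (u k x - u k z) ^ n) * indicator ?Q z)" for x z
    proof -
      have "(\<lambda>k. ennreal (norm (u k x - u k z) ^ n)) \<longlonglongrightarrow> ennreal (norm (f x - f z) ^ n)"
        by (intro tendsto_ennrealI tendsto_intros pw)
      then have "(\<lambda>k. ennreal (norm (u k x - u k z) ^ n) * indicator ?Q z) \<longlonglongrightarrow> ennreal (norm (f x - f z) ^ n) * indicator ?Q z"
        by (cases "z \<in> ?Q") auto
      from lim_imp_Liminf[OF trivial_limit_sequentially this] show ?thesis by simp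
    qed
    have "(\<integral>\<^sup>+z\<in>?Q. ennreal (norm (f x - f z) ^ n) \<partial>lborel) * indicator ?Q x \<le>
       liminf (\<lambda>k. (\<integral>\<^sup>+z\<in>?Q. ennreal (norm (u k x - u k z) ^ n) \<partial>lborel) * indicator ?Q x)" for x
    proof (cases "x \<in> ?Q")
      case True
      have "(\<integral>\<^sup>+z\<in>?Q. ennreal (norm (f x - f z) ^ n) \<partial>lborel) \<le>
        (\<integral>\<^sup>+z. liminf (\<lambda>k. ennreal (norm (u k x - u k z) ^ n) * indicator ?Q z) \<partial>lborel)"
        by (intro nn_integral_mono L)
      also have "\<dots> \<le> liminf (\<lambda>k. \<integral>\<^sup>+z\<in>?Q. ennreal (norm (u k x - u k z) ^ n) \<partial>lborel)"
        by (rule nn_integral_liminf) measurable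
      finally show ?thesis using True by simp
    qed simp
    then have "double_osc n f ?Q ?Q \<le> (\<integral>\<^sup>+x. liminf (\<lambda>k. (\<integral>\<^sup>+z\<in>?Q. ennreal (norm (u k x - u k z) ^ n) \<partial>lborel) * indicator ?Q x) \<partial>lborel)"
      unfolding double_osc_def by (intro nn_integral_mono)
    also have "\<dots> \<le> liminf (\<lambda>k. double_osc n (u k) ?Q ?Q)"
      unfolding double_osc_def by (rule nn_integral_liminf) measurable
    finally show ?thesis .
  qed
  also have "\<dots> \<le> liminf (\<lambda>k. ennreal c * (deriv_energy G ?Q + \<Delta> k))"
    by (intro Liminf_mono always_eventually allI bound)
  also have "\<dots> = ennreal c * (deriv_energy G ?Q + 0)"
    using lim unfolding \<Delta>_def
    by (intro lim_imp_Liminf ennreal_tendsto_cmult tendsto_add tendsto_const) auto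
  finally show ?thesis unfolding c_def by simp
qed

section \<open>Hoelder continuity\<close>

definition cube_avg :: "(real ^ 'n::finite \<Rightarrow> real ^ 'n) \<Rightarrow> real ^ 'n \<Rightarrow> real \<Rightarrow> real ^ 'n" where
  "cube_avg f p r = (1 / (2 * r) ^ CARD('n)) *\<^sub>R integral (cube p r) f"

text \<open>Jensen's inequality for normalised Lebesgue measure on the cube.\<close>

lemma cube_avg_power_le:
  fixes f :: "real ^ 'n \<Rightarrow> real ^ 'n"
  assumes f: "continuous_on UNIV f" and r: "r > 0" and n: "n = CARD('n)"
  shows "ennreal (norm (cube_avg f p r - c) ^ n) \<le>
    ennreal (1 / (2 * r) ^ n) * (\<integral>\<^sup>+z\<in>cube p r. ennreal (norm (f z - c) ^ n) \<partial>lborel)"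
proof -
  have n1: "n \<ge> 1" by (simp add: n Suc_leI)
  have [measurable]: "f \<in> borel_measurable borel" using f by (rule borel_measurable_continuous_onI)
  define m where "m = (2 * r) ^ n"
  have m: "m > 0" using r by (simp add: m_def)
  have int: "g integrable_on cube p r" if "continuous_on UNIV g" for g :: "real ^ 'n \<Rightarrow> 'b::banach"
    unfolding cube_eq_cbox by (intro integrable_continuous continuous_on_subset[OF that]) simp
  have intn: "(\<lambda>z. norm (f z - c)) integrable_on cube p r"
    by (rule int) (intro continuous_intros f)
  have cont: "Henstock_Kurzweil_Integration.content (cube p r) = m"
  proof -
    have "ennreal (measure lborel (cube p r)) = ennreal m"
      using emeasure_cube[of r p] r unfolding m_def n
      by (metis cube_eq_cbox emeasure_eq_ennreal_measure emeasure_lborel_cbox_finite infinity_ennreal_def less_imp_le less_irrefl)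
    then show ?thesis using m by simp
  qed
  have "cube_avg f p r - c = (1 / m) *\<^sub>R integral (cube p r) (\<lambda>z. f z - c)"
  proof -
    have "integral (cube p r) (\<lambda>z. f z - c) = integral (cube p r) f - integral (cube p r) (\<lambda>z. c)"
      by (intro Henstock_Kurzweil_Integration.integral_diff int f) simp
    also have "integral (cube p r) (\<lambda>z. c) = m *\<^sub>R c"
      using cont unfolding cube_eq_cbox by simp
    moreover have "cube_avg f p r = (1 / m) *\<^sub>R integral (cube p r) f"
      unfolding cube_avg_def m_def n ..
    ultimately show ?thesis using m by (simp add: scaleR_diff_right)
  qed
  then have "norm (cube_avg f p r - c) = (1 / m) * norm (integral (cube p r) (\<lambda>z. f z - c))"
    using m by simp
  also have "\<dots> \<le> (1 / m) * integral (cube p r) (\<lambda>z. norm (f z - c))"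
    using m by (intro mult_left_mono integral_norm_bound_integral[OF int intn] continuous_intros f) auto
  finally have "ennreal (norm (cube_avg f p r - c)) \<le> ennreal ((1 / m) * integral (cube p r) (\<lambda>z. norm (f z - c)))"
    by (rule ennreal_leI)
  also have "\<dots> = ennreal (1 / m) * ennreal (integral (cube p r) (\<lambda>z. norm (f z - c)))"
    using m Henstock_Kurzweil_Integration.integral_nonneg[OF intn] by (intro ennreal_mult) auto
  also have "ennreal (integral (cube p r) (\<lambda>z. norm (f z - c))) = (\<integral>\<^sup>+z\<in>cube p r. ennreal (norm (f z - c)) \<partial>lborel)"
    using nn_integral_has_integral_lebesgue'[OF _ integrable_integral[OF intn]] by simp
  also have "ennreal (1 / m) * (\<integral>\<^sup>+z\<in>cube p r. ennreal (norm (f z - c)) \<partial>lborel)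
    = (\<integral>\<^sup>+z. (ennreal (1 / m) * indicator (cube p r) z) * ennreal (norm (f z - c)) \<partial>lborel)"
    by (subst nn_integral_cmult[symmetric]) (auto simp: mult_ac)
  finally have le: "ennreal (norm (cube_avg f p r - c)) \<le> (\<integral>\<^sup>+z. (ennreal (1 / m) * indicator (cube p r) z) * ennreal (norm (f z - c)) \<partial>lborel)" .
  have one: "(\<integral>\<^sup>+z. ennreal (1 / m) * indicator (cube p r) z \<partial>lborel) = 1"
  proof -
    have "(\<integral>\<^sup>+z. ennreal (1 / m) * indicator (cube p r) z \<partial>lborel) = ennreal (1 / m) * ennreal m"
      using r by (subst nn_integral_cmult) (auto simp: emeasure_cube m_def n)
    also have "\<dots> = 1" using m by (simp flip: ennreal_mult)
    finally show ?thesis .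
  qed
  have "ennreal (norm (cube_avg f p r - c) ^ n) = ennreal (norm (cube_avg f p r - c)) ^ n"
    by (simp add: ennreal_power)
  also have "\<dots> \<le> (\<integral>\<^sup>+z. (ennreal (1 / m) * indicator (cube p r) z) * ennreal (norm (f z - c)) \<partial>lborel) ^ n"
    by (intro power_mono le) simp
  also have "\<dots> \<le> (\<integral>\<^sup>+z. (ennreal (1 / m) * indicator (cube p r) z) * ennreal (norm (f z - c)) ^ n \<partial>lborel)"
    by (rule nn_integral_jensen_power[OF _ _ one n1]) measurable
  also have "\<dots> = ennreal (1 / m) * (\<integral>\<^sup>+z\<in>cube p r. ennreal (norm (f z - c) ^ n) \<partial>lborel)"
    by (subst nn_integral_cmult[symmetric]) (auto simp: mult_ac ennreal_power)
  finally show ?thesis by (simp add: m_def)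
qed

text \<open>The preceding bound is applied to the average over the small cube and then, with c = f
  x, to the average over the large one.\<close>

lemma cube_avg_diff_le:
  fixes f :: "real ^ 'n \<Rightarrow> real ^ 'n"
  assumes f: "continuous_on UNIV f" and r: "r > 0" "r' > 0" and n: "n = CARD('n)"
    and sub: "cube p' r' \<subseteq> cube p r"
  shows "ennreal (norm (cube_avg f p' r' - cube_avg f p r) ^ n) \<le>
    ennreal (1 / (2 * r') ^ n) * (ennreal (1 / (2 * r) ^ n) * double_osc n f (cube p r) (cube p r))"
proof -
  have [measurable]: "f \<in> borel_measurable borel" using f by (rule borel_measurable_continuous_onI)
  have "ennreal (norm (cube_avg f p' r' - cube_avg f p r) ^ n) \<le>
    ennreal (1 / (2 * r') ^ n) * (\<integral>\<^sup>+x\<in>cube p' r'. ennreal (norm (f x - cube_avg f p r) ^ n) \<partial>lborel)"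
    by (rule cube_avg_power_le[OF f r(2) n])
  also have "\<dots> \<le> ennreal (1 / (2 * r') ^ n) * (\<integral>\<^sup>+x. ennreal (1 / (2 * r) ^ n) *
      ((\<integral>\<^sup>+z\<in>cube p r. ennreal (norm (f x - f z) ^ n) \<partial>lborel) * indicator (cube p' r') x) \<partial>lborel)"
  proof (intro mult_left_mono nn_integral_mono)
    fix x
    have "ennreal (norm (f x - cube_avg f p r) ^ n) \<le>
        ennreal (1 / (2 * r) ^ n) * (\<integral>\<^sup>+z\<in>cube p r. ennreal (norm (f x - f z) ^ n) \<partial>lborel)"
      using cube_avg_power_le[OF f r(1) n, of p "f x"] by (simp add: norm_minus_commute)
    then show "ennreal (norm (f x - cube_avg f p r) ^ n) * indicator (cube p' r') x \<le> ennreal (1 / (2 * r) ^ n) *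
      ((\<integral>\<^sup>+z\<in>cube p r. ennreal (norm (f x - f z) ^ n) \<partial>lborel) * indicator (cube p' r') x)"
      by (auto simp: indicator_def)
  qed simp
  also have "(\<integral>\<^sup>+x. ennreal (1 / (2 * r) ^ n) *
      ((\<integral>\<^sup>+z\<in>cube p r. ennreal (norm (f x - f z) ^ n) \<partial>lborel) * indicator (cube p' r') x) \<partial>lborel)
      = ennreal (1 / (2 * r) ^ n) * double_osc n f (cube p' r') (cube p r)"
    unfolding double_osc_def by (rule nn_integral_cmult) measurable
  also have "ennreal (1 / (2 * r') ^ n) * (ennreal (1 / (2 * r) ^ n) * double_osc n f (cube p' r') (cube p r)) \<le>
      ennreal (1 / (2 * r') ^ n) * (ennreal (1 / (2 * r) ^ n) * double_osc n f (cube p r) (cube p r))"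
    by (intro mult_left_mono double_osc_mono sub) auto
  finally show ?thesis .
qed

lemma cube_avg_tendsto:
  fixes f :: "real ^ 'n \<Rightarrow> real ^ 'n"
  assumes f: "continuous_on UNIV f" and r: "\<And>k. r k > 0" "r \<longlonglongrightarrow> 0"
  shows "(\<lambda>k. cube_avg f p (r k)) \<longlonglongrightarrow> f p"
proof (rule tendstoI)
  fix e :: real assume e: "e > 0"
  define n where "n = CARD('n)"
  have n: "real n > 0" by (simp add: n_def)
  have "isCont f p" using f by (simp add: continuous_on_eq_continuous_at)
  then obtain d where d: "d > 0" "\<And>z. dist z p < d \<Longrightarrow> dist (f z) (f p) < e / 2"
    using e unfolding continuous_at_eps_delta by (metis half_gt_zero)
  have "\<forall>\<^sub>F k in sequentially. r k < d / (2 * n)" using d n by (intro order_tendstoD(2)[OF r(2)]) auto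
  then show "\<forall>\<^sub>F k in sequentially. dist (cube_avg f p (r k)) (f p) < e"
  proof eventually_elim
    case (elim k)
    have close: "norm (f z - f p) \<le> e / 2" if "z \<in> cube p (r k)" for z
    proof -
      have "norm (z - p) \<le> real CARD('n) * r k" by (rule norm_le_card_times) (use that in \<open>simp add: cube_def\<close>)
      also have "\<dots> \<le> n * (d / (2 * n))" unfolding n_def[symmetric] using elim by (intro mult_left_mono) auto
      also have "\<dots> < d" using d n by simp
      finally show ?thesis using d(2)[of z] by (simp add: dist_norm)
    qed
    have "ennreal (norm (cube_avg f p (r k) - f p) ^ n) \<le> ennreal (1 / (2 * r k) ^ n) * (\<integral>\<^sup>+z\<in>cube p (r k). ennreal (norm (f z - f p) ^ n) \<partial>lborel)"
      by (rule cube_avg_power_le[OF f r(1) n_def])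
    also have "\<dots> \<le> ennreal (1 / (2 * r k) ^ n) * (\<integral>\<^sup>+z. ennreal ((e / 2) ^ n) * indicator (cube p (r k)) z \<partial>lborel)"
      using close by (intro mult_left_mono nn_integral_mono) (auto simp: indicator_def intro!: ennreal_leI power_mono)
    also have "\<dots> = ennreal (1 / (2 * r k) ^ n) * (ennreal ((e / 2) ^ n) * ennreal ((2 * r k) ^ n))"
      using r(1)[of k] by (simp add: nn_integral_cmult emeasure_cube n_def)
    also have "\<dots> = ennreal ((1 / (2 * r k) ^ n) * ((e / 2) ^ n * (2 * r k) ^ n))"
      using r(1)[of k] e by (subst ennreal_mult[symmetric]; simp)+
    also have "(1 / (2 * r k) ^ n) * ((e / 2) ^ n * (2 * r k) ^ n) = (e / 2) ^ n"
      using r(1)[of k] by simp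
    finally have "norm (cube_avg f p (r k) - f p) ^ n \<le> (e / 2) ^ n"
      using e by (subst (asm) ennreal_le_iff) auto
    then have "norm (cube_avg f p (r k) - f p) \<le> e / 2"
      using e n by (subst (asm) power_mono_iff) auto
    then show ?case using e by (simp add: dist_norm)
  qed
qed

text \<open>With T = S / (1 - \<mu>), partial sums are bounded by T (\<mu>^k - \<mu>^(k+j)); this
  form reproduces itself under induction because T (1 - \<mu>) = S.\<close>

lemma dyadic_geometric_limit:
  fixes b :: "nat \<Rightarrow> 'a::real_normed_vector"
  assumes step: "\<And>k. norm (b (Suc k) - b k) \<le> S * \<mu> ^ k" and \<mu>: "0 < \<mu>" "\<mu> < 1" and lim: "b \<longlonglongrightarrow> l" and S: "S \<ge> 0"
  shows "norm (l - b k) \<le> S / (1 - \<mu>) * \<mu> ^ k"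
proof -
  define T where "T = S / (1 - \<mu>)"
  have T: "T \<ge> 0" "T * (1 - \<mu>) = S" using S \<mu> by (auto simp: T_def)
  have part: "norm (b (k + j) - b k) \<le> T * (\<mu> ^ k - \<mu> ^ (k + j))" for j
  proof (induction j)
    case (Suc j)
    have "norm (b (k + Suc j) - b k) \<le> norm (b (Suc (k + j)) - b (k + j)) + norm (b (k + j) - b k)"
      using norm_triangle_ineq[of "b (Suc (k + j)) - b (k + j)" "b (k + j) - b k"] by simp
    also have "\<dots> \<le> T * (1 - \<mu>) * \<mu> ^ (k + j) + T * (\<mu> ^ k - \<mu> ^ (k + j))"
      using step[of "k + j"] Suc T(2) by simp
    also have "\<dots> = T * (\<mu> ^ k - \<mu> ^ (k + Suc j))" by (simp add: algebra_simps)
    finally show ?case .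
  qed simp
  have "norm (b (k + j) - b k) \<le> T * \<mu> ^ k" for j
  proof -
    have "T * (\<mu> ^ k - \<mu> ^ (k + j)) \<le> T * \<mu> ^ k" using T \<mu> by (intro mult_left_mono) auto
    with part[of j] show ?thesis by linarith
  qed
  moreover have "(\<lambda>j. norm (b (k + j) - b k)) \<longlonglongrightarrow> norm (l - b k)"
    using LIMSEQ_ignore_initial_segment[OF lim, of k] by (intro tendsto_intros) (simp add: add.commute)
  ultimately show ?thesis
    unfolding T_def[symmetric] by (intro LIMSEQ_le_const2) auto
qed

theorem hoelder_of_energy_decay:
  fixes f :: "real ^ 'n \<Rightarrow> real ^ 'n"
  assumes fG: "has_moll_deriv f G" and E: "bounded E" and \<kappa>: "0 < \<kappa>" "\<kappa> < 1"
    and decay: "\<And>p r. r > 0 \<Longrightarrow> deriv_energy G (cube p r) \<le> ennreal \<kappa> * deriv_energy G (cube p (2 * r))"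
  shows "\<exists>C. \<exists>\<alpha>>0. \<forall>x\<in>E. \<forall>y\<in>E. dist (f x) (f y) \<le> C * dist x y powr \<alpha>"
proof -
  define n where "n = CARD('n)"
  have n0: "n > 0" by (simp add: n_def)
  have f: "continuous_on UNIV f" using fG by (simp add: has_moll_deriv_def)
  obtain B where B: "B > 0" "\<And>x. x \<in> E \<Longrightarrow> norm x \<le> B" using E unfolding bounded_pos by auto
  \<comment> \<open>Two points of \<open>E\<close> are at distance at most 2 B = R / 2 = r 1, so the
    dyadic comparison can start at k = 0; and the cubes of radius R about them lie in
    \<open>cube 0 (2 * R)\<close>.\<close>
  define R where "R = 4 * B"
  have R: "R > 0" using B by (simp add: R_def)
  define r where "r k = R / 2 ^ k" for k :: nat
  have r: "r k > 0" "r k = 2 * r (Suc k)" for k using R by (auto simp: r_def)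
  have limr: "r \<longlonglongrightarrow> 0" unfolding r_def
    by (rule LIMSEQ_divide_realpow_zero) simp
  have "deriv_energy G (cube 0 (2 * R)) < top" by (rule deriv_energy_finite[OF fG])
  then obtain M where M: "M \<ge> 0" "deriv_energy G (cube 0 (2 * R)) = ennreal M"
    by (metis ennreal_cases less_irrefl)
  have energy: "deriv_energy G (cube x (r k)) \<le> ennreal (\<kappa> ^ k * M)" if x: "x \<in> E" for x k
  proof (induction k)
    case 0
    have "cube x R \<subseteq> cube 0 (2 * R)"
    proof
      fix z assume z: "z \<in> cube x R"
      have "\<bar>z $ i\<bar> \<le> 2 * R" for i
      proof -
        have "\<bar>z $ i - x $ i\<bar> \<le> R" using z by (simp add: cube_def)
        moreover have "\<bar>x $ i\<bar> \<le> B" using component_le_norm_cart[of x i] B(2)[OF x] by linarith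
        ultimately show ?thesis using B unfolding R_def by linarith
      qed
      then show "z \<in> cube 0 (2 * R)" by (simp add: cube_def)
    qed
    then show ?case using deriv_energy_mono[of "cube x R" "cube 0 (2 * R)" G] M by (simp add: r_def)
  next
    case (Suc k)
    have "deriv_energy G (cube x (r (Suc k))) \<le> ennreal \<kappa> * deriv_energy G (cube x (r k))"
      using decay[OF r(1), of x "Suc k"] by (simp add: r(2)[of k])
    also have "\<dots> \<le> ennreal \<kappa> * ennreal (\<kappa> ^ k * M)" by (intro mult_left_mono Suc) auto
    also have "\<dots> = ennreal (\<kappa> ^ Suc k * M)" using \<kappa> M by (simp add: mult.assoc flip: ennreal_mult)
    finally show ?case .
  qed
  \<comment> \<open>Energy controls n-th powers of oscillations, hence the n-th root of the decay
    factor. In \<open>S\<close> below, 8 n is 2 (4 n s) / s: all powers of the radius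
    cancel.\<close>
  define \<mu> where "\<mu> = root n \<kappa>"
  define S where "S = 8 * real n * root n M"
  have \<mu>: "0 < \<mu>" "\<mu> < 1" "\<mu> ^ n = \<kappa>" using \<kappa> n0 by (auto simp: \<mu>_def)
  have S: "S \<ge> 0" "S ^ n = (8 * real n) ^ n * M"
    using M n0 by (auto simp: S_def power_mult_distrib[of "8 * real n"])
  \<comment> \<open>Two centres are allowed so that one estimate serves both for halving the radius
    at one point and for passing from x to y.\<close>
  have key: "norm (cube_avg f y (r (Suc k)) - cube_avg f x (r k)) \<le> S * \<mu> ^ k"
    if x: "x \<in> E" and sub: "cube y (r (Suc k)) \<subseteq> cube x (r k)" for x y k
  proof -
    define s where "s = r k"
    have s: "s > 0" "2 * r (Suc k) = s" unfolding s_def using r(1)[of k] r(2)[of k] by simp_all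
    have "ennreal (norm (cube_avg f y (r (Suc k)) - cube_avg f x (r k)) ^ n) \<le>
      ennreal (1 / s ^ n) * (ennreal (1 / (2 * s) ^ n) * double_osc n f (cube x s) (cube x s))"
      using cube_avg_diff_le[OF f r(1) r(1) n_def sub] s by (simp add: s_def)
    also have "\<dots> \<le> ennreal (1 / s ^ n) * (ennreal (1 / (2 * s) ^ n) *
        (ennreal ((4 * real n * s) ^ n * (2 * s) ^ n * 2 ^ n) * ennreal (\<kappa> ^ k * M)))"
      using double_osc_le_energy[OF fG n_def s(1), of x] mult_left_mono[OF energy[OF x, of k], of "ennreal ((4 * real n * s) ^ n * (2 * s) ^ n * 2 ^ n)"]
      by (intro mult_left_mono) (auto simp: s_def intro: order_trans)
    also have "\<dots> = ennreal ((1 / s ^ n) * ((1 / (2 * s) ^ n) * (((4 * real n * s) ^ n * (2 * s) ^ n * 2 ^ n) * (\<kappa> ^ k * M))))"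
      using s \<kappa> M by (subst ennreal_mult[symmetric]; simp)+
    also have "(1 / s ^ n) * ((1 / (2 * s) ^ n) * (((4 * real n * s) ^ n * (2 * s) ^ n * 2 ^ n) * (\<kappa> ^ k * M))) = (S * \<mu> ^ k) ^ n"
    proof -
      have "(1 / s ^ n) * ((1 / (2 * s) ^ n) * (((4 * real n * s) ^ n * (2 * s) ^ n * 2 ^ n) * (\<kappa> ^ k * M)))
          = ((4 * real n * s) ^ n / s ^ n * 2 ^ n) * ((2 * s) ^ n / (2 * s) ^ n) * (\<kappa> ^ k * M)"
      proof -
        have "(1 / a) * ((1 / b) * ((w * b * t) * z)) = (w / a * t) * (b / b) * z" for a b w t z :: real
          by (simp add: mult_ac)
        then show ?thesis .
      qed
      also have "(2 * s) ^ n / (2 * s) ^ n = 1" using s by simp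
      also have "(4 * real n * s) ^ n / s ^ n * 2 ^ n = (8 * real n) ^ n"
      proof -
        have "(4 * real n * s) ^ n / s ^ n = (4 * real n) ^ n" using s by (simp add: power_mult_distrib)
        moreover have "(4 * real n) ^ n * 2 ^ n = (4 * real n * 2) ^ n" by (rule power_mult_distrib[symmetric])
        ultimately show ?thesis by (simp add: mult_ac)
      qed
      also have "(8 * real n) ^ n * 1 * (\<kappa> ^ k * M) = (S * \<mu> ^ k) ^ n"
        unfolding power_mult_distrib[of S] S(2) \<mu>(3)[symmetric] by (simp add: power_mult[symmetric] mult_ac)
      finally show ?thesis .
    qed
    finally have "norm (cube_avg f y (r (Suc k)) - cube_avg f x (r k)) ^ n \<le> (S * \<mu> ^ k) ^ n"
      using S \<mu> by (subst (asm) ennreal_le_iff) auto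
    then show ?thesis using n0 S \<mu> by (subst (asm) power_mono_iff) auto
  qed
  have sub: "cube y (r (Suc k)) \<subseteq> cube x (r k)" if "dist x y \<le> r (Suc k)" for x y k
  proof
    fix z assume z: "z \<in> cube y (r (Suc k))"
    have "\<bar>z $ i - x $ i\<bar> \<le> r k" for i
    proof -
      have "\<bar>z $ i - y $ i\<bar> \<le> r (Suc k)" using z by (simp add: cube_def)
      moreover have "\<bar>x $ i - y $ i\<bar> \<le> r (Suc k)"
        using component_le_norm_cart[of "x - y" i] that by (simp add: dist_norm)
      ultimately show ?thesis unfolding r(2)[of k] by linarith
    qed
    then show "z \<in> cube x (r k)" by (simp add: cube_def)
  qed
  define T where "T = S / (1 - \<mu>)"
  have T: "T \<ge> 0" using S \<mu> by (simp add: T_def)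
  have avg: "norm (f x - cube_avg f x (r k)) \<le> T * \<mu> ^ k" if "x \<in> E" for x k
    unfolding T_def
  proof (rule dyadic_geometric_limit[OF _ \<mu>(1,2) _ S(1)])
    show "norm (cube_avg f x (r (Suc k)) - cube_avg f x (r k)) \<le> S * \<mu> ^ k" for k
      using r(1)[of "Suc k"] by (intro key that sub) simp
    show "(\<lambda>k. cube_avg f x (r k)) \<longlonglongrightarrow> f x" by (rule cube_avg_tendsto[OF f r(1) limr])
  qed
  have osc: "dist (f x) (f y) \<le> (2 * T + S) * \<mu> ^ k" if "x \<in> E" "y \<in> E" "dist x y \<le> r (Suc k)" for x y k
  proof -
    have "f x - f y = (f x - cube_avg f x (r k)) - (cube_avg f y (r (Suc k)) - cube_avg f x (r k)) - (f y - cube_avg f y (r (Suc k)))"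
      by simp
    then have "norm (f x - f y) \<le> norm (f x - cube_avg f x (r k)) + norm (cube_avg f y (r (Suc k)) - cube_avg f x (r k)) + norm (f y - cube_avg f y (r (Suc k)))"
      using norm_triangle_ineq4[of "(f x - cube_avg f x (r k)) - (cube_avg f y (r (Suc k)) - cube_avg f x (r k))" "f y - cube_avg f y (r (Suc k))"]
        norm_triangle_ineq4[of "f x - cube_avg f x (r k)" "cube_avg f y (r (Suc k)) - cube_avg f x (r k)"] by simp
    also have "\<dots> \<le> T * \<mu> ^ k + S * \<mu> ^ k + T * \<mu> ^ Suc k"
      using that by (intro add_mono avg key sub)
    also have "T * \<mu> ^ Suc k \<le> T * \<mu> ^ k" using T \<mu> by (intro mult_left_mono power_decreasing) auto
    finally show ?thesis by (simp add: dist_norm algebra_simps)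
  qed
  \<comment> \<open>Chosen so that \<mu> = 2^(-\<alpha>), which turns decay in k into a power of the
    radius.\<close>
  define \<alpha> where "\<alpha> = - log 2 \<mu>"
  have \<alpha>: "\<alpha> > 0" using \<mu> by (simp add: \<alpha>_def)
  \<comment> \<open>The factor 4 / R arises because R / 2^(k+2) < s means 2^(-k) < 4 s / R.\<close>
  define C where "C = (2 * T + S) * (4 / R) powr \<alpha>"
  have "dist (f x) (f y) \<le> C * dist x y powr \<alpha>" if xy: "x \<in> E" "y \<in> E" for x y
  proof (cases "x = y")
    case False
    define s where "s = dist x y"
    have s: "s > 0" using False by (simp add: s_def)
    have ex: "\<exists>k. r (Suc (Suc k)) < s"
    proof -
      have "\<forall>\<^sub>F k in sequentially. r k < s" using s by (intro order_tendstoD(2)[OF limr])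
      then obtain k where "\<And>j. j \<ge> k \<Longrightarrow> r j < s" by (auto simp: eventually_sequentially)
      then show ?thesis by (intro exI[of _ k]) simp
    qed
    \<comment> \<open>The least such k also satisfies s \<le> r (k + 1): for k > 0 by minimality,
      for k = 0 by the choice of \<open>R\<close>.\<close>
    define k where "k = (LEAST k. r (Suc (Suc k)) < s)"
    have k: "r (Suc (Suc k)) < s" unfolding k_def using ex by (rule LeastI_ex)
    have "s \<le> r (Suc k)"
    proof (cases k)
      case 0
      have "s \<le> norm x + norm y" unfolding s_def dist_norm by (rule norm_triangle_ineq4)
      also have "\<dots> \<le> R / 2" using B(2)[OF xy(1)] B(2)[OF xy(2)] by (simp add: R_def)
      finally show ?thesis using 0 by (simp add: r_def)
    next
      case (Suc j)
      then have "\<not> r (Suc (Suc j)) < s" using not_less_Least[of j "\<lambda>k. r (Suc (Suc k)) < s"] by (simp add: k_def)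
      then show ?thesis using Suc by simp
    qed
    then have "dist (f x) (f y) \<le> (2 * T + S) * \<mu> ^ k" using osc xy by (simp add: s_def)
    also have "\<mu> ^ k = (1 / 2 ^ k) powr \<alpha>"
    proof -
      have "\<mu> = 2 powr (- \<alpha>)" using \<mu> by (simp add: \<alpha>_def)
      then have "\<mu> ^ k = 2 powr (- \<alpha> * real k)" using \<mu> by (simp add: powr_powr flip: powr_realpow)
      also have "\<dots> = (2 powr (- real k)) powr \<alpha>" by (simp add: powr_powr mult.commute)
      also have "2 powr (- real k) = 1 / 2 ^ k" by (simp add: powr_minus powr_realpow divide_inverse)
      finally show ?thesis .
    qed
    also have "(1 / 2 ^ k) powr \<alpha> \<le> (4 / R * s) powr \<alpha>"
    proof (rule powr_mono2)
      show "1 / 2 ^ k \<le> 4 / R * s" using k R by (simp add: r_def field_simps)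
    qed (use \<alpha> in auto)
    also have "(4 / R * s) powr \<alpha> = (4 / R) powr \<alpha> * s powr \<alpha>" by (intro powr_mult)
    finally show ?thesis using T S by (simp add: C_def s_def mult_left_mono mult.assoc)
  qed simp
  then show ?thesis using \<alpha> by blast
qed

section \<open>Quasiconformal maps\<close>

lemma AE_eq_0_if_integral_cubes_eq_0:
  fixes g :: "real ^ 'n \<Rightarrow> real"
  assumes [measurable]: "g \<in> borel_measurable borel" and 0: "\<And>r. (\<integral>\<^sup>+x\<in>cube 0 r. ennreal \<bar>g x\<bar> \<partial>lborel) = 0"
  shows "AE x in lborel. g x = 0"
proof -
  have "AE x in lborel. \<forall>k::nat. ennreal \<bar>g x\<bar> * indicator (cube 0 (real k)) x = 0"
    unfolding AE_all_countable using 0 by (subst nn_integral_0_iff_AE[symmetric]) auto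
  then show ?thesis
  proof eventually_elim
    case (elim x)
    obtain k :: nat where k: "norm x \<le> real k" using real_arch_simple by blast
    have "\<bar>x $ i\<bar> \<le> real k" for i using component_le_norm_cart[of x i] k by linarith
    then have "x \<in> cube 0 (real k)" by (simp add: cube_def)
    with elim[rule_format, of k] show ?case by simp
  qed
qed

text \<open>The fundamental lemma of the calculus of variations: the mollifications of v - w vanish,
  yet converge to v - w in L^1 on cubes.\<close>

lemma eq_AE_if_moll_eq:
  fixes v w :: "real ^ 'n \<Rightarrow> real"
  assumes v: "Lp_bounded 1 v" and w: "Lp_bounded 1 w"
    and eq: "\<And>\<epsilon> \<rho> x. mollifier \<epsilon> \<rho> \<Longrightarrow> moll \<rho> v x = moll \<rho> w x"
  shows "AE x in lborel. v x = w x"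
proof -
  obtain \<rho> :: "nat \<Rightarrow> real ^ 'n \<Rightarrow> real" where \<rho>: "\<And>k. mollifier (1 / real (Suc k)) (\<rho> k)"
    using mollifier_sequence by blast
  have lim: "(\<lambda>k. 1 / real (Suc k)) \<longlonglongrightarrow> 0"
    by (rule LIMSEQ_Suc[OF lim_1_over_n])
  have vw: "Lp_bounded 1 (\<lambda>x. v x - w x)" by (rule Lp_bounded_diff[OF v w])
  have zero: "moll (\<rho> k) (\<lambda>y. v y - w y) x = 0" for k x
    using moll_diff[OF \<rho> v w, of k x] eq[OF \<rho>, of k x] by simp
  have "(\<integral>\<^sup>+x\<in>cube 0 r. ennreal \<bar>v x - w x\<bar> \<partial>lborel) = 0" for r
  proof -
    have "(\<lambda>k::nat. \<integral>\<^sup>+x\<in>cube 0 r. ennreal (\<bar>moll (\<rho> k) (\<lambda>y. v y - w y) x - (v x - w x)\<bar> ^ 1) \<partial>lborel) \<longlonglongrightarrow> 0"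
      by (rule moll_tendsto_Lp[OF vw _ \<rho> lim]) simp
    then have "(\<lambda>k::nat. \<integral>\<^sup>+x\<in>cube 0 r. ennreal \<bar>v x - w x\<bar> \<partial>lborel) \<longlonglongrightarrow> 0"
      by (simp add: zero abs_minus_commute)
    then show ?thesis by (simp add: LIMSEQ_const_iff)
  qed
  then have "AE x in lborel. v x - w x = 0"
    using vw by (intro AE_eq_0_if_integral_cubes_eq_0) (auto simp: Lp_bounded_def)
  then show ?thesis by eventually_elim simp
qed

text \<open>Quasiconformality is defined with the operator norm, the energy with the Frobenius norm;
  the factor counts the entries.\<close>

lemma norm_matrix_le_onorm: "norm (A :: real ^ 'n ^ 'n) \<le> real (CARD('n) * CARD('n)) * onorm (\<lambda>h. A *v h)"
proof -
  have "norm A \<le> (\<Sum>(j, i)\<in>UNIV. \<bar>A $ j $ i\<bar>)" by (rule norm_matrix_le_sum)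
  also have "\<dots> \<le> (\<Sum>(j, i)\<in>(UNIV :: ('n \<times> 'n) set). onorm (\<lambda>h. A *v h))"
    unfolding case_prod_unfold by (intro sum_mono matrix_component_le_onorm)
  finally show ?thesis by (simp add: case_prod_unfold)
qed

text \<open>The definition provides two weak derivatives, \<open>D\<close> locally in L^n and
  \<open>D'\<close> with the distortion inequality. They have the same mollifications, so they agree
  almost everywhere, and \<open>G\<close> is a Borel version with both properties.\<close>

lemma quasiconformal_has_moll_deriv:
  fixes f :: "real ^ 'n \<Rightarrow> real ^ 'n"
  assumes qc: "K_quasiconformal K UNIV UNIV f"
  shows "\<exists>G K'. has_moll_deriv f G \<and> K' > 0 \<and> (AE x in lborel. norm (G x) ^ CARD('n) \<le> K' * det (G x))"
proof -
  let ?n = "CARD('n)"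
  have n1: "?n \<ge> 1" by (simp add: Suc_leI)
  have K: "K \<ge> 1" using qc by (simp add: K_quasiconformal_def)
  have f: "continuous_on UNIV f" using qc by (auto simp: K_quasiconformal_def homeomorphism_def)
  obtain D where D: "weak_deriv UNIV f D" "Lp_loc (real ?n) UNIV D"
    using qc by (auto simp: K_quasiconformal_def W1p_loc_def)
  obtain D' where D': "weak_deriv UNIV f D'"
    and ae: "AE x in lebesgue. onorm (\<lambda>h. D' x *v h) ^ ?n \<le> K * det (D' x)"
    using qc by (auto simp: K_quasiconformal_def)
  have meas: "(\<lambda>x. H x $ j $ i) \<in> borel_measurable lebesgue" if "weak_deriv UNIV f H" for H j i
    using that by (intro Lp_loc_measurable[of 1]) (simp add: weak_deriv_def weak_partial_deriv_def)
  have borel: "\<exists>V. \<forall>j i. V j i \<in> borel_measurable borel \<and> (AE x in lborel. H x $ j $ i = V j i x)"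
    if "weak_deriv UNIV f H" for H
  proof -
    have "\<forall>j i. \<exists>v. v \<in> borel_measurable borel \<and> (AE x in lborel. H x $ j $ i = v x)"
      using completion_ex_borel_measurable_real[OF meas[OF that]] by auto
    then show ?thesis by metis
  qed
  obtain V where V: "\<And>j i. V j i \<in> borel_measurable borel" "\<And>j i. AE x in lborel. D x $ j $ i = V j i x"
    using borel[OF D(1)] by blast
  obtain V' where V': "\<And>j i. V' j i \<in> borel_measurable borel" "\<And>j i. AE x in lborel. D' x $ j $ i = V' j i x"
    using borel[OF D'] by blast
  have mollV: "(\<integral>y. f y $ j * partial_deriv i \<rho> (x - y) \<partial>lborel) = moll \<rho> (V j i) x" if "mollifier \<epsilon> \<rho>" for \<epsilon> \<rho> x j i
    using D(1) f that
    by (intro weak_partial_deriv_moll[OF _ _ meas[OF D(1)] V]) (auto simp: weak_deriv_def intro: continuous_intros)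
  have mollV': "(\<integral>y. f y $ j * partial_deriv i \<rho> (x - y) \<partial>lborel) = moll \<rho> (V' j i) x" if "mollifier \<epsilon> \<rho>" for \<epsilon> \<rho> x j i
    using D' f that
    by (intro weak_partial_deriv_moll[OF _ _ meas[OF D'] V']) (auto simp: weak_deriv_def intro: continuous_intros)
  have LpV: "Lp_bounded ?n (V j i)" for j i
  proof (rule Lp_bounded_if_Lp_loc[OF D(2) V(1) _ n1])
    show "AE x in lborel. \<bar>V j i x\<bar> \<le> norm (D x)"
      using V(2)[of j i] by eventually_elim (metis abs_matrix_nth_le)
  qed
  have LpV': "Lp_bounded 1 (V' j i)" for j i
  proof -
    have "Lp_loc (real 1) UNIV (\<lambda>x. D' x $ j $ i)"
      using D' by (simp add: weak_deriv_def weak_partial_deriv_def)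
    then show ?thesis
    proof (rule Lp_bounded_if_Lp_loc[OF _ V'(1)])
      show "AE x in lborel. \<bar>V' j i x\<bar> \<le> norm (D' x $ j $ i)" using V'(2)[of j i] by eventually_elim simp
    qed simp
  qed
  have VV': "AE x in lborel. V j i x = V' j i x" for j i
  proof (rule eq_AE_if_moll_eq[OF Lp_boundedD1[OF LpV n1] LpV'])
    fix \<epsilon> \<rho> x assume M: "mollifier \<epsilon> (\<rho> :: real ^ 'n \<Rightarrow> real)"
    show "moll \<rho> (V j i) x = moll \<rho> (V' j i) x" using mollV[OF M] mollV'[OF M] by metis
  qed
  have D'V: "AE x in lborel. \<forall>j i. D' x $ j $ i = V j i x"
  proof (intro eventually_all_finite)
    fix j i
    show "AE x in lborel. D' x $ j $ i = V j i x"
      using V'(2)[of j i] VV'[of j i] by eventually_elim simp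
  qed
  have ae': "AE x in lborel. onorm (\<lambda>h. D' x *v h) ^ ?n \<le> K * det (D' x)"
    using ae by (simp add: AE_completion_iff)
  define G where "G x = (\<chi> j i. V j i x)" for x
  define K' where "K' = real (?n * ?n) ^ ?n * K"
  have "AE x in lborel. norm (G x) ^ ?n \<le> K' * det (G x)"
    using D'V ae'
  proof eventually_elim
    case (elim x)
    have G: "G x = D' x" using elim(1) by (simp add: G_def vec_eq_iff)
    have "norm (G x) ^ ?n \<le> (real (?n * ?n) * onorm (\<lambda>h. D' x *v h)) ^ ?n"
      unfolding G by (intro power_mono norm_matrix_le_onorm) simp
    also have "\<dots> = real (?n * ?n) ^ ?n * onorm (\<lambda>h. D' x *v h) ^ ?n" by (rule power_mult_distrib)
    also have "\<dots> \<le> real (?n * ?n) ^ ?n * (K * det (D' x))" by (intro mult_left_mono elim(2)) simp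
    finally show ?case by (simp add: K'_def G mult.assoc)
  qed
  moreover have "has_moll_deriv f G"
    unfolding has_moll_deriv_def G_def using f LpV mollV by (simp add: eta_contract_eq)
  moreover have "K' > 0" using K by (simp add: K'_def)
  ultimately show ?thesis by blast
qed

lemma quasiconformal_hoelder:
  fixes f :: "real ^ 'n \<Rightarrow> real ^ 'n"
  assumes "CARD('n) \<ge> 2" "quasiconformal UNIV UNIV f" "bounded E"
  shows "\<exists>C. \<exists>\<alpha>>0. \<forall>x\<in>E. \<forall>y\<in>E. dist (f x) (f y) \<le> C * dist x y powr \<alpha>"
proof -
  obtain K where "K_quasiconformal K UNIV UNIV f" using assms(2) by (auto simp: quasiconformal_def)
  then obtain G K' where fG: "has_moll_deriv f G" "K' > 0" "AE x in lborel. norm (G x) ^ CARD('n) \<le> K' * det (G x)"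
    using quasiconformal_has_moll_deriv by blast
  obtain \<kappa> where "0 < \<kappa>" "\<kappa> < 1" and decay: "\<forall>p r. r > 0 \<longrightarrow> deriv_energy G (cube p r) \<le> ennreal \<kappa> * deriv_energy G (cube p (2 * r))"
    using deriv_energy_decay[OF fG(1) refl assms(1) fG(3,2)] by auto
  then show ?thesis by (intro hoelder_of_energy_decay[OF fG(1) assms(3)]) auto
qed

theorem proposition1p3:
  fixes E F :: "(real ^ 'n) set"
  assumes "CARD('n) \<ge> 2"
    and "compact E" and "compact F"
    and "hausdorff_dim E = 0" and "hausdorff_dim F = 0"
    and "hausdorff_dim E = quasi_hausdorff_dim E"
    and "hausdorff_dim F < quasi_hausdorff_dim F"
  shows "\<not> (\<exists>f :: real ^ 'n \<Rightarrow> real ^ 'n. quasiconformal UNIV UNIV f \<and> f ` E = F)"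
proof
  assume "\<exists>f :: real ^ 'n \<Rightarrow> real ^ 'n. quasiconformal UNIV UNIV f \<and> f ` E = F"
  then obtain f :: "real ^ 'n \<Rightarrow> real ^ 'n" where f: "quasiconformal UNIV UNIV f" "f ` E = F" by blast
  have bounded: "bounded E" "bounded (f ` E)" using compact_imp_bounded[OF assms(2)] compact_imp_bounded[OF assms(3)] f(2) by simp_all
  obtain C \<alpha> where \<alpha>: "\<alpha> > 0" and hoelder: "\<forall>x\<in>E. \<forall>y\<in>E. dist (f x) (f y) \<le> C * dist x y powr \<alpha>"
    using quasiconformal_hoelder[OF assms(1) f(1) bounded(1)] by blast
  have "quasi_hausdorff_dim (f ` E) \<le> quasi_hausdorff_dim E / \<alpha>"
    by (rule quasi_hausdorff_dim_hoelder_image[OF bounded \<alpha>]) (use hoelder in blast)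
  \<comment> \<open>The hypotheses give \<open>quasi_hausdorff_dim E = 0\<close>, so the bound is 0,
    against the positive value for \<open>F\<close>.\<close>
  then show False using assms(4-7) f(2) by simp
qed

end
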